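(* Let $n\ge 2$, let $\Omega$ be a bounded open subset of $\mathbb{R}^n$ and let $T\in\,]-\infty,+\infty]$. Let $\alpha,\beta\in\,]0,1[$. Then: (i) If $g\in C^{\frac{-1+\alpha}{2};\beta}(\overline{\Omega_T})$, then $\partial_t P[g]-\Delta P[g]=g$ in the sense of distributions in $\Omega_T$. (ii) $P[\cdot]$ is a bounded linear operator from $C^{\frac{-1+\alpha}{2};\beta}(\overline{\Omega_T})$ to $C^{\frac{1+\alpha}{2};1+\alpha}(\overline{\Omega_T})$.
   Context: For $\mathbb{D}\subseteq\mathbb{R}^n$ set $\mathbb{D}_T=\overline{]-\infty,T[}\times\mathbb{D}$, where the closure is taken in $\mathbb{R}$ (so it is $]-\infty,T]$ if $T<+\infty$ and $\mathbb{R}$ if $T=+\infty$); thus $\overline{\Omega_T}=\overline{]-\infty,T[}\times\overline{\Omega}$. "Distributions in $\Omega_T$" means distributions on the open set $]-\infty,T[\times\Omega$; $\Delta$ is the Laplacian in the space variables. For $\gamma,\beta\in\,]0,1[$, $C^{\gamma;\beta}(\mathbb{D}_T)$ is the space of bounded continuous functions $u:\mathbb{D}_T\to\mathbb{R}$ with $$\|u\|_{C^{\gamma;\beta}(\mathbb{D}_T)}=\sup_{\mathbb{D}_T}|u|+\sup_{t_1\ne t_2}\sup_{x\in\mathbb{D}}\frac{|u(t_1,x)-u(t_2,x)|}{|t_1-t_2|^{\gamma}}+\sup_{t}\sup_{x_1\neq x_2\in\mathbb{D}}\frac{|u(t,x_1)-u(t,x_2)|}{|x_1-x_2|^{\beta}}<+\infty,$$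 where $t,t_1,t_2$ range over $\overline{]-\infty,T[}$. For $\alpha\in\,]0,1[$, $C^{\frac{1+\alpha}{2};1+\alpha}(\overline{\Omega_T})$ is the space of bounded continuous functions $u:\overline{\Omega_T}\to\mathbb{R}$ that are continuously differentiable with respect to the space variables and such that $$\|u\|_{C^{\frac{1+\alpha}{2};1+\alpha}(\overline{\Omega_T})}=\sup_{\overline{\Omega_T}}|u|+\sup_{t_1\neq t_2}\sup_{x\in\overline{\Omega}}\frac{|u(t_1,x)-u(t_2,x)|}{|t_1-t_2|^{\frac{1+\alpha}{2}}}+\sum_{i=1}^n\|\partial_{x_i}u\|_{C^{\frac{\alpha}{2};\alpha}(\overline{\Omega_T})}<+\infty.$$ For $\gamma,\beta\in\,]0,1[$, $C^{-1+\gamma;\beta}(\overline{\Omega_T})$ is the space of distributions in $\Omega_T$ of the form $\partial_t u$ (distributional time derivative) with $u\in C^{\gamma;\beta}(\overline{\Omega_T})$, endowed with the quotient norm $\|g\|_{C^{-1+\gamma;\beta}(\overline{\Omega_T})}=\inf\{\|u\|_{C^{\gamma;\beta}(\overline{\Omega_T})}: g=\partial_t u\}$. In particular, taking $\gamma=\frac{1+\alpha}{2}$ gives $C^{\frac{-1+\alpha}{2};\beta}(\overline{\Omega_T})$. $S_n$ is the fundamental solution of the heat operator on $\mathbb{R}^{1+n}\setminus\{(0,0)\}$: $S_n(t,x)=(4\pi t)^{-n/2}e^{-|x|^2/(4t)}$ if $t>0$, and $S_n(t,x)=0$ if $t\le 0$, $(t,x)\neq(0,0)$. The heat volume potential $P[g]$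 of $g=\partial_t f\in C^{\frac{-1+\alpha}{2};\beta}(\overline{\Omega_T})$, with $f\in C^{\frac{1+\alpha}{2};\beta}(\overline{\Omega_T})$, is defined by $$P[g](t,x)=\int_{-\infty}^t\int_\Omega \partial_tS_n(t-\tau,x-y)\,\big(f(\tau,y)-f(t,y)\big)\,dy\,d\tau\qquad\forall (t,x)\in\overline{\Omega_T};$$ this does not depend on the choice of $f$ with $g=\partial_t f$. *)

theory Defs
  imports "HOL-Analysis.Analysis"
begin

section \<open>Distributions on an open subset of a Euclidean space\<close>

fun iter_deriv :: "'a list \<Rightarrow> ('a::euclidean_space \<Rightarrow> real) \<Rightarrow> 'a \<Rightarrow> real" where
  "iter_deriv [] f = f"
| "iter_deriv (b # bs) f = (\<lambda>z. frechet_derivative (iter_deriv bs f) (at z) b)"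

definition smooth :: "('a::euclidean_space \<Rightarrow> real) \<Rightarrow> bool" where
  "smooth f \<longleftrightarrow> (\<forall>bs. set bs \<subseteq> Basis \<longrightarrow> (\<forall>z. iter_deriv bs f differentiable (at z)))"

definition supp :: "('a::euclidean_space \<Rightarrow> real) \<Rightarrow> 'a set" where
  "supp f = closure {z. f z \<noteq> 0}"

definition test_functions :: "'a::euclidean_space set \<Rightarrow> ('a \<Rightarrow> real) set" where
  "test_functions U = {\<phi>. smooth \<phi> \<and> compact (supp \<phi>) \<and> supp \<phi> \<subseteq> U}"

text \<open>A distribution is represented by a functional on all functions that vanishes outside the
  test functions, so that equality of distributions is equality in HOL. Continuity is expressed by
  the usual seminorm estimates on each compact subset.\<close>

definition distributions :: "'a::euclidean_space set \<Rightarrow> (('a \<Rightarrow> real) \<Rightarrow> real) set" where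
  "distributions U = {L.
     (\<forall>\<phi>. \<phi> \<notin> test_functions U \<longrightarrow> L \<phi> = 0) \<and>
     (\<forall>\<phi>\<in>test_functions U. \<forall>\<psi>\<in>test_functions U. \<forall>a b.
        L (\<lambda>z. a * \<phi> z + b * \<psi> z) = a * L \<phi> + b * L \<psi>) \<and>
     (\<forall>K. compact K \<and> K \<subseteq> U \<longrightarrow>
        (\<exists>C N. \<forall>\<phi>\<in>test_functions U. supp \<phi> \<subseteq> K \<longrightarrow>
           \<bar>L \<phi>\<bar> \<le> C * (\<Sum>bs\<in>{bs. set bs \<subseteq> Basis \<and> length bs \<le> N}.
                              SUP z. \<bar>iter_deriv bs \<phi> z\<bar>)))}"

definition regular_distr ::
    "'a::euclidean_space set \<Rightarrow> ('a \<Rightarrow> real) \<Rightarrow> ('a \<Rightarrow> real) \<Rightarrow> real" where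
  "regular_distr U u = (\<lambda>\<phi>. if \<phi> \<in> test_functions U then (LINT z:U|lborel. u z * \<phi> z) else 0)"

definition distr_deriv ::
    "'a::euclidean_space set \<Rightarrow> 'a \<Rightarrow> (('a \<Rightarrow> real) \<Rightarrow> real) \<Rightarrow> ('a \<Rightarrow> real) \<Rightarrow> real" where
  "distr_deriv U v L =
     (\<lambda>\<phi>. if \<phi> \<in> test_functions U then - L (\<lambda>z. frechet_derivative \<phi> (at z) v) else 0)"


section \<open>Parabolic cylinders\<close>

definition time_open :: "ereal \<Rightarrow> real set" where
  "time_open T = {t. ereal t < T}"

definition time_closed :: "ereal \<Rightarrow> real set" where
  "time_closed T = closure (time_open T)"

definition open_cyl :: "ereal \<Rightarrow> (real ^ 'n) set \<Rightarrow> (real \<times> (real ^ 'n)) set" where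
  "open_cyl T \<Omega> = time_open T \<times> \<Omega>"

definition cyl :: "ereal \<Rightarrow> (real ^ 'n) set \<Rightarrow> (real \<times> (real ^ 'n)) set" where
  "cyl T D = time_closed T \<times> D"

definition distr_dt :: "ereal \<Rightarrow> (real ^ 'n) set \<Rightarrow>
    ((real \<times> (real ^ 'n) \<Rightarrow> real) \<Rightarrow> real) \<Rightarrow> (real \<times> (real ^ 'n) \<Rightarrow> real) \<Rightarrow> real" where
  "distr_dt T \<Omega> L = distr_deriv (open_cyl T \<Omega>) (1, 0) L"

definition distr_laplacian :: "ereal \<Rightarrow> (real ^ 'n) set \<Rightarrow>
    ((real \<times> (real ^ 'n) \<Rightarrow> real) \<Rightarrow> real) \<Rightarrow> (real \<times> (real ^ 'n) \<Rightarrow> real) \<Rightarrow> real" where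
  "distr_laplacian T \<Omega> L = (\<lambda>\<phi>. \<Sum>i\<in>UNIV.
     distr_deriv (open_cyl T \<Omega>) (0, axis i 1)
       (distr_deriv (open_cyl T \<Omega>) (0, axis i 1) L) \<phi>)"


section \<open>Parabolic Hoelder spaces\<close>

text \<open>Functions on a cylinder are total functions of which only the values on the cylinder matter.
  Norms take values in \<open>ennreal\<close>, the spaces being cut out by finiteness.\<close>

definition sup_norm :: "'a set \<Rightarrow> ('a \<Rightarrow> real) \<Rightarrow> ennreal" where
  "sup_norm A u = (SUP z\<in>A. ennreal \<bar>u z\<bar>)"

definition time_seminorm ::
    "ereal \<Rightarrow> (real ^ 'n) set \<Rightarrow> real \<Rightarrow> (real \<times> (real ^ 'n) \<Rightarrow> real) \<Rightarrow> ennreal" where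
  "time_seminorm T D \<gamma> u =
     (SUP (t1, t2)\<in>{(t1, t2). t1 \<in> time_closed T \<and> t2 \<in> time_closed T \<and> t1 \<noteq> t2}.
        SUP x\<in>D. ennreal (\<bar>u (t1, x) - u (t2, x)\<bar> / \<bar>t1 - t2\<bar> powr \<gamma>))"

definition space_seminorm ::
    "ereal \<Rightarrow> (real ^ 'n) set \<Rightarrow> real \<Rightarrow> (real \<times> (real ^ 'n) \<Rightarrow> real) \<Rightarrow> ennreal" where
  "space_seminorm T D \<beta> u =
     (SUP t\<in>time_closed T. SUP (x1, x2)\<in>{(x1, x2). x1 \<in> D \<and> x2 \<in> D \<and> x1 \<noteq> x2}.
        ennreal (\<bar>u (t, x1) - u (t, x2)\<bar> / norm (x1 - x2) powr \<beta>))"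

definition holder_norm ::
    "ereal \<Rightarrow> (real ^ 'n) set \<Rightarrow> real \<Rightarrow> real \<Rightarrow> (real \<times> (real ^ 'n) \<Rightarrow> real) \<Rightarrow> ennreal" where
  "holder_norm T D \<gamma> \<beta> u = sup_norm (cyl T D) u + time_seminorm T D \<gamma> u + space_seminorm T D \<beta> u"

definition holder_space ::
    "ereal \<Rightarrow> (real ^ 'n) set \<Rightarrow> real \<Rightarrow> real \<Rightarrow> (real \<times> (real ^ 'n) \<Rightarrow> real) set" where
  "holder_space T D \<gamma> \<beta> =
     {u. bounded (u ` cyl T D) \<and> continuous_on (cyl T D) u \<and> holder_norm T D \<gamma> \<beta> u < \<infinity>}"

text \<open>The space derivatives of a function on the closed cylinder are the classical ones over the
  open set \<open>\<Omega>\<close>, extended by limits from \<open>\<Omega>\<close> to boundary points. If no continuous extension to the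
  closure exists, the function below is not continuous there, whatever the junk value of
  \<open>Lim\<close>.\<close>

definition space_pderiv ::
    "(real ^ 'n) set \<Rightarrow> 'n \<Rightarrow> (real \<times> (real ^ 'n) \<Rightarrow> real) \<Rightarrow> real \<times> (real ^ 'n) \<Rightarrow> real" where
  "space_pderiv \<Omega> i u = (\<lambda>(t, x).
     let d = (\<lambda>y. frechet_derivative (\<lambda>w. u (t, w)) (at y) (axis i 1))
     in if x \<in> \<Omega> then d x else Lim (at x within \<Omega>) d)"

definition space_C1 :: "ereal \<Rightarrow> (real ^ 'n) set \<Rightarrow> (real \<times> (real ^ 'n) \<Rightarrow> real) \<Rightarrow> bool" where
  "space_C1 T \<Omega> u \<longleftrightarrow> (\<forall>t\<in>time_closed T.
     (\<forall>x\<in>\<Omega>. (\<lambda>w. u (t, w)) differentiable (at x)) \<and>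
     (\<forall>i. continuous_on (closure \<Omega>) (\<lambda>x. space_pderiv \<Omega> i u (t, x))))"

definition holder1_norm ::
    "ereal \<Rightarrow> (real ^ 'n) set \<Rightarrow> real \<Rightarrow> (real \<times> (real ^ 'n) \<Rightarrow> real) \<Rightarrow> ennreal" where
  "holder1_norm T \<Omega> \<alpha> u =
     sup_norm (cyl T (closure \<Omega>)) u
     + time_seminorm T (closure \<Omega>) ((1 + \<alpha>) / 2) u
     + (\<Sum>i\<in>UNIV. holder_norm T (closure \<Omega>) (\<alpha> / 2) \<alpha> (space_pderiv \<Omega> i u))"

definition holder1_space ::
    "ereal \<Rightarrow> (real ^ 'n) set \<Rightarrow> real \<Rightarrow> (real \<times> (real ^ 'n) \<Rightarrow> real) set" where
  "holder1_space T \<Omega> \<alpha> =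
     {u. bounded (u ` cyl T (closure \<Omega>)) \<and> continuous_on (cyl T (closure \<Omega>)) u \<and>
         space_C1 T \<Omega> u \<and>
         (\<forall>i. space_pderiv \<Omega> i u \<in> holder_space T (closure \<Omega>) (\<alpha> / 2) \<alpha>) \<and>
         holder1_norm T \<Omega> \<alpha> u < \<infinity>}"

text \<open>In the two definitions below \<open>\<gamma>\<close> is the exponent before differentiation: they describe
  the space of negative time exponent \<open>-1 + \<gamma>\<close>.\<close>

definition neg_primitives :: "ereal \<Rightarrow> (real ^ 'n) set \<Rightarrow> real \<Rightarrow> real \<Rightarrow>
    ((real \<times> (real ^ 'n) \<Rightarrow> real) \<Rightarrow> real) \<Rightarrow> (real \<times> (real ^ 'n) \<Rightarrow> real) set" where
  "neg_primitives T \<Omega> \<gamma> \<beta> g =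
     {u \<in> holder_space T (closure \<Omega>) \<gamma> \<beta>.
        g = distr_dt T \<Omega> (regular_distr (open_cyl T \<Omega>) u)}"

definition neg_holder_space :: "ereal \<Rightarrow> (real ^ 'n) set \<Rightarrow> real \<Rightarrow> real \<Rightarrow>
    ((real \<times> (real ^ 'n) \<Rightarrow> real) \<Rightarrow> real) set" where
  "neg_holder_space T \<Omega> \<gamma> \<beta> =
     {g \<in> distributions (open_cyl T \<Omega>). neg_primitives T \<Omega> \<gamma> \<beta> g \<noteq> {}}"

definition neg_holder_norm :: "ereal \<Rightarrow> (real ^ 'n) set \<Rightarrow> real \<Rightarrow> real \<Rightarrow>
    ((real \<times> (real ^ 'n) \<Rightarrow> real) \<Rightarrow> real) \<Rightarrow> ennreal" where
  "neg_holder_norm T \<Omega> \<gamma> \<beta> g =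
     (INF u\<in>neg_primitives T \<Omega> \<gamma> \<beta> g. holder_norm T (closure \<Omega>) \<gamma> \<beta> u)"


section \<open>The heat volume potential\<close>

text \<open>The (irrelevant) value at the origin is 0.\<close>

definition heat_kernel :: "real \<Rightarrow> real ^ 'n \<Rightarrow> real" where
  "heat_kernel t x =
     (if t > 0 then (4 * pi * t) powr (- real CARD('n) / 2) * exp (- (norm x)\<^sup>2 / (4 * t)) else 0)"

definition heat_potential_of ::
    "(real ^ 'n) set \<Rightarrow> (real \<times> (real ^ 'n) \<Rightarrow> real) \<Rightarrow> real \<times> (real ^ 'n) \<Rightarrow> real" where
  "heat_potential_of \<Omega> f = (\<lambda>(t, x).
     LINT \<tau>:{..<t}|lborel. LINT y:\<Omega>|lborel.
       deriv (\<lambda>s. heat_kernel s (x - y)) (t - \<tau>) * (f (\<tau>, y) - f (t, y)))"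

text \<open>The potential of \<open>g\<close> is that of any primitive \<open>f\<close> in the Hoelder space; on the closed
  cylinder it does not depend on the choice.\<close>

definition heat_potential :: "ereal \<Rightarrow> (real ^ 'n) set \<Rightarrow> real \<Rightarrow> real \<Rightarrow>
    ((real \<times> (real ^ 'n) \<Rightarrow> real) \<Rightarrow> real) \<Rightarrow> real \<times> (real ^ 'n) \<Rightarrow> real" where
  "heat_potential T \<Omega> \<alpha> \<beta> g =
     heat_potential_of \<Omega> (SOME f. f \<in> neg_primitives T \<Omega> ((1 + \<alpha>) / 2) \<beta> g)"

end

theory Submission
  imports Defs "HOL-Probability.Distributions"
begin

text \<open>Extend a primitive \<open>f\<close> of \<open>g\<close> by zero outside \<open>\<Omega>\<close> and constantly in time after \<open>T\<close>; the
  result \<open>F\<close> is bounded and Hoelder continuous in time with exponent \<open>\<gamma> = (1 + \<alpha>) / 2\<close>, uniformly in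
  space, and \<open>P[g](t, x)\<close> is the integral of \<open>\<partial>\<^sub>tS\<^sub>n(s, x - y) (F(t - s, y) - F(t, y))\<close> over \<open>s > 0\<close>
  and \<open>y \<in> \<real>\<^sup>n\<close>. All kernels that occur are bounded by a power of \<open>s\<close> times the Gaussian
  \<open>S\<^sub>n(4s, x - y)\<close>, so the estimates reduce to integrals of powers of \<open>s\<close>, split at \<open>s = |h|\<^sup>2\<close> for
  increments in space and at \<open>s = h\<close> for increments in time. The one borderline term, in the time
  estimate of \<open>P[g]\<close> itself, is computed exactly by integrating \<open>\<partial>\<^sub>tS\<^sub>n\<close> in time. For the equation, cut
  the integral off at \<open>s > \<epsilon>\<close>, test with \<open>\<phi>\<close> and exchange the integrals; Green's identity leaves a
  Gaussian average that converges to \<open>\<partial>\<^sub>t\<phi>\<close> as \<open>\<epsilon> \<rightarrow> 0\<close>. Independence of the choice of \<open>f\<close>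
  holds because two primitives differ by a function that is constant in time.\<close>

section \<open>The heat kernel and its derivatives\<close>

text \<open>A kernel bounded by \<open>s powr (- m)\<close> times a Gaussian of mass one meets the
  factor \<open>s powr \<gamma>\<close> from the time increment of \<open>F\<close>, so an integral
  near 0 needs m < \<gamma> + 1 and one near infinity needs m > \<gamma> + 1. The gradient kernel
  has m = 3/2, which is where \<gamma> > 1/2 enters; an increment by h in space gains |h| and costs
  1/2 in m, one in time gains h and costs 1. The potential and its gradient have m < \<gamma> + 1
  and an infinite past, so convergence at infinity comes from elsewhere: on a set of finite measure
  in dimension at least 2 the Gaussian has mass O(1/s). Only increments of \<open>F\<close> in time
  enter, hence the jump of the zero extension across the boundary is harmless, and the estimates
  hold at every point of the space, which later yields the boundary values of the gradient.\<close>

lemma heat_kernel_nonneg: "0 \<le> heat_kernel s z"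
  by (simp add: heat_kernel_def)

lemma heat_kernel_pos_eq:
  fixes z :: "real ^ 'n"
  shows "0 < s \<Longrightarrow> heat_kernel s z =
    (4 * pi) powr (- real CARD('n) / 2) * (s powr (- real CARD('n) / 2) * exp (- (z \<bullet> z) / (4 * s)))"
  by (simp add: heat_kernel_def power2_norm_eq_inner powr_mult mult.assoc)

text \<open>The kernel is a Gaussian law with variance \<open>2 * s\<close> in each coordinate; the
  product form reduces its total mass to one-dimensional masses.\<close>

lemma heat_kernel_eq_prod_normal_density:
  fixes z :: "real ^ 'n"
  assumes "0 < s"
  shows "heat_kernel s z = (\<Prod>b\<in>Basis. normal_density 0 (sqrt (2 * s)) (z \<bullet> b))"
proof -
  have "(\<Prod>b\<in>Basis. normal_density 0 (sqrt (2 * s)) (z \<bullet> b)) =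
    (\<Prod>b\<in>(Basis :: (real ^ 'n) set). 1 / sqrt (4 * pi * s)) * (\<Prod>b\<in>Basis. exp (- (z \<bullet> b)\<^sup>2 / (4 * s)))"
    using assms by (simp add: normal_density_def prod_dividef power_divide mult.commute mult.left_commute)
  also have "(\<Prod>b\<in>Basis. exp (- (z \<bullet> b)\<^sup>2 / (4 * s))) = exp (- (norm z)\<^sup>2 / (4 * s))"
    unfolding power2_norm_eq_inner euclidean_inner[of z z]
    by (simp add: exp_sum[symmetric] power2_eq_square sum_divide_distrib sum_negf)
  also have "(\<Prod>b\<in>(Basis :: (real ^ 'n) set). 1 / sqrt (4 * pi * s)) = (4 * pi * s) powr (- real CARD('n) / 2)"
  proof -
    have "(1 / sqrt (4 * pi * s)) = (4 * pi * s) powr (- (1 / 2))"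
      using assms by (simp add: powr_minus powr_half_sqrt field_simps)
    then have "(1 / sqrt (4 * pi * s)) ^ CARD('n) = ((4 * pi * s) powr (- (1 / 2))) ^ CARD('n)"
      by simp
    also have "\<dots> = (4 * pi * s) powr (- real CARD('n) / 2)"
      using assms by (simp add: powr_powr flip: powr_realpow)
    finally show ?thesis by simp
  qed
  finally show ?thesis using assms by (simp add: heat_kernel_def)
qed

lemma measurable_heat_kernel [measurable (raw)]:
  assumes [measurable]: "f \<in> borel_measurable M" "g \<in> borel_measurable M"
  shows "(\<lambda>w. heat_kernel (f w) (g w :: real ^ 'n)) \<in> borel_measurable M"
  unfolding heat_kernel_def by measurable

lemma nn_integral_heat_kernel:
  assumes "0 < s"
  shows "(\<integral>\<^sup>+ z. ennreal (heat_kernel s (z :: real ^ 'n)) \<partial>lborel) = 1"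
proof -
  have "(\<integral>\<^sup>+ z. ennreal (heat_kernel s (z :: real ^ 'n)) \<partial>lborel) =
      (\<integral>\<^sup>+ z. (\<Prod>b\<in>(Basis :: (real ^ 'n) set). ennreal (normal_density 0 (sqrt (2 * s)) (z \<bullet> b))) \<partial>lborel)"
    using assms by (simp add: heat_kernel_eq_prod_normal_density prod_ennreal)
  also have "\<dots> = (\<Prod>b\<in>(Basis :: (real ^ 'n) set). (\<integral>\<^sup>+ x. ennreal (normal_density 0 (sqrt (2 * s)) x) \<partial>lborel))"
    by (rule nn_integral_lborel_prod) auto
  also have "\<dots> = 1"
  proof -
    have "(\<integral>\<^sup>+ x. ennreal (normal_density 0 (sqrt (2 * s)) x) \<partial>lborel) = 1"
      using assms by (subst nn_integral_eq_integral) auto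
    then show ?thesis by simp
  qed
  finally show ?thesis .
qed

section \<open>Closed forms of the derivatives of the heat kernel\<close>

definition heat_x :: "real ^ 'n \<Rightarrow> real \<Rightarrow> real ^ 'n \<Rightarrow> real" where
  "heat_x v s z = - heat_kernel s z * (z \<bullet> v) / (2 * s)"

text \<open>Suffixes list the derivatives taken: t in time, x along a vector argument. Each closed
  form is the kernel times a polynomial in z with powers of 1/s as coefficients, so the bounds
  become estimates of polynomials.\<close>

definition heat_t :: "real \<Rightarrow> real ^ 'n \<Rightarrow> real" where
  "heat_t s z = heat_kernel s z * ((z \<bullet> z) / (4 * s\<^sup>2) - real CARD('n) / (2 * s))"

definition heat_tx :: "real ^ 'n \<Rightarrow> real \<Rightarrow> real ^ 'n \<Rightarrow> real" where
  "heat_tx v s z = heat_kernel s z * ((z \<bullet> v) * ((real CARD('n) + 2) / (4 * s\<^sup>2) - (z \<bullet> z) / (8 * s ^ 3)))"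

definition heat_txx :: "real ^ 'n \<Rightarrow> real ^ 'n \<Rightarrow> real \<Rightarrow> real ^ 'n \<Rightarrow> real" where
  "heat_txx v w s z = heat_kernel s z *
     ((v \<bullet> w) * ((real CARD('n) + 2) / (4 * s\<^sup>2) - (z \<bullet> z) / (8 * s ^ 3))
      - (z \<bullet> v) * (z \<bullet> w) / (4 * s ^ 3)
      - (z \<bullet> v) * (z \<bullet> w) / (2 * s) * ((real CARD('n) + 2) / (4 * s\<^sup>2) - (z \<bullet> z) / (8 * s ^ 3)))"

definition heat_tt :: "real \<Rightarrow> real ^ 'n \<Rightarrow> real" where
  "heat_tt s z = heat_kernel s z *
     (((z \<bullet> z) / (4 * s\<^sup>2) - real CARD('n) / (2 * s))\<^sup>2 - (z \<bullet> z) / (2 * s ^ 3) + real CARD('n) / (2 * s\<^sup>2))"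

definition heat_ttx :: "real ^ 'n \<Rightarrow> real \<Rightarrow> real ^ 'n \<Rightarrow> real" where
  "heat_ttx v s z = heat_kernel s z * ((z \<bullet> v) *
     (((z \<bullet> z) / (4 * s\<^sup>2) - real CARD('n) / (2 * s)) * ((real CARD('n) + 2) / (4 * s\<^sup>2) - (z \<bullet> z) / (8 * s ^ 3))
      + 3 * (z \<bullet> z) / (8 * s ^ 4) - (real CARD('n) + 2) / (2 * s ^ 3)))"

lemma measurable_heat_derivs [measurable (raw)]:
  assumes [measurable]: "f \<in> borel_measurable M" "g \<in> borel_measurable M"
  shows "(\<lambda>w. heat_t (f w) (g w :: real ^ 'n)) \<in> borel_measurable M"
    and "(\<lambda>w. heat_tx v (f w) (g w :: real ^ 'n)) \<in> borel_measurable M"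
    and "(\<lambda>w. heat_x v (f w) (g w :: real ^ 'n)) \<in> borel_measurable M"
  unfolding heat_t_def heat_tx_def heat_x_def by measurable

lemma DERIV_inner_line:
  "((\<lambda>r. (z + r *\<^sub>R v) \<bullet> w) has_real_derivative v \<bullet> w) (at r)"
  unfolding inner_left_distrib inner_scaleR_left by (auto intro!: derivative_eq_intros)

lemma DERIV_inner_line_self:
  "((\<lambda>r. (z + r *\<^sub>R v) \<bullet> (z + r *\<^sub>R v)) has_real_derivative 2 * ((z + r *\<^sub>R v) \<bullet> v)) (at r)"
proof -
  have eq: "(z + r *\<^sub>R v) \<bullet> (z + r *\<^sub>R v) = z \<bullet> z + 2 * r * (z \<bullet> v) + r\<^sup>2 * (v \<bullet> v)" for r
    by (simp add: inner_simps inner_commute power2_eq_square algebra_simps)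
  show ?thesis unfolding eq
    by (auto intro!: derivative_eq_intros simp: inner_simps algebra_simps)
qed

lemma DERIV_heat_kernel_t:
  assumes "0 < s"
  shows "((\<lambda>s. heat_kernel s z) has_real_derivative heat_t s z) (at s)"
proof -
  have *: "((\<lambda>s. s powr a * exp (- q / (4 * s))) has_real_derivative
      s powr a * exp (- q / (4 * s)) * (q / (4 * s\<^sup>2) + a / s)) (at s)" for a q :: real
    using assms
    by (auto intro!: derivative_eq_intros simp: powr_diff divide_simps power2_eq_square)
      (simp add: algebra_simps)
  have "((\<lambda>s. (4 * pi) powr (- real CARD('a) / 2) * (s powr (- real CARD('a) / 2) * exp (- (z \<bullet> z) / (4 * s))))
     has_real_derivative heat_t s z) (at s)"
    by (rule DERIV_cong[OF DERIV_cmult[OF *]])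
      (use assms in \<open>simp add: heat_t_def heat_kernel_pos_eq\<close>)
  then show ?thesis
    using assms by (auto elim!: has_field_derivative_transform_within_open[where S = "{0<..}"]
      simp: heat_kernel_pos_eq)
qed

lemma DERIV_heat_kernel_x:
  assumes "0 < s"
  shows "((\<lambda>r. heat_kernel s (z + r *\<^sub>R v)) has_real_derivative heat_x v s (z + r *\<^sub>R v)) (at r)"
  using assms unfolding heat_x_def heat_kernel_pos_eq[OF assms]
  by (auto intro!: derivative_eq_intros DERIV_inner_line_self simp: divide_simps)

lemma DERIV_heat_x:
  assumes "0 < s"
  shows "((\<lambda>r. heat_x v s (z + r *\<^sub>R w)) has_real_derivative
    heat_kernel s (z + r *\<^sub>R w) * (((z + r *\<^sub>R w) \<bullet> v) * ((z + r *\<^sub>R w) \<bullet> w) / (4 * s\<^sup>2) - (v \<bullet> w) / (2 * s))) (at r)"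
  using assms unfolding heat_x_def
  by (auto intro!: derivative_eq_intros DERIV_heat_kernel_x DERIV_inner_line
      simp: divide_simps heat_x_def power2_eq_square) (simp add: algebra_simps inner_commute)

lemma DERIV_heat_t_x:
  assumes "0 < s"
  shows "((\<lambda>r. heat_t s (z + r *\<^sub>R v)) has_real_derivative heat_tx v s (z + r *\<^sub>R v)) (at r)"
  using assms unfolding heat_t_def heat_tx_def
  by (auto intro!: derivative_eq_intros DERIV_heat_kernel_x DERIV_inner_line_self
      simp: divide_simps heat_x_def power2_eq_square power3_eq_cube) (simp add: algebra_simps)

lemma DERIV_heat_tx_x:
  assumes "0 < s"
  shows "((\<lambda>r. heat_tx v s (z + r *\<^sub>R w)) has_real_derivative heat_txx v w s (z + r *\<^sub>R w)) (at r)"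
  using assms unfolding heat_tx_def heat_txx_def
  by (auto intro!: derivative_eq_intros DERIV_heat_kernel_x DERIV_inner_line_self DERIV_inner_line
      simp: divide_simps heat_x_def power2_eq_square power3_eq_cube) (simp add: algebra_simps inner_commute)

lemma DERIV_heat_t_t:
  assumes "0 < s"
  shows "((\<lambda>s. heat_t s z) has_real_derivative heat_tt s z) (at s)"
proof -
  have *: "((\<lambda>s. q / (4 * s\<^sup>2) - a / (2 * s)) has_real_derivative - q / (2 * s ^ 3) + a / (2 * s\<^sup>2)) (at s)"
    for a q :: real
    by (rule DERIV_cong, rule DERIV_diff, (rule DERIV_const DERIV_divide DERIV_cmult DERIV_ident DERIV_power | (use assms in \<open>simp; fail\<close>))+)
      (use assms in \<open>auto simp: divide_simps power2_eq_square power3_eq_cube\<close>)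
  show ?thesis
    unfolding heat_t_def
    by (rule DERIV_cong[OF DERIV_mult[OF DERIV_heat_kernel_t[OF assms] *]])
      (simp add: heat_tt_def heat_t_def power2_eq_square algebra_simps)
qed

lemma DERIV_heat_tx_t:
  assumes "0 < s"
  shows "((\<lambda>s. heat_tx v s z) has_real_derivative heat_ttx v s z) (at s)"
proof -
  have *: "((\<lambda>s. a / (4 * s\<^sup>2) - q / (8 * s ^ 3)) has_real_derivative - a / (2 * s ^ 3) + 3 * q / (8 * s ^ 4)) (at s)"
    for a q :: real
    by (rule DERIV_cong, rule DERIV_diff, (rule DERIV_const DERIV_divide DERIV_cmult DERIV_ident DERIV_power | (use assms in \<open>simp; fail\<close>))+)
      (use assms in \<open>auto simp: divide_simps power2_eq_square power3_eq_cube power4_eq_xxxx algebra_simps\<close>)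
  have eq: "H * A * (c * B) + c * (- a / x + 3 * q / y) * H = H * (c * (A * B + 3 * q / y - a / x))"
    for H A c B a x q y :: real
    by (simp add: algebra_simps)
  show ?thesis
    unfolding heat_tx_def
    by (rule DERIV_cong[OF DERIV_mult[OF DERIV_heat_kernel_t[OF assms] DERIV_cmult[OF *]]])
      (simp only: heat_ttx_def heat_t_def eq)
qed

section \<open>Domination by Gaussians of a longer time\<close>

lemma heat_kernel_poly_bound:
  fixes z :: "real ^ 'n"
  assumes s: "0 < s"
  shows "heat_kernel s z * (1 + (z \<bullet> z) / s) ^ 3 \<le> 13824 * 2 powr (real CARD('n) / 2) * heat_kernel (2 * s) z"
proof -
  define u where "u = (z \<bullet> z) / s"
  have u: "0 \<le> u" using s by (simp add: u_def)
  \<comment> \<open>The inequality 1 + x <= exp x at x = u/24 makes the cube cost exp (u/8), which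
    is half of the available decay exp (-u/4); 13824 is the cube of 24.\<close>
  have "(1 + u) ^ 3 \<le> (24 * (1 + u / 24)) ^ 3"
    using u by (intro power_mono) auto
  also have "\<dots> \<le> (24 * exp (u / 24)) ^ 3"
    using u by (intro power_mono mult_left_mono exp_ge_add_one_self) auto
  also have "\<dots> = 13824 * exp (u / 24) ^ 3"
    by (simp add: power_mult_distrib)
  also have "exp (u / 24) ^ 3 = exp (u / 8)"
    by (simp flip: exp_of_nat_mult)
  finally have 1: "(1 + u) ^ 3 \<le> 13824 * exp (u / 8)" .
  have "exp (- u / 4) * (1 + u) ^ 3 \<le> exp (- u / 4) * (13824 * exp (u / 8))"
    using 1 by (intro mult_left_mono) auto
  also have "\<dots> = 13824 * exp (- u / 8)"
    by (simp flip: exp_add)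
  finally have 2: "exp (- u / 4) * (1 + u) ^ 3 \<le> 13824 * exp (- u / 8)" .
  define c where "c = (4 * pi) powr (- real CARD('n) / 2) * s powr (- real CARD('n) / 2)"
  have "0 \<le> c" by (simp add: c_def)
  have "heat_kernel s z = c * exp (- u / 4)"
    using s by (simp add: heat_kernel_pos_eq c_def u_def)
  moreover have "2 powr (real CARD('n) / 2) * heat_kernel (2 * s) z = c * exp (- u / 8)"
    using s by (simp add: heat_kernel_pos_eq c_def u_def powr_mult powr_minus field_simps)
  ultimately show ?thesis
    using mult_left_mono[OF 2 \<open>0 \<le> c\<close>] by (simp add: u_def[symmetric] mult_ac)
qed

text \<open>Mean values in time are taken at some s' between s and 2 s; this brings their Gaussians
  back to the left endpoint at the price of doubling the time once more.\<close>

lemma heat_kernel_time_bound: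
  fixes z :: "real ^ 'n"
  assumes s: "0 < s" "s \<le> s'" "s' \<le> 2 * s"
  shows "heat_kernel (2 * s') z \<le> 2 powr (real CARD('n) / 2) * heat_kernel (4 * s) z"
proof -
  have a: "(z \<bullet> z) / (16 * s) \<le> (z \<bullet> z) / (8 * s')"
    using s by (intro divide_left_mono) auto
  have b: "s' powr (- real CARD('n) / 2) \<le> s powr (- real CARD('n) / 2)"
    using s by (intro powr_mono2') auto
  have "heat_kernel (2 * s') z =
      (4 * pi) powr (- real CARD('n) / 2) * 2 powr (- real CARD('n) / 2) * (s' powr (- real CARD('n) / 2) * exp (- ((z \<bullet> z) / (8 * s'))))"
    using s by (simp add: heat_kernel_pos_eq powr_mult)
  also have "\<dots> \<le> (4 * pi) powr (- real CARD('n) / 2) * 2 powr (- real CARD('n) / 2) *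
      (s powr (- real CARD('n) / 2) * exp (- ((z \<bullet> z) / (16 * s))))"
    using a b by (intro mult_left_mono mult_mono) auto
  also have "2 powr (- real CARD('n) / 2) = 2 powr (real CARD('n) / 2) * 4 powr (- real CARD('n) / 2)"
  proof -
    have "(4::real) = 2 * 2" by simp
    then have "(4::real) powr (- real CARD('n) / 2) = 2 powr (- real CARD('n) / 2) * 2 powr (- real CARD('n) / 2)"
      by (simp only: powr_mult)
    then show ?thesis by (simp add: powr_minus)
  qed
  finally show ?thesis
    using s by (simp add: heat_kernel_pos_eq powr_mult mult_ac)
qed

text \<open>The parallelogram law gives |z|^2 <= 2 |z + h|^2 + 2 |h|^2. Doubling the time absorbs
  the factor 2, and the term 2 |h|^2 <= 2 s costs exp (1/8) <= 3.\<close>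

lemma heat_kernel_shift_bound:
  fixes z h :: "real ^ 'n"
  assumes s: "0 < s" and h: "(norm h)\<^sup>2 \<le> s"
  shows "heat_kernel (2 * s) (z + h) \<le> 3 * 2 powr (real CARD('n) / 2) * heat_kernel (4 * s) z"
proof -
  have "z \<bullet> z + (z + 2 *\<^sub>R h) \<bullet> (z + 2 *\<^sub>R h) = 2 * ((z + h) \<bullet> (z + h)) + 2 * (h \<bullet> h)"
    by (simp add: inner_simps inner_commute)
  then have "z \<bullet> z \<le> 2 * ((z + h) \<bullet> (z + h)) + 2 * (h \<bullet> h)"
    using inner_ge_zero[of "z + 2 *\<^sub>R h"] by linarith
  then have "z \<bullet> z \<le> 2 * ((z + h) \<bullet> (z + h)) + 2 * s"
    using h by (simp add: power2_norm_eq_inner)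
  then have "- ((z + h) \<bullet> (z + h)) / (8 * s) \<le> 1 / 8 + - (z \<bullet> z) / (16 * s)"
    using s by (simp add: field_simps)
  then have "exp (- ((z + h) \<bullet> (z + h)) / (8 * s)) \<le> exp (1 / 8) * exp (- (z \<bullet> z) / (16 * s))"
    by (simp flip: exp_add)
  also have "\<dots> \<le> 3 * exp (- (z \<bullet> z) / (16 * s))"
    using exp_le exp_le_cancel_iff[of "1 / 8" "1::real"] by (intro mult_right_mono) (linarith | simp)+
  finally have "exp (- ((z + h) \<bullet> (z + h)) / (8 * s)) \<le> 3 * exp (- (z \<bullet> z) / (16 * s))" .
  then have "(4 * pi) powr (- real CARD('n) / 2) * ((2 * s) powr (- real CARD('n) / 2) * exp (- ((z + h) \<bullet> (z + h)) / (8 * s)))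
     \<le> (4 * pi) powr (- real CARD('n) / 2) * ((2 * s) powr (- real CARD('n) / 2) * (3 * exp (- (z \<bullet> z) / (16 * s))))"
    by (intro mult_left_mono) auto
  then have "heat_kernel (2 * s) (z + h) \<le> 3 * heat_kernel (2 * s) (0 :: real ^ 'n) * exp (- (z \<bullet> z) / (16 * s))"
    using s by (simp add: heat_kernel_pos_eq mult_ac)
  also have "\<dots> \<le> 3 * (2 powr (real CARD('n) / 2) * heat_kernel (4 * s) (0 :: real ^ 'n)) * exp (- (z \<bullet> z) / (16 * s))"
    using heat_kernel_time_bound[of s s "0 :: real ^ 'n"] s by (intro mult_right_mono mult_left_mono) auto
  finally show ?thesis
    using s by (simp add: heat_kernel_pos_eq mult_ac)
qed

text \<open>Parabolic scaling: with a = sqrt s and r = |z| / a each kernel is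
  \<open>heat_kernel s z\<close> times a polynomial in the scaled variable over a power of a. All
  polynomials are dominated by powers of R = 1 + r^2, and the cube, which \<open>heat_ttx\<close>
  requires, is the highest. The last bound is a first moment; it serves the limit in the weak
  equation.\<close>

lemma heat_bounds:
  "\<exists>C>0. \<forall>s>0. \<forall>z v w :: real ^ 'n.
     \<bar>heat_t s z\<bar> \<le> C * s powr (-1) * heat_kernel (2 * s) z \<and>
     \<bar>heat_tx v s z\<bar> \<le> C * norm v * s powr (-3/2) * heat_kernel (2 * s) z \<and>
     \<bar>heat_txx v w s z\<bar> \<le> C * norm v * norm w * s powr (-2) * heat_kernel (2 * s) z \<and>
     \<bar>heat_tt s z\<bar> \<le> C * s powr (-2) * heat_kernel (2 * s) z \<and>
     \<bar>heat_ttx v s z\<bar> \<le> C * norm v * s powr (-5/2) * heat_kernel (2 * s) z \<and>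
     norm z * heat_kernel s z \<le> C * sqrt s * heat_kernel (2 * s) z"
proof -
  define N where "N = real CARD('n) + 2"
  \<comment> \<open>At most three summands occur, each at most N^2 R^3; the other factor is the
    constant of \<open>heat_kernel_poly_bound\<close>.\<close>
  define C where "C = 3 * N\<^sup>2 * (13824 * 2 powr (real CARD('n) / 2))"
  have N: "2 \<le> N" by (simp add: N_def)
  have nN: "real CARD('n) = N - 2" by (simp add: N_def)
  have "0 < C" using N by (simp add: C_def)
  moreover have
    "\<bar>heat_t s z\<bar> \<le> C * s powr (-1) * heat_kernel (2 * s) z \<and>
     \<bar>heat_tx v s z\<bar> \<le> C * norm v * s powr (-3/2) * heat_kernel (2 * s) z \<and>
     \<bar>heat_txx v w s z\<bar> \<le> C * norm v * norm w * s powr (-2) * heat_kernel (2 * s) z \<and>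
     \<bar>heat_tt s z\<bar> \<le> C * s powr (-2) * heat_kernel (2 * s) z \<and>
     \<bar>heat_ttx v s z\<bar> \<le> C * norm v * s powr (-5/2) * heat_kernel (2 * s) z \<and>
     norm z * heat_kernel s z \<le> C * sqrt s * heat_kernel (2 * s) z"
    if s: "0 < s" for s and z v w :: "real ^ 'n"
  proof -
    define a r where "a = sqrt s" and "r = norm z / a"
    define p p' where "p = (z \<bullet> v) / a" and "p' = (z \<bullet> w) / a"
    define R where "R = 1 + r\<^sup>2"
    have a: "0 < a" and sa: "s = a\<^sup>2" using s by (auto simp: a_def)
    have nz: "norm z = a * r" and zv: "z \<bullet> v = a * p" and zw: "z \<bullet> w = a * p'" and zz: "z \<bullet> z = a\<^sup>2 * r\<^sup>2"
      using a by (auto simp: r_def p_def p'_def power_divide power2_norm_eq_inner)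
    have r: "0 \<le> r" using a by (simp add: r_def)
    have R: "1 \<le> R" "r\<^sup>2 \<le> R" by (auto simp: R_def)
    have "2 * r \<le> R" using sum_squares_bound[of 1 r] by (simp add: R_def)
    then have rR: "r \<le> R" using r by linarith
    have p: "\<bar>p\<bar> \<le> r * norm v" "\<bar>p'\<bar> \<le> r * norm w"
      using a Cauchy_Schwarz_ineq2[of z v] Cauchy_Schwarz_ineq2[of z w] by (auto simp: p_def p'_def r_def divide_right_mono)
    have main: "\<bar>heat_kernel s z * X\<bar> \<le> C * k * heat_kernel (2 * s) z"
      if "\<bar>X\<bar> \<le> 3 * N\<^sup>2 * R ^ 3 * k" for X k
    proof -
      have k: "0 \<le> k"
      proof (rule ccontr)
        assume "\<not> 0 \<le> k"
        then have "3 * N\<^sup>2 * R ^ 3 * k < 0" using N R by (simp add: mult_pos_neg)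
        then show False using that by linarith
      qed
      have "\<bar>heat_kernel s z * X\<bar> \<le> heat_kernel s z * (3 * N\<^sup>2 * R ^ 3 * k)"
        using that by (simp add: abs_mult heat_kernel_nonneg mult_left_mono)
      also have "\<dots> = 3 * N\<^sup>2 * k * (heat_kernel s z * (1 + (z \<bullet> z) / s) ^ 3)"
        using a by (simp add: R_def zz sa)
      also have "\<dots> \<le> 3 * N\<^sup>2 * k * (13824 * 2 powr (real CARD('n) / 2) * heat_kernel (2 * s) z)"
        using k by (intro mult_left_mono heat_kernel_poly_bound s) auto
      finally show ?thesis by (simp add: C_def mult_ac)
    qed
    have pw: "s powr (-1) = 1 / a\<^sup>2" "s powr (-3/2) = 1 / a ^ 3" "s powr (-2) = 1 / a ^ 4" "s powr (-5/2) = 1 / a ^ 5"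
      using a by (simp_all add: sa powr_powr powr_minus inverse_eq_divide flip: powr_numeral)
    \<comment> \<open>A and B are the scaled brackets of \<open>heat_t\<close> and
      \<open>heat_tx\<close>; the remaining kernels are polynomials in these, p, p' and r.\<close>
    define A B where "A = r\<^sup>2 / 4 - real CARD('n) / 2" and "B = N / 4 - r\<^sup>2 / 8"
    have NR: "N \<le> N * R" "r\<^sup>2 \<le> N * R" "1 \<le> N * R"
      using N R mult_mono[of 1 N 1 R] mult_mono[of 1 N "r\<^sup>2" R] mult_left_mono[of 1 R N] by auto
    have lin: "\<bar>q / 4 - (N - 2) / 2\<bar> \<le> P \<and> \<bar>N / 4 - q / 8\<bar> \<le> P" if "N \<le> P" "q \<le> P" "1 \<le> P" "0 \<le> q" for P q :: real
      using that N unfolding diff_divide_distrib by - (intro conjI; linarith)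
    have A: "\<bar>A\<bar> \<le> N * R" and B: "\<bar>B\<bar> \<le> N * R"
      using lin[OF NR zero_le_power2] by (simp_all only: A_def B_def nN)
    have N2: "N * R ^ k \<le> N\<^sup>2 * R ^ 3" if "k \<le> 3" for k
      using N R that by (intro mult_mono power_increasing) (auto simp: power2_eq_square)
    have R3: "N\<^sup>2 * R ^ k \<le> N\<^sup>2 * R ^ 3" if "k \<le> 3" for k
      using N R that by (intro mult_mono power_increasing) (auto simp: power2_eq_square)
    have pos: "0 \<le> N\<^sup>2 * R ^ 3" using R by simp
    have le3: "x \<le> 3 * N\<^sup>2 * R ^ 3" if "x \<le> N\<^sup>2 * R ^ 3" for x
      using that pos by linarith
    have pB: "\<bar>p * Y\<bar> \<le> R * norm v * y" if "\<bar>Y\<bar> \<le> y" for Y y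
    proof -
      have "\<bar>p\<bar> \<le> R * norm v" using p(1) mult_right_mono[OF rR norm_ge_zero[of v]] by linarith
      then show ?thesis unfolding abs_mult using that R by (intro mult_mono) auto
    qed
    have X1: "\<bar>A\<bar> \<le> 3 * N\<^sup>2 * R ^ 3" 
      using A N2[of 1] by (auto intro!: le3)
    have X2: "\<bar>p * B\<bar> \<le> 3 * N\<^sup>2 * R ^ 3 * norm v"
    proof -
      have "\<bar>p * B\<bar> \<le> N * R ^ 2 * norm v" using pB[OF B] by (simp add: power2_eq_square mult_ac)
      also have "\<dots> \<le> 3 * N\<^sup>2 * R ^ 3 * norm v" using N2[of 2] by (intro mult_right_mono le3) auto
      finally show ?thesis .
    qed
    have X3: "\<bar>(v \<bullet> w) * B - p * p' / 4 - p * p' / 2 * B\<bar> \<le> 3 * N\<^sup>2 * R ^ 3 * (norm v * norm w)"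
    proof -
      have 1: "\<bar>(v \<bullet> w) * B\<bar> \<le> norm v * norm w * (N * R)"
        unfolding abs_mult using B Cauchy_Schwarz_ineq2[of v w] by (intro mult_mono) auto
      have "\<bar>p * p'\<bar> \<le> (r * norm v) * (r * norm w)"
        unfolding abs_mult using p r by (intro mult_mono) auto
      also have "\<dots> = r\<^sup>2 * (norm v * norm w)" by (simp add: power2_eq_square)
      also have "\<dots> \<le> R * (norm v * norm w)" using R by (intro mult_right_mono) auto
      finally have 2: "\<bar>p * p'\<bar> \<le> R * (norm v * norm w)" .
      have 3: "\<bar>p * p' * B\<bar> \<le> R * (norm v * norm w) * (N * R)"
        unfolding abs_mult[of "p * p'"] using 2 B R by (intro mult_mono) auto
      have tri: "\<bar>x - y / 4 - w / 2\<bar> \<le> \<bar>x\<bar> + \<bar>y\<bar> + \<bar>w\<bar>" for x y w :: real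
        by linarith
      have "\<bar>(v \<bullet> w) * B - p * p' / 4 - p * p' / 2 * B\<bar> \<le> \<bar>(v \<bullet> w) * B\<bar> + \<bar>p * p'\<bar> + \<bar>p * p' * B\<bar>"
        using tri[of "(v \<bullet> w) * B" "p * p'" "p * p' * B"] by simp
      also have "\<dots> \<le> (N * R ^ 1 + R + N * R ^ 2) * (norm v * norm w)"
        using 1 2 3 by (simp add: power2_eq_square algebra_simps)
      also have "\<dots> \<le> (3 * N\<^sup>2 * R ^ 3) * (norm v * norm w)"
      proof (intro mult_right_mono)
        have "R \<le> N * R ^ 1" using N R by simp
        then show "N * R ^ 1 + R + N * R ^ 2 \<le> 3 * N\<^sup>2 * R ^ 3"
          using N2[of 1] N2[of 2] by linarith
      qed auto
      finally show ?thesis .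
    qed
    have X4: "\<bar>A\<^sup>2 - r\<^sup>2 / 2 + real CARD('n) / 2\<bar> \<le> 3 * N\<^sup>2 * R ^ 3"
    proof -
      have "A\<^sup>2 \<le> (N * R)\<^sup>2" using power_mono[OF A abs_ge_zero, of 2] by simp
      then have "A\<^sup>2 \<le> N\<^sup>2 * R ^ 2" by (simp add: power_mult_distrib)
      have lin4: "\<bar>A' - q / 2 + (N - 2) / 2\<bar> \<le> Q + P + P" if "A' \<le> Q" "N \<le> P" "q \<le> P" "0 \<le> q" "0 \<le> A'" for A' P q Q :: real
        using that N unfolding diff_divide_distrib by linarith
      note \<open>A\<^sup>2 \<le> N\<^sup>2 * R ^ 2\<close>
      then have "\<bar>A\<^sup>2 - r\<^sup>2 / 2 + real CARD('n) / 2\<bar> \<le> N\<^sup>2 * R ^ 2 + N * R ^ 1 + N * R ^ 1"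
        using lin4[OF _ NR(1,2) zero_le_power2 zero_le_power2] by (simp add: nN)
      then show ?thesis using R3[of 2] N2[of 1] by linarith
    qed
    have X5: "\<bar>p * (A * B + 3 * r\<^sup>2 / 8 - N / 2)\<bar> \<le> 3 * N\<^sup>2 * R ^ 3 * norm v"
    proof -
      have "\<bar>A * B\<bar> \<le> (N * R) * (N * R)" unfolding abs_mult using A B by (intro mult_mono) auto
      then have AB: "\<bar>A * B\<bar> \<le> N\<^sup>2 * R ^ 2" by (simp add: power2_eq_square mult_ac)
      have tri: "\<bar>x + 3 * y / 8 - N / 2\<bar> \<le> \<bar>x\<bar> + y + N" if "0 \<le> y" for x y :: real
        using that N by linarith
      have "\<bar>A * B + 3 * r\<^sup>2 / 8 - N / 2\<bar> \<le> \<bar>A * B\<bar> + r\<^sup>2 + N" using tri by simp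
      also have "\<dots> \<le> N\<^sup>2 * R ^ 2 + N * R + N * R" using AB NR by linarith
      finally have "\<bar>p * (A * B + 3 * r\<^sup>2 / 8 - N / 2)\<bar> \<le> R * norm v * (N\<^sup>2 * R ^ 2 + N * R + N * R)"
        by (rule pB)
      also have "\<dots> = (N\<^sup>2 * R ^ 3 + 2 * (N * R ^ 2)) * norm v"
        by (simp add: algebra_simps power2_eq_square power3_eq_cube)
      also have "\<dots> \<le> (3 * N\<^sup>2 * R ^ 3) * norm v"
      proof (intro mult_right_mono)
        show "N\<^sup>2 * R ^ 3 + 2 * (N * R ^ 2) \<le> 3 * N\<^sup>2 * R ^ 3"
          using N2[of 2] by linarith
      qed auto
      finally show ?thesis .
    qed
    have X6: "r \<le> 3 * N\<^sup>2 * R ^ 3"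
    proof (rule le3)
      have "r \<le> 1 * R" using rR by simp
      also have "\<dots> \<le> N * R" using N R by (intro mult_right_mono) auto
      also have "\<dots> \<le> N\<^sup>2 * R ^ 3" using N2[of 1] by simp
      finally show "r \<le> N\<^sup>2 * R ^ 3" .
    qed
    have scale: "\<bar>X / y\<bar> \<le> c * (k * (1 / y))" if "\<bar>X\<bar> \<le> c * k" "0 < y" for X y c k :: real
      using that by (simp add: divide_right_mono)
    have "\<bar>heat_t s z\<bar> \<le> C * (1 * (1 / a\<^sup>2)) * heat_kernel (2 * s) z"
    proof -
      have eq: "heat_t s z = heat_kernel s z * (A / a\<^sup>2)"
        using a by (simp add: heat_t_def zz sa A_def field_simps power2_eq_square)
      show ?thesis unfolding eq by (rule main, rule scale) (use a X1 in simp_all)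
    qed
    moreover have "\<bar>heat_tx v s z\<bar> \<le> C * (norm v * (1 / a ^ 3)) * heat_kernel (2 * s) z"
    proof -
      have eq: "heat_tx v s z = heat_kernel s z * (p * B / a ^ 3)"
        using a by (simp add: heat_tx_def zz zv sa B_def N_def field_simps power2_eq_square power3_eq_cube)
      show ?thesis unfolding eq by (rule main, rule scale) (use a X2 in simp_all)
    qed
    moreover have "\<bar>heat_txx v w s z\<bar> \<le> C * (norm v * norm w * (1 / a ^ 4)) * heat_kernel (2 * s) z"
    proof -
      have eq: "heat_txx v w s z = heat_kernel s z * (((v \<bullet> w) * B - p * p' / 4 - p * p' / 2 * B) / a ^ 4)"
        using a by (simp add: heat_txx_def zz zv zw sa B_def N_def field_simps power2_eq_square power3_eq_cube power4_eq_xxxx)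
      show ?thesis unfolding eq by (rule main, rule scale) (use a X3 in simp_all)
    qed
    moreover have "\<bar>heat_tt s z\<bar> \<le> C * (1 * (1 / a ^ 4)) * heat_kernel (2 * s) z"
    proof -
      have eq: "heat_tt s z = heat_kernel s z * ((A\<^sup>2 - r\<^sup>2 / 2 + real CARD('n) / 2) / a ^ 4)"
        using a by (simp add: heat_tt_def zz sa A_def field_simps power2_eq_square power3_eq_cube power4_eq_xxxx)
      show ?thesis unfolding eq by (rule main, rule scale) (use a X4 in simp_all)
    qed
    moreover have "\<bar>heat_ttx v s z\<bar> \<le> C * (norm v * (1 / a ^ 5)) * heat_kernel (2 * s) z"
    proof -
      have eq: "heat_ttx v s z = heat_kernel s z * (p * (A * B + 3 * r\<^sup>2 / 8 - N / 2) / a ^ 5)"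
        using a by (simp add: heat_ttx_def zz zv sa A_def B_def N_def field_simps power2_eq_square power3_eq_cube power4_eq_xxxx numeral_eq_Suc)
      show ?thesis unfolding eq by (rule main, rule scale) (use a X5 in simp_all)
    qed
    moreover have "norm z * heat_kernel s z \<le> C * a * heat_kernel (2 * s) z"
    proof -
      have "\<bar>a * r\<bar> \<le> 3 * N\<^sup>2 * R ^ 3 * a" using X6 a r by (simp add: abs_mult mult.commute mult_left_mono)
      then have "\<bar>heat_kernel s z * (a * r)\<bar> \<le> C * a * heat_kernel (2 * s) z" by (rule main)
      then show ?thesis by (simp add: nz mult_ac)
    qed
    ultimately show ?thesis
      unfolding pw by (simp add: mult_ac a_def)
  qed
  ultimately show ?thesis by blast
qed

section \<open>Integration tools\<close>

lemma lborel_distr_reflect: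
  "distr lborel borel (\<lambda>x. c - x) = (lborel :: 'a::euclidean_space measure)"
  by (subst (2) lborel_affine[of "-1" c]) (auto simp: density_1)

lemma
  fixes f :: "'a::euclidean_space \<Rightarrow> real"
  assumes [measurable]: "f \<in> borel_measurable borel"
  shows integral_lborel_translate: "(\<integral>x. f (c + x) \<partial>lborel) = (\<integral>x. f x \<partial>lborel)"
    and integrable_lborel_translate: "integrable lborel (\<lambda>x. f (c + x)) \<longleftrightarrow> integrable lborel f"
    and integral_lborel_reflect: "(\<integral>x. f (c - x) \<partial>lborel) = (\<integral>x. f x \<partial>lborel)"
proof -
  show "(\<integral>x. f (c + x) \<partial>lborel) = (\<integral>x. f x \<partial>lborel)"
    by (subst (2) lborel_distr_plus[of c, symmetric]) (simp add: integral_distr)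
  show "integrable lborel (\<lambda>x. f (c + x)) \<longleftrightarrow> integrable lborel f"
    by (subst (2) lborel_distr_plus[of c, symmetric]) (simp add: integrable_distr_eq)
  show "(\<integral>x. f (c - x) \<partial>lborel) = (\<integral>x. f x \<partial>lborel)"
    by (subst (2) lborel_distr_reflect[of c, symmetric]) (simp add: integral_distr)
qed

lemma nn_integral_lborel_reflect:
  fixes f :: "'a::euclidean_space \<Rightarrow> ennreal"
  assumes [measurable]: "f \<in> borel_measurable borel"
  shows "(\<integral>\<^sup>+x. f (c - x) \<partial>lborel) = (\<integral>\<^sup>+x. f x \<partial>lborel)"
  by (subst (2) lborel_distr_reflect[of c, symmetric]) (simp add: nn_integral_distr)

lemma lborel_distr_reflect_fst:
  "distr lborel borel (\<lambda>p. (c - fst p, snd p)) = (lborel :: ('a::euclidean_space \<times> 'b::euclidean_space) measure)"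
proof -
  have "distr lborel borel (\<lambda>x::'a. c - x) \<Otimes>\<^sub>M distr lborel borel (\<lambda>y::'b. y) =
      distr (lborel \<Otimes>\<^sub>M lborel) (borel \<Otimes>\<^sub>M borel) (\<lambda>(x, y). (c - x, y))"
    by (rule pair_measure_distr) (auto simp: distr_id2 intro: sigma_finite_lborel)
  then show ?thesis
    by (simp add: lborel_distr_reflect distr_id2 lborel_prod borel_prod case_prod_beta')
qed

text \<open>Reversal of the time coordinate alone: it turns the lag s = t - \<tau> back into the
  time \<tau> when the truncated potential is written as a convolution.\<close>

lemma
  fixes f :: "'a::euclidean_space \<times> 'b::euclidean_space \<Rightarrow> real"
  assumes [measurable]: "f \<in> borel_measurable borel"
  shows integral_lborel_reflect_fst: "(\<integral>p. f (c - fst p, snd p) \<partial>lborel) = (\<integral>p. f p \<partial>lborel)"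
    and integrable_lborel_reflect_fst: "integrable lborel (\<lambda>p. f (c - fst p, snd p)) \<longleftrightarrow> integrable lborel f"
proof -
  have [measurable]: "(\<lambda>p::'a \<times> 'b. (c - fst p, snd p)) \<in> borel_measurable borel"
    unfolding borel_prod[symmetric] by measurable
  show "(\<integral>p. f (c - fst p, snd p) \<partial>lborel) = (\<integral>p. f p \<partial>lborel)"
    by (subst (2) lborel_distr_reflect_fst[of c, symmetric]) (simp add: integral_distr)
  show "integrable lborel (\<lambda>p. f (c - fst p, snd p)) \<longleftrightarrow> integrable lborel f"
    by (subst (2) lborel_distr_reflect_fst[of c, symmetric]) (simp add: integrable_distr_eq)
qed

text \<open>The common shape of the absolute estimates: the space integral goes first, since the
  mass of the Gaussian is known, and leaves a majorant \<open>b\<close> in the lag alone.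
  Integrability and the bound then come from one computation.\<close>

lemma Tonelli_bound:
  fixes \<Psi> :: "'a::euclidean_space \<times> 'b::euclidean_space \<Rightarrow> real"
  assumes [measurable]: "\<Psi> \<in> borel_measurable borel"
    and bnd: "\<And>s. (\<integral>\<^sup>+y. ennreal \<bar>\<Psi> (s, y)\<bar> \<partial>lborel) \<le> ennreal (b s)"
    and b: "has_bochner_integral lborel b W" and b0: "\<And>s. 0 \<le> b s"
  shows "integrable lborel \<Psi>" and "\<bar>\<integral>p. \<Psi> p \<partial>lborel\<bar> \<le> W"
proof -
  have [measurable]: "\<Psi> \<in> borel_measurable (borel \<Otimes>\<^sub>M borel)" by (simp add: borel_prod)
  have "W = (\<integral>s. b s \<partial>lborel)" using b by (simp add: has_bochner_integral_iff)
  then have W0: "0 \<le> W" using b0 by (simp add: Bochner_Integration.integral_nonneg)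
  have "(\<integral>\<^sup>+p. ennreal \<bar>\<Psi> p\<bar> \<partial>lborel) = (\<integral>\<^sup>+p. ennreal \<bar>\<Psi> p\<bar> \<partial>(lborel \<Otimes>\<^sub>M lborel))"
    by (simp add: lborel_prod)
  also have "\<dots> = (\<integral>\<^sup>+s. \<integral>\<^sup>+y. ennreal \<bar>\<Psi> (s, y)\<bar> \<partial>lborel \<partial>lborel)"
    by (subst lborel.nn_integral_fst[symmetric]) simp_all
  also have "\<dots> \<le> (\<integral>\<^sup>+s. ennreal (b s) \<partial>lborel)"
    by (intro nn_integral_mono bnd)
  also have "\<dots> = ennreal W"
    using b b0 by (subst nn_integral_eq_integral) (auto simp: has_bochner_integral_iff)
  finally have *: "(\<integral>\<^sup>+p. ennreal (norm (\<Psi> p)) \<partial>lborel) \<le> ennreal W" by simp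
  then show int: "integrable lborel \<Psi>"
    by (intro integrableI_bounded) (auto intro: order_le_less_trans)
  have "ennreal (norm (\<integral>p. \<Psi> p \<partial>lborel)) \<le> (\<integral>\<^sup>+p. ennreal (norm (\<Psi> p)) \<partial>lborel)"
    using int by (rule integral_norm_bound_ennreal)
  also note *
  finally show "\<bar>\<integral>p. \<Psi> p \<partial>lborel\<bar> \<le> W" using W0 by simp
qed

lemma Fubini_lborel:
  fixes \<Psi> :: "'a::euclidean_space \<times> 'b::euclidean_space \<Rightarrow> real"
  assumes "integrable lborel \<Psi>"
  shows "(\<integral>p. \<Psi> p \<partial>lborel) = (\<integral>s. (\<integral>y. \<Psi> (s, y) \<partial>lborel) \<partial>lborel)"
    and "(\<integral>p. \<Psi> p \<partial>lborel) = (\<integral>y. (\<integral>s. \<Psi> (s, y) \<partial>lborel) \<partial>lborel)"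
proof -
  have int: "integrable (lborel \<Otimes>\<^sub>M lborel) \<Psi>" using assms by (simp add: lborel_prod)
  show 1: "(\<integral>p. \<Psi> p \<partial>lborel) = (\<integral>s. (\<integral>y. \<Psi> (s, y) \<partial>lborel) \<partial>lborel)"
    using lborel_pair.integral_fst'[OF int] by (simp add: lborel_prod)
  then show "(\<integral>p. \<Psi> p \<partial>lborel) = (\<integral>y. (\<integral>s. \<Psi> (s, y) \<partial>lborel) \<partial>lborel)"
    using lborel_pair.Fubini_integral[of "\<lambda>s y. \<Psi> (s, y)"] int by simp
qed

section \<open>Integrals of powers and of derivatives\<close>

lemma has_bochner_integral_powr_from_0:
  fixes p a :: real
  assumes "-1 < p" "0 < a"
  shows "has_bochner_integral lborel (\<lambda>s. indicator {0<..a} s * s powr p) (a powr (p + 1) / (p + 1))"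
proof -
  have "((\<lambda>x. x powr p) has_integral (a powr (p + 1) / (p + 1))) {0..a}"
    using assms by (intro has_integral_powr_from_0) auto
  then have "((\<lambda>x. indicator {0<..a} x * x powr p) has_integral (a powr (p + 1) / (p + 1))) {0..a}"
    by (rule has_integral_eq[rotated]) (auto simp: indicator_def)
  then have "((\<lambda>x. indicator {0<..a} x * x powr p) has_integral (a powr (p + 1) / (p + 1))) UNIV"
    by (rule has_integral_on_superset) (auto simp: indicator_def)
  then have "(\<integral>\<^sup>+x. ennreal (indicator {0<..a} x * x powr p) \<partial>lborel) = ennreal (a powr (p + 1) / (p + 1))"
    using nn_integral_has_integral_lborel[of "\<lambda>x. indicator {0<..a} x * x powr p"] by simp
  then show ?thesis
    using assms by (intro has_bochner_integral_nn_integral) auto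
qed

lemma has_bochner_integral_powr_to_inf:
  fixes p a :: real
  assumes "p < -1" "0 < a"
  shows "has_bochner_integral lborel (\<lambda>s. indicator {a<..} s * s powr p) (a powr (p + 1) / (- p - 1))"
proof -
  have "((\<lambda>x. x powr p) has_integral (-(a powr (p + 1)) / (p + 1))) {a..}"
    using assms by (intro has_integral_powr_to_inf) auto
  also have "-(a powr (p + 1)) / (p + 1) = a powr (p + 1) / (- p - 1)"
    using assms by (simp add: field_simps)
  finally have "((\<lambda>x. indicator {a..} x * x powr p) has_integral (a powr (p + 1) / (- p - 1))) {a..}"
    by (rule has_integral_eq[rotated]) (auto simp: indicator_def)
  then have "((\<lambda>x. indicator {a..} x * x powr p) has_integral (a powr (p + 1) / (- p - 1))) UNIV"
    by (rule has_integral_on_superset) (auto simp: indicator_def)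
  then have "(\<integral>\<^sup>+x. ennreal (indicator {a..} x * x powr p) \<partial>lborel) = ennreal (a powr (p + 1) / (- p - 1))"
    using nn_integral_has_integral_lborel[of "\<lambda>x. indicator {a..} x * x powr p"] by simp
  then have "has_bochner_integral lborel (\<lambda>s. indicator {a..} s * s powr p) (a powr (p + 1) / (- p - 1))"
    using assms by (intro has_bochner_integral_nn_integral) auto
  \<comment> \<open>The integral was computed over the closed half-line; the endpoint is a null
    set.\<close>
  moreover have "AE s in lborel. indicator {a..} s * s powr p = indicator {a<..} s * s powr p"
    using AE_lborel_singleton[of a] by eventually_elim (auto simp: indicator_def)
  ultimately show ?thesis
    by (subst (asm) has_bochner_integral_cong_AE) auto
qed

lemma integral_derivative_to_inf:
  fixes g g' :: "real \<Rightarrow> real"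
  assumes deriv: "\<And>s. a \<le> s \<Longrightarrow> (g has_real_derivative g' s) (at s)"
    and cont: "\<And>s. a < s \<Longrightarrow> isCont g' s"
    and int: "integrable lborel (\<lambda>s. indicator {a<..} s * g' s)"
    and lim: "(g \<longlongrightarrow> 0) at_top"
  shows "(\<integral>s. indicator {a<..} s * g' s \<partial>lborel) = - g a"
proof -
  have e: "einterval (ereal a) \<infinity> = {a<..}" by (auto simp: einterval_def)
  have "(LBINT x=ereal a..\<infinity>. g' x) = 0 - g a"
  proof (rule interval_integral_FTC_integrable)
    show "((g \<circ> real_of_ereal) \<longlongrightarrow> g a) (at_right (ereal a))"
      using DERIV_isCont[OF deriv[of a]]
      by (simp add: ereal_tendsto_simps isCont_def filterlim_at_split)
    show "((g \<circ> real_of_ereal) \<longlongrightarrow> 0) (at_left \<infinity>)"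
      using lim by (simp add: ereal_tendsto_simps)
    show "set_integrable lborel (einterval (ereal a) \<infinity>) g'"
      using int unfolding e set_integrable_def by simp
  qed (use deriv cont in \<open>auto simp: has_real_derivative_iff_has_vector_derivative\<close>)
  then show ?thesis
    by (simp add: interval_lebesgue_integral_def e set_lebesgue_integral_def)
qed

text \<open>Translation invariance does the work: the difference quotients along b have integral
  zero, and dominated convergence passes to the derivative. One direction at a time suffices for the
  Laplacian.\<close>

lemma integral_directional_derivative:
  fixes h h' :: "'a::euclidean_space \<Rightarrow> real"
  assumes deriv: "\<And>x r. ((\<lambda>r. h (x + r *\<^sub>R b)) has_real_derivative h' (x + r *\<^sub>R b)) (at r)"
    and [measurable]: "h \<in> borel_measurable borel"
    and bnd: "\<And>x. \<bar>h' x\<bar> \<le> B" and supp: "\<And>x. R < norm x \<Longrightarrow> h x = 0"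
  shows "(\<integral>x. h' x \<partial>lborel) = 0"
proof -
  define q where "q k x = (h (x + (1 / real (Suc k)) *\<^sub>R b) - h x) * real (Suc k)" for k x
  have lim: "(\<lambda>k. q k x) \<longlonglongrightarrow> h' x" for x
  proof -
    have "(\<lambda>y. (h (x + y *\<^sub>R b) - h x) / y) \<midarrow>0\<rightarrow> h' x"
      using deriv[of x 0] by (simp add: DERIV_def)
    moreover have "filterlim (\<lambda>k. 1 / real (Suc k)) (at 0) sequentially"
      unfolding filterlim_at using LIMSEQ_inverse_real_of_nat by (simp add: inverse_eq_divide)
    ultimately have "(\<lambda>k. (h (x + (1 / real (Suc k)) *\<^sub>R b) - h x) / (1 / real (Suc k))) \<longlonglongrightarrow> h' x"
      by (rule filterlim_compose)
    then show ?thesis by (simp add: q_def)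
  qed
  \<comment> \<open>The steps have length at most |b|, so outside the ball of radius R + |b| both
    values of h in the quotient vanish; inside, the mean value theorem applies.\<close>
  have q_bnd: "norm (q k x) \<le> B * indicator (cball 0 (R + norm b)) x" for k x
  proof (cases "norm x \<le> R + norm b")
    case True
    define d where "d = 1 / real (Suc k)"
    have d: "0 < d" by (simp add: d_def)
    obtain \<xi> where "h (x + d *\<^sub>R b) - h (x + 0 *\<^sub>R b) = (d - 0) * h' (x + \<xi> *\<^sub>R b)"
      using MVT2[OF d, of "\<lambda>r. h (x + r *\<^sub>R b)" "\<lambda>r. h' (x + r *\<^sub>R b)"] deriv by auto
    then have "q k x = h' (x + \<xi> *\<^sub>R b)"
      using d by (simp add: q_def d_def field_simps)
    then show ?thesis using bnd True by simp
  next
    case False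
    have "norm ((1 / real (Suc k)) *\<^sub>R b) \<le> norm b"
      by (simp add: divide_le_eq mult_le_cancel_left1)
    moreover have "norm x \<le> norm (x + (1 / real (Suc k)) *\<^sub>R b) + norm ((1 / real (Suc k)) *\<^sub>R b)"
      using norm_triangle_ineq4[of "x + (1 / real (Suc k)) *\<^sub>R b" "(1 / real (Suc k)) *\<^sub>R b"] by simp
    ultimately have "R < norm (x + (1 / real (Suc k)) *\<^sub>R b)" using False by linarith
    moreover have "R < norm x" using False norm_ge_zero[of b] by linarith
    ultimately show ?thesis using False by (simp add: q_def supp)
  qed
  have dom: "integrable lborel (\<lambda>x. B * indicator (cball 0 (R + norm b)) x :: real)"
    by (intro integrable_mult_right integrable_real_indicator) (use emeasure_bounded_finite[of "cball 0 (R + norm b)"] in auto)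
  have [measurable]: "q k \<in> borel_measurable borel" for k
    unfolding q_def by measurable
  have [measurable]: "h' \<in> borel_measurable borel"
    using lim by (rule borel_measurable_LIMSEQ_real) measurable
  have "(\<lambda>k. \<integral>x. q k x \<partial>lborel) \<longlonglongrightarrow> (\<integral>x. h' x \<partial>lborel)"
    by (rule integral_dominated_convergence[OF _ _ dom]) (use lim q_bnd in auto)
  moreover have "(\<integral>x. q k x \<partial>lborel) = 0" for k
  proof -
    \<comment> \<open>Integrability of h needs a bound that is not assumed: a displacement of length
      2 (|R| + 1) along b leaves the ball and reaches a zero of h, so the mean value theorem bounds
      h through B.\<close>
    have hb: "norm (h x) \<le> (\<bar>B\<bar> * (2 * (\<bar>R\<bar> + 1)) / norm b) * indicator (cball 0 R) x" if "b \<noteq> 0" for x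
    proof (cases "norm x \<le> R")
      case True
      define d where "d = 2 * (\<bar>R\<bar> + 1) / norm b"
      have d: "0 < d" using that by (simp add: d_def)
      obtain \<xi> where \<xi>: "h (x + d *\<^sub>R b) - h (x + 0 *\<^sub>R b) = (d - 0) * h' (x + \<xi> *\<^sub>R b)"
        using MVT2[OF d, of "\<lambda>r. h (x + r *\<^sub>R b)" "\<lambda>r. h' (x + r *\<^sub>R b)"] deriv by auto
      have "norm (d *\<^sub>R b) = 2 * (\<bar>R\<bar> + 1)" using that by (simp add: d_def)
      then have "R < norm (x + d *\<^sub>R b)"
        using norm_triangle_ineq4[of "x + d *\<^sub>R b" x] True by simp
      then have "h x = - d * h' (x + \<xi> *\<^sub>R b)" using \<xi> supp by simp
      then have "\<bar>h x\<bar> \<le> d * \<bar>B\<bar>" using bnd[of "x + \<xi> *\<^sub>R b"] d by (simp add: abs_mult)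
      then show ?thesis using True by (simp add: d_def mult_ac)
    qed (simp add: supp)
    show ?thesis
    proof (cases "b = 0")
      case False
      have ih: "integrable lborel h"
        by (rule Bochner_Integration.integrable_bound[where f = "\<lambda>x. (\<bar>B\<bar> * (2 * (\<bar>R\<bar> + 1)) / norm b) * indicator (cball 0 R) x :: real"])
          (use hb[OF False] in \<open>auto intro!: integrable_mult_right integrable_real_indicator emeasure_bounded_finite AE_I2 order_trans[OF _ abs_ge_self]\<close>)
      have "(\<integral>x. h (x + (1 / real (Suc k)) *\<^sub>R b) \<partial>lborel) = (\<integral>x. h x \<partial>lborel)"
        using integral_lborel_translate[of h "(1 / real (Suc k)) *\<^sub>R b"] by (simp add: add.commute)
      moreover have "integrable lborel (\<lambda>x. h (x + (1 / real (Suc k)) *\<^sub>R b))"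
        using integrable_lborel_translate[of h "(1 / real (Suc k)) *\<^sub>R b"] ih by (simp add: add.commute)
      ultimately show ?thesis
        using ih by (simp add: q_def)
    qed (simp add: q_def)
  qed
  ultimately have "(\<lambda>k::nat. 0 :: real) \<longlonglongrightarrow> (\<integral>x. h' x \<partial>lborel)"
    by simp
  then show "(\<integral>x. h' x \<partial>lborel) = 0"
    by (simp add: LIMSEQ_const_iff)
qed

section \<open>Mass and peak of the heat kernel\<close>

lemma nn_integral_heat_kernel_reflect:
  assumes "0 < s"
  shows "(\<integral>\<^sup>+ y. ennreal (heat_kernel s (x - y :: real ^ 'n)) \<partial>lborel) = 1"
  using nn_integral_lborel_reflect[of "\<lambda>z. ennreal (heat_kernel s z)" x] nn_integral_heat_kernel[OF assms]
  by simp

lemma has_bochner_integral_heat_kernel: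
  assumes "0 < s"
  shows "has_bochner_integral lborel (\<lambda>z :: real ^ 'n. heat_kernel s z) 1"
  using nn_integral_heat_kernel[OF assms]
  by (intro has_bochner_integral_nn_integral) (auto simp: heat_kernel_nonneg)

lemma heat_kernel_convolution_bound:
  fixes f :: "real ^ 'n \<Rightarrow> real"
  assumes s: "0 < s" and [measurable]: "f \<in> borel_measurable borel" and f: "\<And>z. \<bar>f z\<bar> \<le> b"
  shows "integrable lborel (\<lambda>z. heat_kernel s z * f z)" "\<bar>\<integral>z. heat_kernel s z * f z \<partial>lborel\<bar> \<le> b"
proof -
  have H: "integrable lborel (heat_kernel s :: real ^ 'n \<Rightarrow> real)" "(\<integral>z. heat_kernel s (z :: real ^ 'n) \<partial>lborel) = 1"
    using has_bochner_integral_heat_kernel[OF s, where 'n = 'n] by (auto simp: has_bochner_integral_iff)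
  have ptw: "norm (heat_kernel s z * f z) \<le> b * heat_kernel s z" for z
    using mult_left_mono[OF f[of z] heat_kernel_nonneg[of s z]] by (simp add: abs_mult heat_kernel_nonneg mult_ac)
  show int: "integrable lborel (\<lambda>z. heat_kernel s z * f z)"
    by (rule Bochner_Integration.integrable_bound[OF integrable_mult_right[OF H(1), of b]])
      (use ptw in \<open>auto intro!: AE_I2 order_trans[OF _ abs_ge_self]\<close>)
  have "norm (\<integral>z. heat_kernel s z * f z \<partial>lborel) \<le> (\<integral>z. b * heat_kernel s (z :: real ^ 'n) \<partial>lborel)"
    using int H ptw by (intro Bochner_Integration.integral_norm_bound_integral integrable_mult_right)
  then show "\<bar>\<integral>z. heat_kernel s z * f z \<partial>lborel\<bar> \<le> b" using H by simp
qed

text \<open>The dimension enters here: the peak of the kernel has order s^(-n/2), which for n >= 2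
  and s >= 1 is at most 1/s.\<close>

lemma heat_kernel_sup_bound:
  fixes z :: "real ^ 'n"
  assumes "2 \<le> CARD('n)" "1 \<le> s"
  shows "heat_kernel s z \<le> 1 / s"
proof -
  have "heat_kernel s z \<le> (4 * pi * s) powr (- real CARD('n) / 2) * 1"
    using assms unfolding heat_kernel_def by (auto intro!: mult_left_mono)
  also have "\<dots> \<le> s powr (- real CARD('n) / 2)"
    using assms pi_ge_two by (auto intro!: powr_mono2')
  also have "\<dots> \<le> s powr (-1)"
    using assms by (intro powr_mono) auto
  finally show ?thesis using assms by (simp add: powr_minus inverse_eq_divide)
qed

text \<open>Two competing bounds: the full mass 1 for short times, peak times volume for long times.
  The resulting decay 1/s is what makes potentials with an infinite past converge.\<close>

lemma nn_integral_heat_kernel_bounded_set: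
  fixes x :: "real ^ 'n"
  assumes n: "2 \<le> CARD('n)" and s: "0 < s"
    and [measurable]: "\<Omega> \<in> sets borel" and fin: "emeasure lborel \<Omega> < \<infinity>"
  shows "(\<integral>\<^sup>+ y. ennreal (heat_kernel (4 * s) (x - y) * indicator \<Omega> y) \<partial>lborel)
    \<le> ennreal ((1 + measure lborel \<Omega>) * min 1 (1 / s))"
proof (cases "s \<le> 1")
  case True
  have "(\<integral>\<^sup>+ y. ennreal (heat_kernel (4 * s) (x - y) * indicator \<Omega> y) \<partial>lborel)
     \<le> (\<integral>\<^sup>+ y. ennreal (heat_kernel (4 * s) (x - y)) \<partial>lborel)"
    by (intro nn_integral_mono ennreal_leI) (simp add: heat_kernel_nonneg mult_left_le indicator_le_1)
  also have "\<dots> = 1" using s by (simp add: nn_integral_heat_kernel_reflect)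
  also have "\<dots> \<le> ennreal ((1 + measure lborel \<Omega>) * min 1 (1 / s))"
    using True s by (simp add: min_def ennreal_1[symmetric] del: ennreal_1)
  finally show ?thesis .
next
  case False
  have "(\<integral>\<^sup>+ y. ennreal (heat_kernel (4 * s) (x - y) * indicator \<Omega> y) \<partial>lborel)
     \<le> (\<integral>\<^sup>+ y. ennreal (1 / s) * indicator \<Omega> y \<partial>lborel)"
  proof (intro nn_integral_mono)
    fix y
    have "heat_kernel (4 * s) (x - y) \<le> 1 / (4 * s)"
      using heat_kernel_sup_bound[OF n, of "4 * s"] False by simp
    also have "\<dots> \<le> 1 / s" using s by (simp add: field_simps)
    finally show "ennreal (heat_kernel (4 * s) (x - y) * indicator \<Omega> y) \<le> ennreal (1 / s) * indicator \<Omega> y"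
      by (simp add: indicator_def ennreal_leI)
  qed
  also have "\<dots> = ennreal (1 / s) * emeasure lborel \<Omega>"
    by (simp add: nn_integral_cmult_indicator)
  also have "\<dots> = ennreal (1 / s * measure lborel \<Omega>)"
  proof -
    have "emeasure lborel \<Omega> = ennreal (measure lborel \<Omega>)"
      using fin by (intro emeasure_eq_ennreal_measure) auto
    moreover have "ennreal (1 / s * measure lborel \<Omega>) = ennreal (1 / s) * ennreal (measure lborel \<Omega>)"
      using s by (intro ennreal_mult) auto
    ultimately show ?thesis by (simp only:)
  qed
  also have "\<dots> \<le> ennreal ((1 + measure lborel \<Omega>) * min 1 (1 / s))"
    using False s by (intro ennreal_leI) (simp add: min_def field_simps)
  finally show ?thesis .
qed

section \<open>Estimates for heat potentials\<close>

lemma borel_measurable_fst_snd [measurable]: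
  "(fst :: 'a::euclidean_space \<times> 'b::euclidean_space \<Rightarrow> 'a) \<in> borel_measurable borel"
  "(snd :: 'a::euclidean_space \<times> 'b::euclidean_space \<Rightarrow> 'b) \<in> borel_measurable borel"
  by (intro borel_measurable_continuous_onI continuous_intros)+

lemma measurable_curried:
  fixes \<Phi> :: "'a::euclidean_space \<Rightarrow> 'b::euclidean_space \<Rightarrow> real"
  assumes "(\<lambda>p. \<Phi> (fst p) (snd p)) \<in> borel_measurable borel"
    and [measurable]: "f \<in> borel_measurable N" "g \<in> borel_measurable N"
  shows "(\<lambda>w. \<Phi> (f w) (g w)) \<in> borel_measurable N"
  using measurable_compose[of "\<lambda>w. (f w, g w)" N borel "\<lambda>p. \<Phi> (fst p) (snd p)" borel] assms by simp

lemma powr_add': "x powr a * x powr b = (x::real) powr (a + b)"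
  by (simp add: powr_add)

lemma heat_kernel_powr_bound:
  fixes z :: "real ^ 'n"
  assumes "0 < s"
  shows "heat_kernel s z \<le> s powr (- real CARD('n) / 2)"
proof -
  have "heat_kernel s z \<le> (4 * pi * s) powr (- real CARD('n) / 2) * 1"
    using assms unfolding heat_kernel_def by (auto intro!: mult_left_mono)
  also have "\<dots> \<le> s powr (- real CARD('n) / 2)"
    using assms pi_ge_two by (auto intro!: powr_mono2')
  finally show ?thesis .
qed

section \<open>Increments of the kernels in space and time\<close>

lemma MVT_line:
  fixes f g :: "'a::real_vector \<Rightarrow> real"
  assumes "\<And>r. ((\<lambda>r. f (z + r *\<^sub>R h)) has_real_derivative g (z + r *\<^sub>R h)) (at r)"
  obtains r where "0 < r" "r < 1" "f (z + h) - f z = g (z + r *\<^sub>R h)"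
proof -
  obtain r where "0 < r" "r < 1" "f (z + 1 *\<^sub>R h) - f (z + 0 *\<^sub>R h) = (1 - 0) * g (z + r *\<^sub>R h)"
    using MVT2[of 0 1 "\<lambda>r. f (z + r *\<^sub>R h)" "\<lambda>r. g (z + r *\<^sub>R h)"] assms by auto
  then show thesis using that by simp
qed

text \<open>The mean value theorem trades an increment for one more derivative at an intermediate
  point. The restrictions |h|^2 <= s and d <= s keep that point within the parabolic scale, so every
  Gaussian can be compared with the single one at time 4 s.\<close>

lemma heat_difference_bounds:
  "\<exists>C>0. \<forall>s>0. \<forall>z v h :: real ^ 'n.
     \<bar>heat_t s z\<bar> \<le> C * s powr (-1) * heat_kernel (4 * s) z \<and>
     \<bar>heat_tx v s z\<bar> \<le> C * norm v * s powr (-3/2) * heat_kernel (4 * s) z \<and>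
     ((norm h)\<^sup>2 \<le> s \<longrightarrow>
       \<bar>heat_tx v s (z + h) - heat_tx v s z\<bar> \<le> C * norm v * norm h * s powr (-2) * heat_kernel (4 * s) z \<and>
       \<bar>heat_t s (z + h) - heat_t s z - heat_tx h s z\<bar> \<le> C * (norm h)\<^sup>2 * s powr (-2) * heat_kernel (4 * s) z) \<and>
     (\<forall>d. 0 < d \<and> d \<le> s \<longrightarrow>
       \<bar>heat_t (s + d) z - heat_t s z\<bar> \<le> C * d * s powr (-2) * heat_kernel (4 * s) z \<and>
       \<bar>heat_tx v (s + d) z - heat_tx v s z\<bar> \<le> C * norm v * d * s powr (-5/2) * heat_kernel (4 * s) z)"
proof -
  obtain C where C: "0 < C" and bnd: "\<And>s z v w. 0 < s \<Longrightarrow>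
     \<bar>heat_t s (z :: real ^ 'n)\<bar> \<le> C * s powr (-1) * heat_kernel (2 * s) z \<and>
     \<bar>heat_tx v s z\<bar> \<le> C * norm v * s powr (-3/2) * heat_kernel (2 * s) z \<and>
     \<bar>heat_txx v w s z\<bar> \<le> C * norm v * norm w * s powr (-2) * heat_kernel (2 * s) z \<and>
     \<bar>heat_tt s z\<bar> \<le> C * s powr (-2) * heat_kernel (2 * s) z \<and>
     \<bar>heat_ttx v s z\<bar> \<le> C * norm v * s powr (-5/2) * heat_kernel (2 * s) z"
    using heat_bounds[where 'n = 'n] by blast
  define L where "L = 3 * 2 powr (real CARD('n) / 2)"
  have L: "0 < L" by (simp add: L_def)
  have shift: "heat_kernel (2 * s) (z + h) \<le> L * heat_kernel (4 * s) z"
    if "0 < s" "(norm h)\<^sup>2 \<le> s" for s and z h :: "real ^ 'n"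
    unfolding L_def using heat_kernel_shift_bound[OF that] by simp
  have time: "heat_kernel (2 * s') z \<le> L * heat_kernel (4 * s) z"
    if "0 < s" "s \<le> s'" "s' \<le> 2 * s" for s s' and z :: "real ^ 'n"
  proof -
    have "2 powr (real CARD('n) / 2) * heat_kernel (4 * s) z \<le> L * heat_kernel (4 * s) z"
      unfolding L_def by (intro mult_right_mono heat_kernel_nonneg) simp
    then show ?thesis using heat_kernel_time_bound[OF that, of z] by linarith
  qed
  have up: "x \<le> (C * L) * k * heat_kernel (4 * s) z"
    if "x \<le> C * k * H" "H \<le> L * heat_kernel (4 * s) z" "0 \<le> k" for x k H s and z :: "real ^ 'n"
  proof -
    have "C * k * H \<le> C * k * (L * heat_kernel (4 * s) z)"
      using that C by (intro mult_left_mono) auto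
    then show ?thesis using that(1) by (simp add: mult_ac)
  qed
  have "\<bar>heat_t s z\<bar> \<le> (C * L) * s powr (-1) * heat_kernel (4 * s) z"
    "\<bar>heat_tx v s z\<bar> \<le> (C * L) * (norm v * s powr (-3/2)) * heat_kernel (4 * s) z"
    if s: "0 < s" for s and z v :: "real ^ 'n"
    using bnd[OF s, of z v] time[OF s, of s z] s by (intro up[where H = "heat_kernel (2 * s) z"]; simp add: mult.assoc)+
  moreover have space: "\<bar>heat_tx v s (z + h) - heat_tx v s z\<bar> \<le> (C * L) * (norm v * norm h * s powr (-2)) * heat_kernel (4 * s) z"
    if s: "0 < s" and h: "(norm h)\<^sup>2 \<le> s" for s and z v h :: "real ^ 'n"
  proof -
    obtain r where r: "0 < r" "r < 1" and
      eq: "heat_tx v s (z + h) - heat_tx v s z = heat_txx v h s (z + r *\<^sub>R h)"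
      using MVT_line[of "heat_tx v s" z h "heat_txx v h s"] DERIV_heat_tx_x[OF s] by blast
    have "norm (r *\<^sub>R h) \<le> norm h" using r by (simp add: mult_left_le_one_le)
    then have le: "(norm (r *\<^sub>R h))\<^sup>2 \<le> (norm h)\<^sup>2" by (intro power_mono) auto
    then have "heat_kernel (2 * s) (z + r *\<^sub>R h) \<le> L * heat_kernel (4 * s) z"
      by (intro shift s order_trans[OF le h])
    then show ?thesis
      using bnd[OF s, of "z + r *\<^sub>R h" v h] eq
      by (intro up[where H = "heat_kernel (2 * s) (z + r *\<^sub>R h)"]) (auto simp: mult.assoc)
  qed
  moreover have "\<bar>heat_t s (z + h) - heat_t s z - heat_tx h s z\<bar> \<le> (C * L) * ((norm h)\<^sup>2 * s powr (-2)) * heat_kernel (4 * s) z"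
    if s: "0 < s" and h: "(norm h)\<^sup>2 \<le> s" for s and z h :: "real ^ 'n"
  proof -
    \<comment> \<open>The second order remainder is an increment of the first derivative, so the
      preceding estimate applies with the shift \<open>r *\<^sub>R h\<close>.\<close>
    obtain r where r: "0 < r" "r < 1" and
      eq: "heat_t s (z + h) - heat_t s z = heat_tx h s (z + r *\<^sub>R h)"
      using MVT_line[of "heat_t s" z h "heat_tx h s"] DERIV_heat_t_x[OF s] by blast
    have nr: "norm (r *\<^sub>R h) \<le> norm h" using r by (simp add: mult_left_le_one_le)
    then have le: "(norm (r *\<^sub>R h))\<^sup>2 \<le> (norm h)\<^sup>2" by (intro power_mono) auto
    then have "\<bar>heat_tx h s (z + r *\<^sub>R h) - heat_tx h s z\<bar>
        \<le> (C * L) * (norm h * norm (r *\<^sub>R h) * s powr (-2)) * heat_kernel (4 * s) z"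
      by (intro space s order_trans[OF le h])
    also have "\<dots> \<le> (C * L) * (norm h * norm h * s powr (-2)) * heat_kernel (4 * s) z"
      using nr C L by (intro mult_right_mono mult_left_mono heat_kernel_nonneg) auto
    finally show ?thesis using eq by (simp add: power2_eq_square)
  qed
  moreover have "\<bar>heat_t (s + d) z - heat_t s z\<bar> \<le> (C * L) * (d * s powr (-2)) * heat_kernel (4 * s) z"
    if s: "0 < s" and d: "0 < d" "d \<le> s" for s d and z :: "real ^ 'n"
  proof -
    obtain r where r: "s < r" "r < s + d" and eq: "heat_t (s + d) z - heat_t s z = (s + d - s) * heat_tt r z"
    proof -
      have "\<exists>r>s. r < s + d \<and> heat_t (s + d) z - heat_t s z = (s + d - s) * heat_tt r z"
        using s d by (intro MVT2[of s "s + d" "\<lambda>s. heat_t s z" "\<lambda>s. heat_tt s z"] DERIV_heat_t_t) auto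
      then show ?thesis using that by blast
    qed
    have "heat_kernel (2 * r) z \<le> L * heat_kernel (4 * s) z" using s r d by (intro time) auto
    moreover have "\<bar>heat_tt r z\<bar> \<le> C * s powr (-2) * heat_kernel (2 * r) z"
    proof -
      have "\<bar>heat_tt r z\<bar> \<le> C * r powr (-2) * heat_kernel (2 * r) z" using bnd[of r z] s r by auto
      also have "\<dots> \<le> C * s powr (-2) * heat_kernel (2 * r) z"
        using C s r by (intro mult_right_mono mult_left_mono heat_kernel_nonneg powr_mono2') auto
      finally show ?thesis .
    qed
    then have "d * \<bar>heat_tt r z\<bar> \<le> d * (C * s powr (-2) * heat_kernel (2 * r) z)"
      using d by (intro mult_left_mono) auto
    then have "\<bar>heat_t (s + d) z - heat_t s z\<bar> \<le> C * (d * s powr (-2)) * heat_kernel (2 * r) z"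
      unfolding eq using d by (simp add: abs_mult mult_ac)
    ultimately show ?thesis using d by (intro up) auto
  qed
  moreover have "\<bar>heat_tx v (s + d) z - heat_tx v s z\<bar> \<le> (C * L) * (norm v * d * s powr (-5/2)) * heat_kernel (4 * s) z"
    if s: "0 < s" and d: "0 < d" "d \<le> s" for s d and z v :: "real ^ 'n"
  proof -
    obtain r where r: "s < r" "r < s + d" and eq: "heat_tx v (s + d) z - heat_tx v s z = (s + d - s) * heat_ttx v r z"
    proof -
      have "\<exists>r>s. r < s + d \<and> heat_tx v (s + d) z - heat_tx v s z = (s + d - s) * heat_ttx v r z"
        using s d by (intro MVT2[of s "s + d" "\<lambda>s. heat_tx v s z" "\<lambda>s. heat_ttx v s z"] DERIV_heat_tx_t) auto
      then show ?thesis using that by blast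
    qed
    have "heat_kernel (2 * r) z \<le> L * heat_kernel (4 * s) z" using s r d by (intro time) auto
    moreover have "\<bar>heat_ttx v r z\<bar> \<le> C * norm v * s powr (-5/2) * heat_kernel (2 * r) z"
    proof -
      have "\<bar>heat_ttx v r z\<bar> \<le> C * norm v * r powr (-5/2) * heat_kernel (2 * r) z" using bnd[of r z v] s r by auto
      also have "\<dots> \<le> C * norm v * s powr (-5/2) * heat_kernel (2 * r) z"
        using C s r by (intro mult_right_mono mult_left_mono heat_kernel_nonneg powr_mono2') auto
      finally show ?thesis .
    qed
    then have "d * \<bar>heat_ttx v r z\<bar> \<le> d * (C * norm v * s powr (-5/2) * heat_kernel (2 * r) z)"
      using d by (intro mult_left_mono) auto
    then have "\<bar>heat_tx v (s + d) z - heat_tx v s z\<bar> \<le> C * (norm v * d * s powr (-5/2)) * heat_kernel (2 * r) z"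
      unfolding eq using d by (simp add: abs_mult mult_ac)
    ultimately show ?thesis using d by (intro up) auto
  qed
  moreover have "0 < C * L" using C L by simp
  ultimately show ?thesis
    by (intro exI[of _ "C * L"]) (simp add: mult.assoc)
qed

section \<open>Absolute bounds for potentials of densities that are Hoelder in time\<close>

locale heat_domain =
  fixes \<Omega> :: "(real ^ 'n) set" and \<gamma> :: real
  assumes card: "2 \<le> CARD('n)" and Om [measurable]: "\<Omega> \<in> sets borel"
    and fin: "emeasure lborel \<Omega> < \<infinity>" and \<gamma>: "1/2 < \<gamma>" "\<gamma> < 1"
begin

text \<open>One number M serves as sup bound and as Hoelder constant in time. Vanishing off \<Omega>
  lets the space integrals run over the whole space, where Gaussians have mass 1, and still allows
  the finite measure of \<Omega> to be exploited.\<close>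

definition holder_density :: "real \<Rightarrow> (real \<times> (real ^ 'n) \<Rightarrow> real) \<Rightarrow> bool" where
  "holder_density M F \<longleftrightarrow> F \<in> borel_measurable borel \<and> (\<forall>z. \<bar>F z\<bar> \<le> M) \<and>
     (\<forall>t y. y \<notin> \<Omega> \<longrightarrow> F (t, y) = 0) \<and>
     (\<forall>t t' y. \<bar>F (t, y) - F (t', y)\<bar> \<le> M * \<bar>t - t'\<bar> powr \<gamma>)"

text \<open>Written in the lag s = t - \<tau>, so that the kernel does not depend on t and every
  cut-off is a set I of lags. The kernel is a parameter because the same bounds serve the time
  derivative, its gradient and their increments.\<close>

definition integrand :: "real set \<Rightarrow> (real \<Rightarrow> real ^ 'n \<Rightarrow> real) \<Rightarrow> (real \<times> (real ^ 'n) \<Rightarrow> real) \<Rightarrow> real \<Rightarrow> real ^ 'n \<Rightarrow>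
    real \<times> (real ^ 'n) \<Rightarrow> real" where
  "integrand I \<Phi> F t x p =
     indicator I (fst p) * \<Phi> (fst p) (x - snd p) * (F (t - fst p, snd p) - F (t, snd p))"

definition pot :: "real set \<Rightarrow> (real \<Rightarrow> real ^ 'n \<Rightarrow> real) \<Rightarrow> (real \<times> (real ^ 'n) \<Rightarrow> real) \<Rightarrow> real \<Rightarrow> real ^ 'n \<Rightarrow> real" where
  "pot I \<Phi> F t x = (\<integral>p. integrand I \<Phi> F t x p \<partial>lborel)"

lemma holder_densityD:
  assumes "holder_density M F"
  shows "F \<in> borel_measurable borel" "\<bar>F z\<bar> \<le> M" "y \<notin> \<Omega> \<Longrightarrow> F (t, y) = 0"
    "\<bar>F (t, y) - F (t', y)\<bar> \<le> M * \<bar>t - t'\<bar> powr \<gamma>" "0 \<le> M"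
proof -
  show "0 \<le> M" using assms abs_ge_zero[of "F z"] unfolding holder_density_def by (meson order_trans)
qed (use assms in \<open>unfold holder_density_def, blast+\<close>)

lemma measurable_integrand:
  assumes \<Phi>: "(\<lambda>p. \<Phi> (fst p) (snd p)) \<in> borel_measurable borel" and F: "holder_density M F"
    and [measurable]: "I \<in> sets borel"
  shows "integrand I \<Phi> F t x \<in> borel_measurable borel"
proof -
  note [measurable] = measurable_curried[OF \<Phi>] holder_densityD(1)[OF F]
  have [measurable]: "(\<lambda>p. \<Phi> (fst p) (x - snd p)) \<in> borel_measurable borel"
    by (rule measurable_curried[OF \<Phi>]) measurable
  show ?thesis unfolding integrand_def by measurable
qed

text \<open>The Gaussian integrates to 1 in space and the Hoelder condition contributes
  \<open>s powr \<gamma>\<close>; only the integral of \<open>s powr (\<gamma> - m)\<close> over the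
  lags remains.\<close>

lemma pot_bound:
  assumes \<Phi>: "(\<lambda>p. \<Phi> (fst p) (snd p)) \<in> borel_measurable borel" and F: "holder_density M F"
    and [measurable]: "I \<in> sets borel" and pos: "I \<subseteq> {0<..}" and B: "0 \<le> B"
    and bnd: "\<And>s y. s \<in> I \<Longrightarrow> \<bar>\<Phi> s y\<bar> \<le> B * s powr (- m) * heat_kernel (4 * s) (y + c)"
    and W: "has_bochner_integral lborel (\<lambda>s. indicator I s * s powr (\<gamma> - m)) W"
  shows "integrable lborel (integrand I \<Phi> F t x)" and "\<bar>pot I \<Phi> F t x\<bar> \<le> B * M * W"
proof -
  note M = holder_densityD[OF F]
  have *: "(\<integral>\<^sup>+y. ennreal \<bar>integrand I \<Phi> F t x (s, y)\<bar> \<partial>lborel) \<le> ennreal (B * M * (indicator I s * s powr (\<gamma> - m)))" for s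
  proof (cases "s \<in> I")
    case True
    then have s: "0 < s" using pos by auto
    have "\<bar>integrand I \<Phi> F t x (s, y)\<bar> \<le> (B * M * s powr (\<gamma> - m)) * heat_kernel (4 * s) (x + c - y)" for y
    proof -
      have "\<bar>integrand I \<Phi> F t x (s, y)\<bar> = \<bar>\<Phi> s (x - y)\<bar> * \<bar>F (t - s, y) - F (t, y)\<bar>"
        using True by (simp add: integrand_def abs_mult)
      also have "\<dots> \<le> (B * s powr (- m) * heat_kernel (4 * s) (x - y + c)) * (M * \<bar>(t - s) - t\<bar> powr \<gamma>)"
        using B by (intro mult_mono bnd True M) (auto intro!: mult_nonneg_nonneg heat_kernel_nonneg)
      also have "\<dots> = (B * M * (s powr (- m) * s powr \<gamma>)) * heat_kernel (4 * s) (x - y + c)"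
        using s by (simp add: mult_ac)
      also have "\<dots> = (B * M * s powr (\<gamma> - m)) * heat_kernel (4 * s) (x + c - y)"
        by (simp add: powr_add' algebra_simps)
      finally show ?thesis .
    qed
    then have "(\<integral>\<^sup>+y. ennreal \<bar>integrand I \<Phi> F t x (s, y)\<bar> \<partial>lborel)
        \<le> (\<integral>\<^sup>+y. ennreal (B * M * s powr (\<gamma> - m)) * ennreal (heat_kernel (4 * s) (x + c - y)) \<partial>lborel)"
      using B M(5) by (intro nn_integral_mono) (simp add: ennreal_mult[symmetric] heat_kernel_nonneg ennreal_leI)
    also have "\<dots> = ennreal (B * M * s powr (\<gamma> - m))"
      using s by (subst nn_integral_cmult) (auto simp: nn_integral_heat_kernel_reflect)
    finally show ?thesis using True by simp
  qed (simp add: integrand_def)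
  have b: "has_bochner_integral lborel (\<lambda>s. B * M * (indicator I s * s powr (\<gamma> - m))) (B * M * W)"
    using W by (rule has_bochner_integral_mult_right)
  have meas: "integrand I \<Phi> F t x \<in> borel_measurable borel"
    using \<Phi> F by (rule measurable_integrand) measurable
  show "integrable lborel (integrand I \<Phi> F t x)" and "\<bar>pot I \<Phi> F t x\<bar> \<le> B * M * W"
    unfolding pot_def using Tonelli_bound[OF meas * b] B M(5) by auto
qed

lemma pot_bound_near:
  assumes "(\<lambda>p. \<Phi> (fst p) (snd p)) \<in> borel_measurable borel" and "holder_density M F"
    and "0 < a" "0 \<le> B" "m < \<gamma> + 1"
    and "\<And>s y. 0 < s \<Longrightarrow> s \<le> a \<Longrightarrow> \<bar>\<Phi> s y\<bar> \<le> B * s powr (- m) * heat_kernel (4 * s) (y + c)"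
  shows "integrable lborel (integrand {0<..a} \<Phi> F t x)"
    and "\<bar>pot {0<..a} \<Phi> F t x\<bar> \<le> B * M * (a powr (\<gamma> - m + 1) / (\<gamma> - m + 1))"
proof -
  have "has_bochner_integral lborel (\<lambda>s. indicator {0<..a} s * s powr (\<gamma> - m)) (a powr (\<gamma> - m + 1) / (\<gamma> - m + 1))"
    using assms by (intro has_bochner_integral_powr_from_0) auto
  then show "integrable lborel (integrand {0<..a} \<Phi> F t x)"
    and "\<bar>pot {0<..a} \<Phi> F t x\<bar> \<le> B * M * (a powr (\<gamma> - m + 1) / (\<gamma> - m + 1))"
    using assms by (intro pot_bound[where c = c and m = m]; force)+
qed

lemma pot_bound_far:
  assumes "(\<lambda>p. \<Phi> (fst p) (snd p)) \<in> borel_measurable borel" and "holder_density M F"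
    and "0 < a" "0 \<le> B" "\<gamma> + 1 < m"
    and "\<And>s y. a < s \<Longrightarrow> \<bar>\<Phi> s y\<bar> \<le> B * s powr (- m) * heat_kernel (4 * s) y"
  shows "integrable lborel (integrand {a<..} \<Phi> F t x)"
    and "\<bar>pot {a<..} \<Phi> F t x\<bar> \<le> B * M * (a powr (\<gamma> - m + 1) / (m - \<gamma> - 1))"
proof -
  have "has_bochner_integral lborel (\<lambda>s. indicator {a<..} s * s powr (\<gamma> - m)) (a powr (\<gamma> - m + 1) / (- (\<gamma> - m) - 1))"
    using assms by (intro has_bochner_integral_powr_to_inf) auto
  then show "integrable lborel (integrand {a<..} \<Phi> F t x)"
    and "\<bar>pot {a<..} \<Phi> F t x\<bar> \<le> B * M * (a powr (\<gamma> - m + 1) / (m - \<gamma> - 1))"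
    using assms by (intro pot_bound[where c = 0 and m = m]; force)+
qed

lemma bounded_set_kernel_bound:
  assumes \<Psi>: "\<Psi> \<in> borel_measurable borel" and I: "I \<subseteq> {0<..}" and A: "0 \<le> A"
    and bnd: "\<And>s y. \<bar>\<Psi> (s, y)\<bar> \<le> A * (indicator I s * s powr p) * (heat_kernel (4 * s) (x - y) * indicator \<Omega> y)"
  shows "(\<integral>\<^sup>+y. ennreal \<bar>\<Psi> (s, y)\<bar> \<partial>lborel) \<le> ennreal (A * (1 + measure lborel \<Omega>) * (indicator I s * s powr p * min 1 (1 / s)))"
proof (cases "s \<in> I")
  case True
  then have s: "0 < s" using I by auto
  have "(\<integral>\<^sup>+y. ennreal \<bar>\<Psi> (s, y)\<bar> \<partial>lborel)
      \<le> (\<integral>\<^sup>+y. ennreal (A * s powr p) * ennreal (heat_kernel (4 * s) (x - y) * indicator \<Omega> y) \<partial>lborel)"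
    using bnd[of s] A True by (intro nn_integral_mono) (simp add: ennreal_mult[symmetric] heat_kernel_nonneg ennreal_leI)
  also have "\<dots> = ennreal (A * s powr p) * (\<integral>\<^sup>+y. ennreal (heat_kernel (4 * s) (x - y) * indicator \<Omega> y) \<partial>lborel)"
    by (rule nn_integral_cmult) measurable
  also have "\<dots> \<le> ennreal (A * s powr p) * ennreal ((1 + measure lborel \<Omega>) * min 1 (1 / s))"
    using s card fin by (intro mult_left_mono nn_integral_heat_kernel_bounded_set) auto
  also have "\<dots> = ennreal (A * s powr p * ((1 + measure lborel \<Omega>) * min 1 (1 / s)))"
    using A s by (intro ennreal_mult[symmetric]) auto
  also have "A * s powr p * ((1 + measure lborel \<Omega>) * min 1 (1 / s)) =
      A * (1 + measure lborel \<Omega>) * (indicator I s * s powr p * min 1 (1 / s))"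
    using True by (simp add: mult_ac)
  finally show ?thesis .
next
  case False
  then have "\<Psi> (s, y) = 0" for y using bnd[of s y] by simp
  then show ?thesis by simp
qed

text \<open>Near 0 the power \<gamma> - m is integrable because m < \<gamma> + 1. Beyond 1 the
  finite measure of \<Omega> supplies a further factor 1/s, and \<gamma> - m - 1 is integrable there
  because m >= 1 > \<gamma>.\<close>

lemma pot_bound_total:
  assumes \<Phi>: "(\<lambda>p. \<Phi> (fst p) (snd p)) \<in> borel_measurable borel" and F: "holder_density M F"
    and B: "0 \<le> B" and m: "1 \<le> m" "m < \<gamma> + 1"
    and bnd: "\<And>s y. 0 < s \<Longrightarrow> \<bar>\<Phi> s y\<bar> \<le> B * s powr (- m) * heat_kernel (4 * s) y"
  shows "integrable lborel (integrand {0<..} \<Phi> F t x)"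
    and "\<bar>pot {0<..} \<Phi> F t x\<bar> \<le> B * M * ((1 + measure lborel \<Omega>) * (1 / (\<gamma> - m + 1) + 1 / (m - \<gamma>)))"
proof -
  note M = holder_densityD[OF F]
  define c where "c = 1 + measure lborel \<Omega>"
  define b where "b s = B * M * c * (indicator {0<..1} s * s powr (\<gamma> - m) + indicator {1<..} s * s powr (\<gamma> - m - 1))" for s
  have c: "0 \<le> c" by (simp add: c_def)
  have meas: "integrand {0<..} \<Phi> F t x \<in> borel_measurable borel"
    using \<Phi> F by (rule measurable_integrand) measurable
  have ptw: "\<bar>integrand {0<..} \<Phi> F t x (s, y)\<bar> \<le> B * M * (indicator {0<..} s * s powr (\<gamma> - m)) * (heat_kernel (4 * s) (x - y) * indicator \<Omega> y)"
    for s y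
  proof (cases "0 < s \<and> y \<in> \<Omega>")
    case True
    have "\<bar>integrand {0<..} \<Phi> F t x (s, y)\<bar> = \<bar>\<Phi> s (x - y)\<bar> * \<bar>F (t - s, y) - F (t, y)\<bar>"
      using True by (simp add: integrand_def abs_mult)
    also have "\<dots> \<le> (B * s powr (- m) * heat_kernel (4 * s) (x - y)) * (M * \<bar>(t - s) - t\<bar> powr \<gamma>)"
      using B True by (intro mult_mono bnd M) (auto intro!: mult_nonneg_nonneg heat_kernel_nonneg)
    also have "\<dots> = (B * M * (s powr (- m) * s powr \<gamma>)) * heat_kernel (4 * s) (x - y)"
      using True by (simp add: mult_ac)
    also have "\<dots> = B * M * (indicator {0<..} s * s powr (\<gamma> - m)) * (heat_kernel (4 * s) (x - y) * indicator \<Omega> y)"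
      using True by (simp add: powr_add' algebra_simps)
    finally show ?thesis .
  qed (auto simp: integrand_def M(3))
  have *: "(\<integral>\<^sup>+y. ennreal \<bar>integrand {0<..} \<Phi> F t x (s, y)\<bar> \<partial>lborel) \<le> ennreal (b s)" for s
  proof -
    have "(\<integral>\<^sup>+y. ennreal \<bar>integrand {0<..} \<Phi> F t x (s, y)\<bar> \<partial>lborel)
       \<le> ennreal (B * M * (1 + measure lborel \<Omega>) * (indicator {0<..} s * s powr (\<gamma> - m) * min 1 (1 / s)))"
      using B M(5) by (intro bounded_set_kernel_bound[where x = x] meas ptw) auto
    also have "indicator {0<..} s * s powr (\<gamma> - m) * min 1 (1 / s) =
        indicator {0<..1} s * s powr (\<gamma> - m) + indicator {1<..} s * s powr (\<gamma> - m - 1)"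
      by (auto simp: indicator_def min_def powr_diff divide_simps)
    finally show ?thesis by (simp add: b_def c_def)
  qed
  have "has_bochner_integral lborel b (B * M * c * (1 powr (\<gamma> - m + 1) / (\<gamma> - m + 1) + 1 powr (\<gamma> - m - 1 + 1) / (- (\<gamma> - m - 1) - 1)))"
    unfolding b_def using m \<gamma>
    by (intro has_bochner_integral_mult_right has_bochner_integral_add has_bochner_integral_powr_from_0 has_bochner_integral_powr_to_inf) auto
  then have bb: "has_bochner_integral lborel b (B * M * c * (1 / (\<gamma> - m + 1) + 1 / (m - \<gamma>)))" by simp
  have "0 \<le> b s" for s using B M(5) c by (simp add: b_def)
  from Tonelli_bound[OF meas * bb this]
  show "integrable lborel (integrand {0<..} \<Phi> F t x)"
    and "\<bar>pot {0<..} \<Phi> F t x\<bar> \<le> B * M * ((1 + measure lborel \<Omega>) * (1 / (\<gamma> - m + 1) + 1 / (m - \<gamma>)))"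
    unfolding pot_def c_def by (auto simp: mult.assoc)
qed

text \<open>Away from lag 0 a merely bounded D may replace the Hoelder increment: the mass O(1/s) on
  \<Omega> makes every m > 0 integrable at infinity. Hence the two terms of
  \<open>F (t - s, y) - F (t, y)\<close> can be separated once the lag is cut off, and the L1 bound,
  uniform in x, justifies Fubini.\<close>

lemma
  assumes \<Phi>: "(\<lambda>p. \<Phi> (fst p) (snd p)) \<in> borel_measurable borel"
    and B: "0 \<le> B" and m: "0 < m" and a: "0 < a"
    and bnd: "\<And>s y. a < s \<Longrightarrow> \<bar>\<Phi> s y\<bar> \<le> B * s powr (- m) * heat_kernel (4 * s) y"
    and [measurable]: "D \<in> borel_measurable borel" and D: "\<And>p. \<bar>D p\<bar> \<le> b" "\<And>s y. y \<notin> \<Omega> \<Longrightarrow> D (s, y) = 0"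
  shows integrable_tail: "integrable lborel (\<lambda>p. indicator {a<..} (fst p) * \<Phi> (fst p) (x - snd p) * D p)"
    and tail_abs_bound: "(\<integral>p. \<bar>indicator {a<..} (fst p) * \<Phi> (fst p) (x - snd p) * D p\<bar> \<partial>lborel)
      \<le> B * b * (1 + measure lborel \<Omega>) * (a powr (- m) / m)"
proof -
  let ?\<Psi> = "\<lambda>p. indicator {a<..} (fst p) * \<Phi> (fst p) (x - snd p) * D p"
  have b: "0 \<le> b" using D(1)[of undefined] abs_ge_zero by (rule order_trans[rotated])
  have [measurable]: "(\<lambda>p. \<Phi> (fst p) (x - snd p)) \<in> borel_measurable borel"
    by (rule measurable_curried[OF \<Phi>]) measurable
  have meas: "?\<Psi> \<in> borel_measurable borel" by measurable
  have ptw: "\<bar>?\<Psi> (s, y)\<bar> \<le> B * b * (indicator {a<..} s * s powr (- m)) * (heat_kernel (4 * s) (x - y) * indicator \<Omega> y)" for s y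
  proof (cases "a < s \<and> y \<in> \<Omega>")
    case True
    then have "\<bar>?\<Psi> (s, y)\<bar> = \<bar>\<Phi> s (x - y)\<bar> * \<bar>D (s, y)\<bar>" by (simp add: abs_mult)
    also have "\<dots> \<le> (B * s powr (- m) * heat_kernel (4 * s) (x - y)) * b"
      using B True by (intro mult_mono bnd D) (auto intro!: mult_nonneg_nonneg heat_kernel_nonneg)
    finally show ?thesis using True by (simp add: mult_ac)
  qed (auto simp: D)
  have *: "(\<integral>\<^sup>+y. ennreal \<bar>?\<Psi> (s, y)\<bar> \<partial>lborel) \<le> ennreal (B * b * (1 + measure lborel \<Omega>) * (indicator {a<..} s * s powr (- m - 1)))" for s
  proof -
    have "(\<integral>\<^sup>+y. ennreal \<bar>?\<Psi> (s, y)\<bar> \<partial>lborel) \<le> ennreal (B * b * (1 + measure lborel \<Omega>) * (indicator {a<..} s * s powr (- m) * min 1 (1 / s)))"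
      using B b a by (intro bounded_set_kernel_bound[where x = x] meas ptw) auto
    also have "\<dots> \<le> ennreal (B * b * (1 + measure lborel \<Omega>) * (indicator {a<..} s * s powr (- m - 1)))"
    proof (intro ennreal_leI mult_left_mono)
      have "s powr (- m) * min 1 (1 / s) \<le> s powr (- m) * (1 / s)" by (intro mult_left_mono) auto
      then show "indicator {a<..} s * s powr (- m) * min 1 (1 / s) \<le> indicator {a<..} s * s powr (- m - 1)"
        using a by (auto simp: indicator_def powr_diff)
    qed (use B b in auto)
    finally show ?thesis .
  qed
  have bb: "has_bochner_integral lborel (\<lambda>s. B * b * (1 + measure lborel \<Omega>) * (indicator {a<..} s * s powr (- m - 1)))
      (B * b * (1 + measure lborel \<Omega>) * (a powr (- m - 1 + 1) / (- (- m - 1) - 1)))"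
    using m a by (intro has_bochner_integral_mult_right has_bochner_integral_powr_to_inf) auto
  have b0: "0 \<le> B * b * (1 + measure lborel \<Omega>) * (indicator {a<..} s * s powr (- m - 1))" for s
    using B b by auto
  show "integrable lborel ?\<Psi>" by (rule Tonelli_bound(1)[OF meas * bb b0])
  have meas': "(\<lambda>p. \<bar>?\<Psi> p\<bar>) \<in> borel_measurable borel" by measurable
  have abs_bnd: "(\<integral>\<^sup>+y. ennreal \<bar>\<bar>?\<Psi> (s, y)\<bar>\<bar> \<partial>lborel) \<le> ennreal (B * b * (1 + measure lborel \<Omega>) * (indicator {a<..} s * s powr (- m - 1)))" for s
    using *[of s] by simp
  show "(\<integral>p. \<bar>?\<Psi> p\<bar> \<partial>lborel) \<le> B * b * (1 + measure lborel \<Omega>) * (a powr (- m) / m)"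
    using Tonelli_bound(2)[OF meas' abs_bnd bb b0] by simp
qed

lemma pot_diff:
  assumes "integrable lborel (integrand I \<Phi> F t x)" "integrable lborel (integrand I \<Psi> F t x)"
  shows "integrable lborel (integrand I (\<lambda>s y. \<Phi> s y - \<Psi> s y) F t x)"
    and "pot I (\<lambda>s y. \<Phi> s y - \<Psi> s y) F t x = pot I \<Phi> F t x - pot I \<Psi> F t x"
proof -
  have eq: "integrand I (\<lambda>s y. \<Phi> s y - \<Psi> s y) F t x = (\<lambda>p. integrand I \<Phi> F t x p - integrand I \<Psi> F t x p)"
    by (auto simp: integrand_def algebra_simps)
  show "integrable lborel (integrand I (\<lambda>s y. \<Phi> s y - \<Psi> s y) F t x)"
    and "pot I (\<lambda>s y. \<Phi> s y - \<Psi> s y) F t x = pot I \<Phi> F t x - pot I \<Psi> F t x"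
    unfolding pot_def eq using assms by auto
qed

lemma pot_split:
  assumes "integrable lborel (integrand {0<..a} \<Phi> F t x)" "integrable lborel (integrand {a<..} \<Phi> F t x)" and "0 < a"
  shows "integrable lborel (integrand {0<..} \<Phi> F t x)"
    and "pot {0<..} \<Phi> F t x = pot {0<..a} \<Phi> F t x + pot {a<..} \<Phi> F t x"
proof -
  have eq: "integrand {0<..} \<Phi> F t x = (\<lambda>p. integrand {0<..a} \<Phi> F t x p + integrand {a<..} \<Phi> F t x p)"
    using \<open>0 < a\<close> by (auto simp: integrand_def indicator_def)
  show "integrable lborel (integrand {0<..} \<Phi> F t x)"
    and "pot {0<..} \<Phi> F t x = pot {0<..a} \<Phi> F t x + pot {a<..} \<Phi> F t x"
    unfolding pot_def eq using assms by auto
qed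

lemma integrable_integrand_subset:
  assumes "integrable lborel (integrand I \<Phi> F t x)" "J \<subseteq> I" and [measurable]: "J \<in> sets borel"
  shows "integrable lborel (integrand J \<Phi> F t x)"
proof -
  have eq: "integrand J \<Phi> F t x = (\<lambda>p. integrand I \<Phi> F t x p * indicator (fst -` J) p)"
    using \<open>J \<subseteq> I\<close> by (auto simp: integrand_def indicator_def fun_eq_iff)
  have "fst -` J \<in> sets (borel :: (real \<times> (real ^ 'n)) measure)"
    using measurable_sets_borel[OF borel_measurable_fst_snd(1) \<open>J \<in> sets borel\<close>] .
  then show ?thesis
    unfolding eq using assms(1) by (intro integrable_real_mult_indicator) auto
qed

lemma integrand_shift: "integrand I (\<lambda>s y. \<Phi> s (y + h)) F t x = integrand I \<Phi> F t (x + h)"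
  by (simp add: integrand_def fun_eq_iff algebra_simps)

lemma pot_shift: "pot I (\<lambda>s y. \<Phi> s (y + h)) F t x = pot I \<Phi> F t (x + h)"
  by (simp add: pot_def integrand_shift)

end

section \<open>Exact integration of the borderline kernel over the lag\<close>

lemma integrable_heat_t_tail:
  fixes z :: "real ^ 'n"
  assumes n: "2 \<le> CARD('n)" and a: "0 < a"
  shows "integrable lborel (\<lambda>s. indicator {a<..} s * heat_t s z)"
    and "(\<integral>s. indicator {a<..} s * heat_t s z \<partial>lborel) = - heat_kernel a z"
proof -
  obtain C where C: "0 < C" and bnd: "\<And>s z. 0 < s \<Longrightarrow> \<bar>heat_t s (z :: real ^ 'n)\<bar> \<le> C * s powr (-1) * heat_kernel (4 * s) z"
    using heat_difference_bounds[where 'n = 'n] by blast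
  \<comment> \<open>For fixed z the peak bound s^(-n/2) is added to the factor 1/s, which makes the
    tail absolutely integrable.\<close>
  define e where "e = - 1 - real CARD('n) / 2"
  have e: "e < -1" by (simp add: e_def)
  have dom: "integrable lborel (\<lambda>s. C * (indicator {a<..} s * s powr e))"
    using has_bochner_integral_powr_to_inf[OF e a] by (auto simp: has_bochner_integral_iff)
  show int: "integrable lborel (\<lambda>s. indicator {a<..} s * heat_t s z)"
  proof (rule Bochner_Integration.integrable_bound[OF dom])
    show "AE s in lborel. norm (indicator {a<..} s * heat_t s z) \<le> norm (C * (indicator {a<..} s * s powr e))"
    proof (rule AE_I2)
      fix s
      show "norm (indicator {a<..} s * heat_t s z) \<le> norm (C * (indicator {a<..} s * s powr e))"
      proof (cases "a < s")
        case True
        then have s: "0 < s" using a by simp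
        have "\<bar>heat_t s z\<bar> \<le> C * s powr (-1) * heat_kernel (4 * s) z" by (rule bnd[OF s])
        also have "\<dots> \<le> C * s powr (-1) * (4 * s) powr (- real CARD('n) / 2)"
          using C s by (intro mult_left_mono heat_kernel_powr_bound) auto
        also have "\<dots> \<le> C * s powr (-1) * s powr (- real CARD('n) / 2)"
          using C s by (intro mult_left_mono powr_mono2') auto
        also have "\<dots> = C * s powr e" by (simp only: mult.assoc powr_add') (simp add: e_def)
        finally show ?thesis using True C by simp
      qed simp
    qed
  qed measurable
  have "((\<lambda>s. heat_kernel s z) \<longlongrightarrow> 0) at_top"
  proof (rule tendsto_sandwich[OF _ _ tendsto_const])
    show "eventually (\<lambda>s. heat_kernel s z \<le> s powr (- real CARD('n) / 2)) at_top"
      using eventually_gt_at_top[of 0] by eventually_elim (rule heat_kernel_powr_bound)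
    show "((\<lambda>s. s powr (- real CARD('n) / 2)) \<longlongrightarrow> 0) at_top"
      by (intro tendsto_neg_powr filterlim_ident) simp
  qed (simp add: heat_kernel_nonneg)
  moreover have "isCont (\<lambda>s. heat_t s z) s" if "a < s" for s
    using DERIV_heat_t_t[of s z] that a by (intro DERIV_isCont) auto
  ultimately show "(\<integral>s. indicator {a<..} s * heat_t s z \<partial>lborel) = - heat_kernel a z"
    using a int by (intro integral_derivative_to_inf DERIV_heat_kernel_t) auto
qed

context heat_domain
begin

text \<open>For m > 1 the powers of s are integrable at infinity by themselves, so a D independent
  of the lag costs only its sup, and the result has the scale \<open>a powr (1 - m)\<close>. This
  covers the gradient kernel, m = 3/2.\<close>

lemma tail_bound:
  assumes \<Phi>: "(\<lambda>p. \<Phi> (fst p) (snd p)) \<in> borel_measurable borel"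
    and B: "0 \<le> B" and m: "1 < m" and a: "0 < a"
    and bnd: "\<And>s y. a < s \<Longrightarrow> \<bar>\<Phi> s y\<bar> \<le> B * s powr (- m) * heat_kernel (4 * s) y"
    and [measurable]: "D \<in> borel_measurable borel" and D: "\<And>y. \<bar>D y\<bar> \<le> b"
  shows "\<bar>\<integral>p. indicator {a<..} (fst p) * \<Phi> (fst p) (x - snd p) * D (snd p) \<partial>lborel\<bar>
    \<le> B * b * (a powr (1 - m) / (m - 1))"
proof -
  let ?\<Psi> = "\<lambda>p. indicator {a<..} (fst p) * \<Phi> (fst p) (x - snd p) * D (snd p)"
  have b: "0 \<le> b" using D[of undefined] abs_ge_zero by (rule order_trans[rotated])
  have [measurable]: "(\<lambda>p. \<Phi> (fst p) (x - snd p)) \<in> borel_measurable borel"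
    by (rule measurable_curried[OF \<Phi>]) measurable
  have meas: "?\<Psi> \<in> borel_measurable borel" by measurable
  have *: "(\<integral>\<^sup>+y. ennreal \<bar>?\<Psi> (s, y)\<bar> \<partial>lborel) \<le> ennreal (B * b * (indicator {a<..} s * s powr (- m)))" for s
  proof (cases "a < s")
    case True
    then have s: "0 < s" using a by auto
    have "\<bar>?\<Psi> (s, y)\<bar> \<le> (B * b * s powr (- m)) * heat_kernel (4 * s) (x - y)" for y
    proof -
      have "\<bar>?\<Psi> (s, y)\<bar> = \<bar>\<Phi> s (x - y)\<bar> * \<bar>D y\<bar>" using True by (simp add: abs_mult)
      also have "\<dots> \<le> (B * s powr (- m) * heat_kernel (4 * s) (x - y)) * b"
        using B True by (intro mult_mono bnd D) (auto intro!: mult_nonneg_nonneg heat_kernel_nonneg)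
      finally show ?thesis by (simp add: mult_ac)
    qed
    then have "(\<integral>\<^sup>+y. ennreal \<bar>?\<Psi> (s, y)\<bar> \<partial>lborel)
        \<le> (\<integral>\<^sup>+y. ennreal (B * b * s powr (- m)) * ennreal (heat_kernel (4 * s) (x - y)) \<partial>lborel)"
      using B b by (intro nn_integral_mono) (simp add: ennreal_mult[symmetric] heat_kernel_nonneg ennreal_leI)
    also have "\<dots> = ennreal (B * b * s powr (- m))"
      using s by (subst nn_integral_cmult) (auto simp: nn_integral_heat_kernel_reflect)
    finally show ?thesis using True by simp
  qed simp
  have b: "has_bochner_integral lborel (\<lambda>s. B * b * (indicator {a<..} s * s powr (- m))) (B * b * (a powr (- m + 1) / (- (- m) - 1)))"
    using a m by (intro has_bochner_integral_mult_right has_bochner_integral_powr_to_inf) auto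
  have "0 \<le> B * b * (indicator {a<..} s * s powr (- m))" for s
    using B \<open>0 \<le> b\<close> by simp
  from Tonelli_bound(2)[OF meas * b this] show ?thesis by (simp add: add.commute)
qed

text \<open>For m = 1 an absolute bound would leave the divergent integral of 1/s. Since D does not
  depend on the lag, the kernel is integrated in s first; what remains is a Gaussian average of D,
  of size at most b uniformly in a.\<close>

lemma
  fixes x :: "real ^ 'n"
  assumes a: "0 < a" and D_meas [measurable]: "D \<in> borel_measurable borel"
    and D: "\<And>y. \<bar>D y\<bar> \<le> b" "\<And>y. y \<notin> \<Omega> \<Longrightarrow> D y = 0"
  shows integrable_heat_t_potential_tail:
      "integrable lborel (\<lambda>p. indicator {a<..} (fst p) * heat_t (fst p) (x - snd p) * D (snd p))"
    and heat_t_potential_tail: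
      "(\<integral>p. indicator {a<..} (fst p) * heat_t (fst p) (x - snd p) * D (snd p) \<partial>lborel)
       = - (\<integral>y. heat_kernel a (x - y) * D y \<partial>lborel)"
    and heat_t_potential_tail_bound:
      "\<bar>\<integral>p. indicator {a<..} (fst p) * heat_t (fst p) (x - snd p) * D (snd p) \<partial>lborel\<bar> \<le> b"
proof -
  obtain C where C: "0 < C" and bnd: "\<And>s z. 0 < s \<Longrightarrow> \<bar>heat_t s (z :: real ^ 'n)\<bar> \<le> C * s powr (-1) * heat_kernel (4 * s) z"
    using heat_difference_bounds[where 'n = 'n] by blast
  show int: "integrable lborel (\<lambda>p. indicator {a<..} (fst p) * heat_t (fst p) (x - snd p) * D (snd p))"
    using a C by (intro integrable_tail[where B = C and m = 1 and b = b] bnd) (auto simp: D)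
  have "(\<integral>p. indicator {a<..} (fst p) * heat_t (fst p) (x - snd p) * D (snd p) \<partial>lborel)
      = (\<integral>y. (\<integral>s. indicator {a<..} s * heat_t s (x - y) * D y \<partial>lborel) \<partial>lborel)"
    using Fubini_lborel(2)[OF int] by simp
  also have "\<dots> = (\<integral>y. - (heat_kernel a (x - y) * D y) \<partial>lborel)"
    using integrable_heat_t_tail(2)[OF card a] by simp
  finally show eq: "(\<integral>p. indicator {a<..} (fst p) * heat_t (fst p) (x - snd p) * D (snd p) \<partial>lborel)
       = - (\<integral>y. heat_kernel a (x - y) * D y \<partial>lborel)" by simp
  have m: "(\<lambda>y. heat_kernel a (x - y) * D y) \<in> borel_measurable borel" by measurable
  have "\<bar>\<integral>z. heat_kernel a z * D (x - z) \<partial>lborel\<bar> \<le> b"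
    by (rule heat_kernel_convolution_bound(2)[OF a _ D(1)]) measurable
  then show "\<bar>\<integral>p. indicator {a<..} (fst p) * heat_t (fst p) (x - snd p) * D (snd p) \<partial>lborel\<bar> \<le> b"
    using eq integral_lborel_reflect[OF m, of x] by simp
qed

lemma pot_time_diff:
  assumes \<Phi>: "(\<lambda>p. \<Phi> (fst p) (snd p)) \<in> borel_measurable borel" and F: "holder_density M F"
    and B: "0 \<le> B" and m: "1 \<le> m" "m < \<gamma> + 1" and E: "0 \<le> E"
    and bnd: "\<And>s y. 0 < s \<Longrightarrow> \<bar>\<Phi> s y\<bar> \<le> B * s powr (- m) * heat_kernel (4 * s) y"
    and dbnd: "\<And>s d y. 0 < d \<Longrightarrow> d \<le> s \<Longrightarrow> \<bar>\<Phi> (s + d) y - \<Phi> s y\<bar> \<le> B * d * s powr (- (m + 1)) * heat_kernel (4 * s) y"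
    and tail: "\<And>a D b x. 0 < a \<Longrightarrow> D \<in> borel_measurable borel \<Longrightarrow> (\<And>y. \<bar>D y\<bar> \<le> b) \<Longrightarrow> (\<And>y. y \<notin> \<Omega> \<Longrightarrow> D y = 0) \<Longrightarrow>
       \<bar>\<integral>p. indicator {a<..} (fst p) * \<Phi> (fst p) (x - snd p) * D (snd p) \<partial>lborel\<bar> \<le> E * b * a powr (1 - m)"
  shows "\<bar>pot {0<..} \<Phi> F t1 x - pot {0<..} \<Phi> F t2 x\<bar>
    \<le> (B * (2 powr (\<gamma> - m + 1) + 1) / (\<gamma> - m + 1) + B / (m - \<gamma>) + E) * M * \<bar>t1 - t2\<bar> powr (\<gamma> - m + 1)"
proof -
  define e where "e = \<gamma> - m + 1"
  have e: "0 < e" using m by (simp add: e_def)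
  note M = holder_densityD[OF F]
  have [measurable]: "F \<in> borel_measurable borel" by (rule M(1))
  have main: "\<bar>pot {0<..} \<Phi> F t2 x - pot {0<..} \<Phi> F t1 x\<bar>
    \<le> (B * (2 powr e + 1) / e + B / (m - \<gamma>) + E) * M * \<bar>t2 - t1\<bar> powr e" if t: "t1 < t2" for t1 t2
  proof -
    define h where "h = t2 - t1"
    have h: "0 < h" using t by (simp add: h_def)
    have int: "integrable lborel (integrand {0<..} \<Phi> F t x)" for t
      by (rule pot_bound_total(1)[OF \<Phi> F B m bnd])
    have int_sub: "integrable lborel (integrand J \<Phi> F t x)" if "J \<subseteq> {0<..}" "J \<in> sets borel" for J t
      by (rule integrable_integrand_subset[OF int that])
    have near: "\<bar>pot {0<..a} \<Phi> F t x\<bar> \<le> B * M * (a powr e / e)" if "0 < a" for a t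
      unfolding e_def using that B m bnd by (intro pot_bound_near[OF \<Phi> F, where c = 0]) auto
    have split: "pot {0<..} \<Phi> F t x = pot {0<..a} \<Phi> F t x + pot {a<..} \<Phi> F t x" if "0 < a" for a t
      using that by (intro pot_split int_sub) auto
    define D where "D y = F (t1, y) - F (t2, y)" for y
    have Dm: "D \<in> borel_measurable borel" unfolding D_def by measurable
    have Db: "\<bar>D y\<bar> \<le> M * h powr \<gamma>" for y
      using M(4)[of t1 y t2] t by (simp add: D_def h_def)
    have D0: "D y = 0" if "y \<notin> \<Omega>" for y using M(3)[OF that] by (simp add: D_def)
    \<comment> \<open>The cut at 2 h becomes s > h after the shift of the lag by h, which is the
      range where the increment bound with step h holds.\<close>
    define Q where "Q p = indicator {2 * h<..} (fst p) * \<Phi> (fst p) (x - snd p) * D (snd p)" for p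
    have Q_int: "integrable lborel Q"
      unfolding Q_def using h B m Dm bnd
      by (intro integrable_tail[OF \<Phi>, where B = B and m = m and b = "M * h powr \<gamma>"])
        (auto simp: Db D0 intro: measurable_compose[OF borel_measurable_fst_snd(2)])
    have Q_bnd: "\<bar>\<integral>p. Q p \<partial>lborel\<bar> \<le> E * M * h powr e"
    proof -
      have "\<bar>\<integral>p. Q p \<partial>lborel\<bar> \<le> E * (M * h powr \<gamma>) * (2 * h) powr (1 - m)"
        unfolding Q_def using h by (intro tail Dm Db D0) auto
      also have "\<dots> \<le> E * (M * h powr \<gamma>) * h powr (1 - m)"
        using h E M(5) m by (intro mult_left_mono powr_mono2') auto
      also have "\<dots> = E * M * (h powr \<gamma> * h powr (1 - m))" by simp
      also have "h powr \<gamma> * h powr (1 - m) = h powr e" by (simp add: powr_add' e_def algebra_simps)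
      finally show ?thesis .
    qed
    define G where "G = (\<lambda>s y. \<Phi> (s + h) y - \<Phi> s y)"
    have shift_meas: "(\<lambda>p. \<Phi> (fst p + h) (snd p)) \<in> borel_measurable borel"
      by (rule measurable_curried[OF \<Phi>]) measurable
    have G_meas: "(\<lambda>p. G (fst p) (snd p)) \<in> borel_measurable borel"
      unfolding G_def using shift_meas \<Phi> by measurable
    have G_bnd: "\<bar>G s y\<bar> \<le> (B * h) * s powr (- (m + 1)) * heat_kernel (4 * s) y" if "h < s" for s y
      unfolding G_def using dbnd[of h s y] h that by simp
    have G_far: "integrable lborel (integrand {h<..} G F t1 x)"
      "\<bar>pot {h<..} G F t1 x\<bar> \<le> (B * h) * M * (h powr (\<gamma> - (m + 1) + 1) / (m + 1 - \<gamma> - 1))"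
      using h B m \<gamma> by (intro pot_bound_far[OF G_meas F h _ _ G_bnd]; simp)+
    have Q_shift: "(\<integral>p. Q ((h, 0) + p) \<partial>lborel) = (\<integral>p. Q p \<partial>lborel)" "integrable lborel (\<lambda>p. Q ((h, 0) + p))"
      using Q_int integral_lborel_translate[of Q "(h, 0)"] integrable_lborel_translate[of Q "(h, 0)"]
      by (auto dest: borel_measurable_integrable)
    have im: "integrand {2 * h<..} \<Phi> F t2 x \<in> borel_measurable borel"
      by (rule measurable_integrand[OF \<Phi> F]) simp
    have "pot {2 * h<..} \<Phi> F t2 x = (\<integral>p. integrand {2 * h<..} \<Phi> F t2 x ((h, 0) + p) \<partial>lborel)"
      unfolding pot_def by (rule integral_lborel_translate[OF im, symmetric])
    also have "\<dots> = (\<integral>p. integrand {h<..} G F t1 x p + integrand {h<..} \<Phi> F t1 x p + Q ((h, 0) + p) \<partial>lborel)"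
    proof (rule Bochner_Integration.integral_cong[OF refl])
      fix p :: "real \<times> (real ^ 'n)"
      obtain s y where p: "p = (s, y)" by (cases p)
      have "t2 - (h + s) = t1 - s" by (simp add: h_def)
      then show "integrand {2 * h<..} \<Phi> F t2 x ((h, 0) + p) = integrand {h<..} G F t1 x p + integrand {h<..} \<Phi> F t1 x p + Q ((h, 0) + p)"
        by (cases "h < s") (simp_all add: integrand_def p G_def Q_def D_def indicator_def add.commute algebra_simps)
    qed
    also have "\<dots> = pot {h<..} G F t1 x + pot {h<..} \<Phi> F t1 x + (\<integral>p. Q p \<partial>lborel)"
      using G_far(1) int_sub[of "{h<..}" t1] Q_shift h by (simp add: pot_def)
    finally have far: "pot {2 * h<..} \<Phi> F t2 x = pot {h<..} G F t1 x + pot {h<..} \<Phi> F t1 x + (\<integral>p. Q p \<partial>lborel)" .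
    \<comment> \<open>The far part at t1, over s > h, occurs in both potentials and cancels.\<close>
    have eq: "pot {0<..} \<Phi> F t2 x - pot {0<..} \<Phi> F t1 x =
        pot {0<..2 * h} \<Phi> F t2 x - pot {0<..h} \<Phi> F t1 x + pot {h<..} G F t1 x + (\<integral>p. Q p \<partial>lborel)"
      using split[of "2 * h" t2] split[of h t1] far h by simp
    have 1: "\<bar>pot {0<..2 * h} \<Phi> F t2 x\<bar> \<le> B * M * (2 powr e / e) * h powr e"
      using near[of "2 * h" t2] h by (simp add: powr_mult mult_ac)
    have 2: "\<bar>pot {0<..h} \<Phi> F t1 x\<bar> \<le> B * M * (1 / e) * h powr e"
      using near[of h t1] h by simp
    have 3: "\<bar>pot {h<..} G F t1 x\<bar> \<le> B / (m - \<gamma>) * M * h powr e"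
    proof -
      have "h powr e = h * h powr (\<gamma> - m)" using h by (simp add: e_def powr_add)
      then show ?thesis using G_far(2) by (simp add: mult_ac)
    qed
    have "\<bar>pot {0<..} \<Phi> F t2 x - pot {0<..} \<Phi> F t1 x\<bar> \<le>
        B * M * (2 powr e / e) * h powr e + B * M * (1 / e) * h powr e + B / (m - \<gamma>) * M * h powr e + E * M * h powr e"
      unfolding eq using 1 2 3 Q_bnd by linarith
    also have "\<dots> = (B * (2 powr e + 1) / e + B / (m - \<gamma>) + E) * M * \<bar>t2 - t1\<bar> powr e"
      using h by (simp add: h_def algebra_simps add_divide_distrib)
    finally show ?thesis .
  qed
  show ?thesis
  proof (cases t1 t2 rule: linorder_cases)
    case less
    then show ?thesis using main[OF less] unfolding e_def by (simp add: abs_minus_commute)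
  next
    case greater
    then show ?thesis using main[OF greater] unfolding e_def by simp
  qed simp
qed

section \<open>Hoelder estimates for the potential and its gradient\<close>

definition pot_bounds :: "real \<Rightarrow> real \<Rightarrow> (real \<times> (real ^ 'n) \<Rightarrow> real) \<Rightarrow> bool" where
  "pot_bounds C M F \<longleftrightarrow> (\<forall>t t' x h v.
     integrable lborel (integrand {0<..} heat_t F t x) \<and>
     integrable lborel (integrand {0<..} (heat_tx v) F t x) \<and>
     \<bar>pot {0<..} heat_t F t x\<bar> \<le> C * M \<and>
     \<bar>pot {0<..} (heat_tx v) F t x\<bar> \<le> C * norm v * M \<and>
     \<bar>pot {0<..} (heat_tx v) F t (x + h) - pot {0<..} (heat_tx v) F t x\<bar> \<le> C * norm v * M * norm h powr (2 * \<gamma> - 1) \<and>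
     \<bar>pot {0<..} heat_t F t (x + h) - pot {0<..} heat_t F t x - pot {0<..} (heat_tx h) F t x\<bar> \<le> C * M * norm h powr (2 * \<gamma>) \<and>
     \<bar>pot {0<..} heat_t F t x - pot {0<..} heat_t F t' x\<bar> \<le> C * M * \<bar>t - t'\<bar> powr \<gamma> \<and>
     \<bar>pot {0<..} (heat_tx v) F t x - pot {0<..} (heat_tx v) F t' x\<bar> \<le> C * norm v * M * \<bar>t - t'\<bar> powr (\<gamma> - 1/2) \<and>
     (\<forall>a>0. \<bar>pot {0<..a} heat_t F t x\<bar> \<le> C * M * a powr \<gamma>))"

text \<open>For increments, near lags are bounded term by term and far lags through increments of
  the kernel; at the parabolic scale both have the same order. The constant is fixed before M and F,
  which is what boundedness of the operator requires.\<close>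

theorem pot_estimates: "\<exists>C>0. \<forall>M F. holder_density M F \<longrightarrow> pot_bounds C M F"
proof -
  obtain C where C: "0 < C" and bnd: "\<And>s z v h. 0 < s \<Longrightarrow>
     \<bar>heat_t s (z :: real ^ 'n)\<bar> \<le> C * s powr (-1) * heat_kernel (4 * s) z \<and>
     \<bar>heat_tx v s z\<bar> \<le> C * norm v * s powr (-3/2) * heat_kernel (4 * s) z \<and>
     ((norm h)\<^sup>2 \<le> s \<longrightarrow>
       \<bar>heat_tx v s (z + h) - heat_tx v s z\<bar> \<le> C * norm v * norm h * s powr (-2) * heat_kernel (4 * s) z \<and>
       \<bar>heat_t s (z + h) - heat_t s z - heat_tx h s z\<bar> \<le> C * (norm h)\<^sup>2 * s powr (-2) * heat_kernel (4 * s) z) \<and>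
     (\<forall>d. 0 < d \<and> d \<le> s \<longrightarrow>
       \<bar>heat_t (s + d) z - heat_t s z\<bar> \<le> C * d * s powr (-2) * heat_kernel (4 * s) z \<and>
       \<bar>heat_tx v (s + d) z - heat_tx v s z\<bar> \<le> C * norm v * d * s powr (-5/2) * heat_kernel (4 * s) z)"
    using heat_difference_bounds[where 'n = 'n] by blast
  \<comment> \<open>In the order of the claims: totals for m = 1 and m = 3/2, space increment of the
    gradient, Taylor remainder, time increments of potential and gradient, near part of the
    potential.\<close>
  define c1 where "c1 = C * ((1 + measure lborel \<Omega>) * (1 / \<gamma> + 1 / (1 - \<gamma>)))"
  define c2 where "c2 = C * ((1 + measure lborel \<Omega>) * (1 / (\<gamma> - 1/2) + 1 / (3/2 - \<gamma>)))"
  define c3 where "c3 = C * (2 / (\<gamma> - 1/2) + 1 / (1 - \<gamma>))"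
  define c4 where "c4 = C * (2 / \<gamma> + 1 / (\<gamma> - 1/2) + 1 / (1 - \<gamma>))"
  define c5 where "c5 = C * (2 powr \<gamma> + 1) / \<gamma> + C / (1 - \<gamma>) + 1"
  define c6 where "c6 = C * ((2 powr (\<gamma> - 1/2) + 1) / (\<gamma> - 1/2) + 1 / (3/2 - \<gamma>) + 2)"
  define c7 where "c7 = C / \<gamma>"
  define K where "K = c1 + c2 + c3 + c4 + c5 + c6 + c7"
  have cpos: "0 < c1" "0 < c2" "0 < c3" "0 < c4" "0 < c5" "0 < c6" "0 < c7"
    unfolding c1_def c2_def c3_def c4_def c5_def c6_def c7_def using C \<gamma>
    by (intro mult_pos_pos add_pos_pos add_pos_nonneg divide_pos_pos; simp)+
  have K: "0 < K" "c1 \<le> K" "c2 \<le> K" "c3 \<le> K" "c4 \<le> K" "c5 \<le> K" "c6 \<le> K" "c7 \<le> K"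
    using cpos by (auto simp: K_def)
  have bt: "\<bar>heat_t s z\<bar> \<le> C * s powr (-1) * heat_kernel (4 * s) z" if "0 < s" for s and z :: "real ^ 'n"
    using bnd[OF that, of z] by blast
  have bx: "\<bar>heat_tx v s z\<bar> \<le> C * norm v * s powr (-(3/2)) * heat_kernel (4 * s) z" if "0 < s" for s and z v :: "real ^ 'n"
    using bnd[OF that, of z v] by simp
  have btt: "\<bar>heat_t (s + d) z - heat_t s z\<bar> \<le> C * d * s powr (-(1 + 1)) * heat_kernel (4 * s) z"
    if "0 < d" "d \<le> s" for s d and z :: "real ^ 'n"
    using bnd[of s z] that by simp
  have bxt: "\<bar>heat_tx v (s + d) z - heat_tx v s z\<bar> \<le> C * norm v * d * s powr (-(3/2 + 1)) * heat_kernel (4 * s) z"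
    if "0 < d" "d \<le> s" for s d and z v :: "real ^ 'n"
    using bnd[of s z v] that by simp
  have mt: "(\<lambda>p. heat_t (fst p) (snd p :: real ^ 'n)) \<in> borel_measurable borel" by measurable
  have mx: "(\<lambda>p. heat_tx v (fst p) (snd p)) \<in> borel_measurable borel" for v :: "real ^ 'n" by measurable
  have "integrable lborel (integrand {0<..} heat_t F t x)" (is ?A)
     "integrable lborel (integrand {0<..} (heat_tx v) F t x)" (is ?A')
     "\<bar>pot {0<..} heat_t F t x\<bar> \<le> c1 * M" (is ?B)
     "\<bar>pot {0<..} (heat_tx v) F t x\<bar> \<le> c2 * (norm v * M)" (is ?C)
     "\<bar>pot {0<..} (heat_tx v) F t (x + h) - pot {0<..} (heat_tx v) F t x\<bar> \<le> c3 * (norm v * M * norm h powr (2 * \<gamma> - 1))" (is ?D)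
     "\<bar>pot {0<..} heat_t F t (x + h) - pot {0<..} heat_t F t x - pot {0<..} (heat_tx h) F t x\<bar> \<le> c4 * (M * norm h powr (2 * \<gamma>))" (is ?E)
     "\<bar>pot {0<..} heat_t F t x - pot {0<..} heat_t F t' x\<bar> \<le> c5 * (M * \<bar>t - t'\<bar> powr \<gamma>)" (is ?F)
     "\<bar>pot {0<..} (heat_tx v) F t x - pot {0<..} (heat_tx v) F t' x\<bar> \<le> c6 * (norm v * M * \<bar>t - t'\<bar> powr (\<gamma> - 1/2))" (is ?G)
     "\<forall>a>0. \<bar>pot {0<..a} heat_t F t x\<bar> \<le> c7 * (M * a powr \<gamma>)" (is ?H)
    if F: "holder_density M F" for M F t t' x h v
  proof -
    note M = holder_densityD[OF F]
    have tot_t: "integrable lborel (integrand {0<..} heat_t F t x)" "\<bar>pot {0<..} heat_t F t x\<bar> \<le> C * M * ((1 + measure lborel \<Omega>) * (1 / (\<gamma> - 1 + 1) + 1 / (1 - \<gamma>)))"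
      for t x
      using C \<gamma> by (intro pot_bound_total[OF mt F _ _ _ bt]; simp)+
    have tot_x: "integrable lborel (integrand {0<..} (heat_tx v) F t x)"
      "\<bar>pot {0<..} (heat_tx v) F t x\<bar> \<le> C * norm v * M * ((1 + measure lborel \<Omega>) * (1 / (\<gamma> - 3/2 + 1) + 1 / (3/2 - \<gamma>)))" for v t x
      using C \<gamma> by (intro pot_bound_total[OF mx F _ _ _ bx]; simp)+
    show ?A by (rule tot_t)
    show ?A' by (rule tot_x)
    show ?B using tot_t(2) by (simp add: c1_def mult_ac)
    show ?C using tot_x(2)[of v t x] by (simp add: c2_def mult_ac)
    have near_t: "integrable lborel (integrand {0<..a} heat_t F t x)" "\<bar>pot {0<..a} heat_t F t x\<bar> \<le> C * M * (a powr (\<gamma> - 1 + 1) / (\<gamma> - 1 + 1))"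
      if "0 < a" for a x
      using C \<gamma> that bt by (intro pot_bound_near[OF mt F, where c = 0 and B = C and m = 1]; simp)+
    have near_x: "integrable lborel (integrand {0<..a} (heat_tx v) F t x)"
      "\<bar>pot {0<..a} (heat_tx v) F t x\<bar> \<le> C * norm v * M * (a powr (\<gamma> - 3/2 + 1) / (\<gamma> - 3/2 + 1))" if "0 < a" for a v x
      using C \<gamma> that bx by (intro pot_bound_near[OF mx F, where c = 0 and B = "C * norm v" and m = "3/2"]; simp)+
    show ?H using near_t(2) by (simp add: c7_def mult_ac)
    show ?D
    proof (cases "h = 0")
      case False
      define r where "r = norm h"
      have r: "0 < r" using False by (simp add: r_def)
      define \<Phi> where "\<Phi> = (\<lambda>s y. heat_tx v s (y + h) - heat_tx v s y)"
      have \<Phi>: "(\<lambda>p. \<Phi> (fst p) (snd p)) \<in> borel_measurable borel" unfolding \<Phi>_def by measurable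
      have r2: "(r\<^sup>2) powr k = r powr (2 * k)" for k
        using r by (simp add: powr_powr flip: powr_numeral)
      have ir: "integrable lborel (integrand {0<..r\<^sup>2} (\<lambda>s y. heat_tx v s (y + h)) F t x)"
        unfolding integrand_shift using near_x(1) r by simp
      have n1: "integrable lborel (integrand {0<..r\<^sup>2} \<Phi> F t x)"
        "pot {0<..r\<^sup>2} \<Phi> F t x = pot {0<..r\<^sup>2} (heat_tx v) F t (x + h) - pot {0<..r\<^sup>2} (heat_tx v) F t x"
        unfolding \<Phi>_def using pot_diff[OF ir near_x(1)] r by (auto simp: pot_shift)
      have r20: "0 < r\<^sup>2" using r by simp
      have Cr: "0 \<le> C * norm v * r" using C r by simp
      have far: "\<bar>\<Phi> s y\<bar> \<le> C * norm v * r * s powr (-2) * heat_kernel (4 * s) y" if "r\<^sup>2 < s" for s y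
        using bnd[of s y v h] that r20 unfolding \<Phi>_def r_def by auto
      have n2: "integrable lborel (integrand {r\<^sup>2<..} \<Phi> F t x)"
        "\<bar>pot {r\<^sup>2<..} \<Phi> F t x\<bar> \<le> C * norm v * r * M * ((r\<^sup>2) powr (\<gamma> - 2 + 1) / (2 - \<gamma> - 1))"
        using \<gamma> Cr by (intro pot_bound_far[OF \<Phi> F r20 _ _ far]; simp)+
      have "integrable lborel (integrand {0<..} (\<lambda>s y. heat_tx v s (y + h)) F t x)"
        unfolding integrand_shift by (rule tot_x)
      from pot_diff(2)[OF this tot_x(1)]
      have "pot {0<..} (heat_tx v) F t (x + h) - pot {0<..} (heat_tx v) F t x = pot {0<..} \<Phi> F t x"
        by (simp add: \<Phi>_def pot_shift)
      also have "\<dots> = pot {0<..r\<^sup>2} \<Phi> F t x + pot {r\<^sup>2<..} \<Phi> F t x"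
        using r by (intro pot_split n1 n2) auto
      finally have "\<bar>pot {0<..} (heat_tx v) F t (x + h) - pot {0<..} (heat_tx v) F t x\<bar> \<le>
         2 * (C * norm v * M * ((r\<^sup>2) powr (\<gamma> - 1/2) / (\<gamma> - 1/2))) + C * norm v * r * M * ((r\<^sup>2) powr (\<gamma> - 1) / (1 - \<gamma>))"
        using n1(2) n2(2) near_x(2)[of "r\<^sup>2" v "x + h"] near_x(2)[of "r\<^sup>2" v x] r
        by (simp add: add.commute)
      \<comment> \<open>Both parts have the order r^(2 \<gamma> - 1): the near one directly, the far
        one as r times r^(2 (\<gamma> - 1)).\<close>
      also have "(r\<^sup>2) powr (\<gamma> - 1/2) = r powr (2 * \<gamma> - 1)" by (simp add: r2)
      also have "C * norm v * r * M * ((r\<^sup>2) powr (\<gamma> - 1) / (1 - \<gamma>)) = C * norm v * M * (r powr (2 * \<gamma> - 1) / (1 - \<gamma>))"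
      proof -
        have "r powr (2 * \<gamma> - 1) = r powr (1 + 2 * (\<gamma> - 1))" by (simp add: algebra_simps)
        also have "\<dots> = r * (r\<^sup>2) powr (\<gamma> - 1)"
          unfolding r2 powr_add using r by simp
        finally show ?thesis by simp
      qed
      finally show ?thesis by (simp add: c3_def r_def algebra_simps)
    qed (use C \<gamma> M(5) in simp)
    show ?E
    proof (cases "h = 0")
      case True
      then show ?thesis by (simp add: pot_def integrand_def heat_tx_def)
    next
      case False
      define r where "r = norm h"
      have r: "0 < r" using False by (simp add: r_def)
      define \<Phi> where "\<Phi> = (\<lambda>s y. heat_t s (y + h) - heat_t s y - heat_tx h s y)"
      have \<Phi>: "(\<lambda>p. \<Phi> (fst p) (snd p)) \<in> borel_measurable borel" unfolding \<Phi>_def by measurable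
      have r2: "(r\<^sup>2) powr k = r powr (2 * k)" for k
        using r by (simp add: powr_powr flip: powr_numeral)
      have ir: "integrable lborel (integrand {0<..r\<^sup>2} (\<lambda>s y. heat_t s (y + h)) F t x)"
        unfolding integrand_shift using near_t(1) r by simp
      have r20: "0 < r\<^sup>2" using r by simp
      have n1: "integrable lborel (integrand {0<..r\<^sup>2} \<Phi> F t x)"
        "pot {0<..r\<^sup>2} \<Phi> F t x = pot {0<..r\<^sup>2} heat_t F t (x + h) - pot {0<..r\<^sup>2} heat_t F t x - pot {0<..r\<^sup>2} (heat_tx h) F t x"
        unfolding \<Phi>_def using pot_diff[OF pot_diff(1)[OF ir near_t(1)[OF r20]] near_x(1)[OF r20]]
          pot_diff(2)[OF ir near_t(1)[OF r20]] by (auto simp: pot_shift)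
      have far: "\<bar>\<Phi> s y\<bar> \<le> C * r\<^sup>2 * s powr (-2) * heat_kernel (4 * s) y" if "r\<^sup>2 < s" for s y
        using bnd[of s y undefined h] that r20 unfolding \<Phi>_def r_def by auto
      have n2: "integrable lborel (integrand {r\<^sup>2<..} \<Phi> F t x)"
        "\<bar>pot {r\<^sup>2<..} \<Phi> F t x\<bar> \<le> C * r\<^sup>2 * M * ((r\<^sup>2) powr (\<gamma> - 2 + 1) / (2 - \<gamma> - 1))"
        using C \<gamma> r20 by (intro pot_bound_far[OF \<Phi> F r20 _ _ far]; simp)+
      have ir': "integrable lborel (integrand {0<..} (\<lambda>s y. heat_t s (y + h)) F t x)"
        unfolding integrand_shift by (rule tot_t)
      have "pot {0<..} heat_t F t (x + h) - pot {0<..} heat_t F t x - pot {0<..} (heat_tx h) F t x = pot {0<..} \<Phi> F t x"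
        using pot_diff(2)[OF pot_diff(1)[OF ir' tot_t(1)] tot_x(1)] pot_diff(2)[OF ir' tot_t(1)]
        by (simp add: \<Phi>_def pot_shift)
      also have "\<dots> = pot {0<..r\<^sup>2} \<Phi> F t x + pot {r\<^sup>2<..} \<Phi> F t x"
        using r by (intro pot_split n1 n2) auto
      \<comment> \<open>The three near terms are small separately, each of order r^(2 \<gamma>);
        only the far part uses the cancellation in the Taylor remainder.\<close>
      finally have "\<bar>pot {0<..} heat_t F t (x + h) - pot {0<..} heat_t F t x - pot {0<..} (heat_tx h) F t x\<bar> \<le>
         2 * (C * M * ((r\<^sup>2) powr \<gamma> / \<gamma>)) + C * r * M * ((r\<^sup>2) powr (\<gamma> - 1/2) / (\<gamma> - 1/2)) + C * r\<^sup>2 * M * ((r\<^sup>2) powr (\<gamma> - 1) / (1 - \<gamma>))"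
        using n1(2) n2(2) near_t(2)[OF r20, of "x + h"] near_t(2)[OF r20, of x] near_x(2)[OF r20, of h x]
        by (simp add: add.commute flip: r_def)
      also have "(r\<^sup>2) powr \<gamma> = r powr (2 * \<gamma>)" by (simp add: r2)
      also have "C * r * M * ((r\<^sup>2) powr (\<gamma> - 1/2) / (\<gamma> - 1/2)) = C * M * (r powr (2 * \<gamma>) / (\<gamma> - 1/2))"
      proof -
        have "r powr (2 * \<gamma>) = r powr (1 + 2 * (\<gamma> - 1/2))" by (simp add: algebra_simps)
        also have "\<dots> = r * (r\<^sup>2) powr (\<gamma> - 1/2)"
          unfolding r2 powr_add using r by simp
        finally show ?thesis by simp
      qed
      also have "C * r\<^sup>2 * M * ((r\<^sup>2) powr (\<gamma> - 1) / (1 - \<gamma>)) = C * M * (r powr (2 * \<gamma>) / (1 - \<gamma>))"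
      proof -
        have "r powr (2 * \<gamma>) = r powr (2 + 2 * (\<gamma> - 1))" by (simp add: algebra_simps)
        also have "\<dots> = r\<^sup>2 * (r\<^sup>2) powr (\<gamma> - 1)"
          unfolding r2 powr_add using r by simp
        finally show ?thesis by simp
      qed
      finally show ?thesis by (simp add: c4_def r_def algebra_simps)
    qed
    \<comment> \<open>For m = 1 the tail constant is 1, from the exact integration, and
      \<open>a powr (1 - m)\<close> is 1.\<close>
    have "\<bar>pot {0<..} heat_t F t x - pot {0<..} heat_t F t' x\<bar>
      \<le> (C * (2 powr (\<gamma> - 1 + 1) + 1) / (\<gamma> - 1 + 1) + C / (1 - \<gamma>) + 1) * M * \<bar>t - t'\<bar> powr (\<gamma> - 1 + 1)"
      using C \<gamma> heat_t_potential_tail_bound by (intro pot_time_diff[OF mt F _ _ _ _ bt btt]) auto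
    then show ?F by (simp add: c5_def)
    \<comment> \<open>The tail constant is \<open>2 * C * norm v\<close>, where 2 = 1 / (3/2 - 1)
      comes from the absolute tail bound at m = 3/2.\<close>
    have "\<bar>pot {0<..} (heat_tx v) F t x - pot {0<..} (heat_tx v) F t' x\<bar>
      \<le> (C * norm v * (2 powr (\<gamma> - 3/2 + 1) + 1) / (\<gamma> - 3/2 + 1) + C * norm v / (3/2 - \<gamma>) + 2 * C * norm v) * M * \<bar>t - t'\<bar> powr (\<gamma> - 3/2 + 1)"
    proof (rule pot_time_diff[OF mx F _ _ _ _ bx bxt])
      fix a :: real and D :: "real ^ 'n \<Rightarrow> real" and b x assume "0 < a" "D \<in> borel_measurable borel" "\<And>y. \<bar>D y\<bar> \<le> b"
      then have "\<bar>\<integral>p. indicator {a<..} (fst p) * heat_tx v (fst p) (x - snd p) * D (snd p) \<partial>lborel\<bar>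
        \<le> C * norm v * b * (a powr (1 - 3/2) / (3/2 - 1))"
        using C by (intro tail_bound[OF mx _ _ _ bx]) auto
      then show "\<bar>\<integral>p. indicator {a<..} (fst p) * heat_tx v (fst p) (x - snd p) * D (snd p) \<partial>lborel\<bar>
        \<le> 2 * C * norm v * b * a powr (1 - 3/2)" by (simp add: mult_ac)
    qed (use C \<gamma> in auto)
    then show ?G by (simp add: c6_def algebra_simps add_divide_distrib)
  qed
  note * = this
  have up: "x \<le> K * y" if "x \<le> c * y" "c \<le> K" "0 \<le> y" for x y c
    using that mult_right_mono[of c K y] by linarith
  show ?thesis
    unfolding pot_bounds_def
  proof (intro exI[of _ K] conjI allI impI)
    fix M F and t t' :: real and x h v :: "real ^ 'n" and a :: real
    assume F: "holder_density M F"
    note M = holder_densityD(5)[OF F]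
    note ** = *[OF F, unfolded mult.assoc]
    show "integrable lborel (integrand {0<..} heat_t F t x)" by (rule **(1))
    show "integrable lborel (integrand {0<..} (heat_tx v) F t x)" by (rule **(2))
    show "\<bar>pot {0<..} heat_t F t x\<bar> \<le> K * M" by (rule up[OF **(3) K(2) M])
    show "\<bar>pot {0<..} (heat_tx v) F t x\<bar> \<le> K * norm v * M"
      unfolding mult.assoc by (rule up[OF **(4) K(3)]) (use M in simp)
    show "\<bar>pot {0<..} (heat_tx v) F t (x + h) - pot {0<..} (heat_tx v) F t x\<bar> \<le> K * norm v * M * norm h powr (2 * \<gamma> - 1)"
      unfolding mult.assoc by (rule up[OF **(5) K(4)]) (use M in simp)
    show "\<bar>pot {0<..} heat_t F t (x + h) - pot {0<..} heat_t F t x - pot {0<..} (heat_tx h) F t x\<bar> \<le> K * M * norm h powr (2 * \<gamma>)"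
      unfolding mult.assoc by (rule up[OF **(6) K(5)]) (use M in simp)
    show "\<bar>pot {0<..} heat_t F t x - pot {0<..} heat_t F t' x\<bar> \<le> K * M * \<bar>t - t'\<bar> powr \<gamma>"
      unfolding mult.assoc by (rule up[OF **(7) K(6)]) (use M in simp)
    show "\<bar>pot {0<..} (heat_tx v) F t x - pot {0<..} (heat_tx v) F t' x\<bar> \<le> K * norm v * M * \<bar>t - t'\<bar> powr (\<gamma> - 1/2)"
      unfolding mult.assoc by (rule up[OF **(8) K(7)]) (use M in simp)
    assume "0 < a"
    then show "\<bar>pot {0<..a} heat_t F t x\<bar> \<le> K * M * a powr \<gamma>"
      unfolding mult.assoc by (intro up[OF **(9)[rule_format] K(8)]) (use M in auto)
  qed (rule K)
qed

end

section \<open>Test functions and integration by parts\<close>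

lemma iter_deriv_append: "iter_deriv bs (iter_deriv cs f) = iter_deriv (bs @ cs) f"
  by (induction bs) auto

lemma smooth_frechet_derivative:
  assumes "smooth f" "b \<in> Basis"
  shows "smooth (\<lambda>z. frechet_derivative f (at z) b)"
proof -
  have "(\<lambda>z. frechet_derivative f (at z) b) = iter_deriv [b] f" by simp
  then show ?thesis
    using assms unfolding smooth_def by (auto simp only: iter_deriv_append set_append) auto
qed

lemma smooth_imp_differentiable: "smooth f \<Longrightarrow> f differentiable (at z)"
  unfolding smooth_def by (metis empty_subsetI iter_deriv.simps(1) list.set(1))

lemma test_functionD:
  assumes "\<phi> \<in> test_functions U"
  shows "smooth \<phi>" "\<phi> differentiable (at z)" "continuous_on UNIV \<phi>" "\<phi> \<in> borel_measurable borel"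
    "compact (supp \<phi>)" "supp \<phi> \<subseteq> U" "z \<notin> U \<Longrightarrow> \<phi> z = 0"
proof -
  show *: "smooth \<phi>" "compact (supp \<phi>)" and U: "supp \<phi> \<subseteq> U" using assms by (auto simp: test_functions_def)
  show "\<phi> differentiable (at z)" for z by (rule smooth_imp_differentiable) (rule *)
  then show "continuous_on UNIV \<phi>"
    by (simp add: continuous_at_imp_continuous_on differentiable_imp_continuous_within)
  then show "\<phi> \<in> borel_measurable borel" by (rule borel_measurable_continuous_onI)
  show "\<phi> z = 0" if "z \<notin> U" for z
    using U that closure_subset[of "{z. \<phi> z \<noteq> 0}"] unfolding supp_def by auto
qed

text \<open>Off the closed support the function equals 0 on an open set, so uniqueness of the
  derivative makes the derivative vanish there.\<close>

lemma supp_frechet_derivative_subset: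
  assumes "\<And>z. f differentiable (at z)"
  shows "supp (\<lambda>z. frechet_derivative f (at z) b) \<subseteq> supp f"
  unfolding supp_def
proof (rule closure_minimal)
  show "{z. frechet_derivative f (at z) b \<noteq> 0} \<subseteq> closure {z. f z \<noteq> 0}"
  proof (rule subsetI, rule ccontr)
    fix z assume z: "z \<in> {z. frechet_derivative f (at z) b \<noteq> 0}" and n: "z \<notin> closure {z. f z \<noteq> 0}"
    have "((\<lambda>_. 0) has_derivative frechet_derivative f (at z)) (at z)"
    proof (rule has_derivative_transform_within_open)
      show "(f has_derivative frechet_derivative f (at z)) (at z)"
        using assms frechet_derivative_works by blast
      show "open (- closure {z. f z \<noteq> 0})" by auto
      show "z \<in> - closure {z. f z \<noteq> 0}" using n by simp
      show "f w = 0" if "w \<in> - closure {z. f z \<noteq> 0}" for w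
        using that closure_subset[of "{z. f z \<noteq> 0}"] by auto
    qed
    moreover have "((\<lambda>_. 0) has_derivative (\<lambda>_. 0)) (at z)" by (rule has_derivative_const)
    ultimately have "frechet_derivative f (at z) = (\<lambda>_. 0)" by (rule has_derivative_unique)
    then show False using z by simp
  qed
qed simp

lemma test_function_frechet_derivative:
  assumes "\<phi> \<in> test_functions U" "b \<in> Basis"
  shows "(\<lambda>z. frechet_derivative \<phi> (at z) b) \<in> test_functions U"
proof -
  have s: "supp (\<lambda>z. frechet_derivative \<phi> (at z) b) \<subseteq> supp \<phi>"
    by (intro supp_frechet_derivative_subset test_functionD(2)[OF assms(1)])
  moreover have "compact (supp (\<lambda>z. frechet_derivative \<phi> (at z) b))"
    using compact_Int_closed[OF test_functionD(5)[OF assms(1)], of "supp (\<lambda>z. frechet_derivative \<phi> (at z) b)"] s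
    by (simp add: supp_def Int_absorb1)
  ultimately show ?thesis
    using assms smooth_frechet_derivative test_functionD(1,6)[OF assms(1)] unfolding test_functions_def by blast
qed

lemma DERIV_test_function_line:
  assumes "\<phi> \<in> test_functions U"
  shows "((\<lambda>r. \<phi> (z + r *\<^sub>R b)) has_real_derivative frechet_derivative \<phi> (at (z + r *\<^sub>R b)) b) (at r)"
proof -
  have d: "(\<phi> has_derivative frechet_derivative \<phi> (at (z + r *\<^sub>R b))) (at (z + r *\<^sub>R b))"
    using test_functionD(2)[OF assms] frechet_derivative_works by blast
  have "((\<lambda>r. \<phi> (z + r *\<^sub>R b)) has_derivative (\<lambda>h. frechet_derivative \<phi> (at (z + r *\<^sub>R b)) (h *\<^sub>R b))) (at r)"
    by (rule has_derivative_compose[where f = "\<lambda>r. z + r *\<^sub>R b", OF _ d]) (auto intro!: derivative_eq_intros)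
  moreover have "frechet_derivative \<phi> (at (z + r *\<^sub>R b)) (h *\<^sub>R b) = frechet_derivative \<phi> (at (z + r *\<^sub>R b)) b * h" for h
    using linear_cmul[OF has_derivative_linear[OF d]] by simp
  ultimately show ?thesis by (simp add: has_field_derivative_def)
qed

lemma test_function_bounded_support:
  assumes "\<phi> \<in> test_functions U"
  obtains R where "0 < R" "\<And>z. R < norm z \<Longrightarrow> \<phi> z = 0"
proof -
  obtain R where R: "\<forall>z\<in>supp \<phi>. norm z \<le> R"
    using compact_imp_bounded[OF test_functionD(5)[OF assms]] bounded_iff by blast
  have "\<phi> z = 0" if "max R 1 < norm z" for z
    using R that closure_subset[of "{z. \<phi> z \<noteq> 0}"] unfolding supp_def by force
  then show thesis by (intro that[of "max R 1"]) auto
qed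

lemma
  fixes f :: "'a::euclidean_space \<Rightarrow> real"
  assumes cont: "continuous_on UNIV f" and supp: "\<And>z. R < norm z \<Longrightarrow> f z = 0"
  shows bounded_of_compact_support: "\<exists>B\<ge>0. \<forall>z. \<bar>f z\<bar> \<le> B"
    and integrable_of_compact_support: "integrable lborel f"
proof -
  have "compact (f ` cball 0 R)"
    by (intro compact_continuous_image continuous_on_subset[OF cont]) auto
  then obtain B where B: "\<forall>y\<in>f ` cball 0 R. norm y \<le> B"
    using compact_imp_bounded bounded_iff by blast
  have *: "\<bar>f z\<bar> \<le> max B 0 * indicator (cball 0 R) z" for z
    using B supp[of z] by (cases "norm z \<le> R") (auto simp: le_max_iff_disj)
  moreover have "max B 0 * indicator (cball 0 R) z \<le> max B 0" for z :: 'a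
    by (auto simp: indicator_def)
  ultimately show "\<exists>B\<ge>0. \<forall>z. \<bar>f z\<bar> \<le> B"
    by (intro exI[of _ "max B 0"] conjI allI) (auto intro: order_trans)
  show "integrable lborel f"
  proof (rule Bochner_Integration.integrable_bound)
    show "integrable lborel (\<lambda>z. max B 0 * indicator (cball 0 R) z :: real)"
      by (intro integrable_mult_right integrable_real_indicator)
        (use emeasure_bounded_finite[of "cball 0 R"] in auto)
    show "f \<in> borel_measurable lborel" using cont borel_measurable_continuous_onI by simp
    show "AE x in lborel. norm (f x) \<le> norm (max B 0 * indicator (cball 0 R) x :: real)"
      using * by (auto intro!: AE_I2 order_trans[OF _ abs_ge_self])
  qed
qed

text \<open>Derivatives along basis vectors are again test functions, hence bounded; the mean value
  theorem on the segment and the expansion of h in the basis give one global constant.\<close>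

lemma test_function_Lipschitz:
  fixes \<phi> :: "'a::euclidean_space \<Rightarrow> real"
  assumes \<phi>: "\<phi> \<in> test_functions U"
  obtains L where "0 \<le> L" "\<And>z h. \<bar>\<phi> (z + h) - \<phi> z\<bar> \<le> L * norm h"
proof -
  have "\<forall>b\<in>Basis. \<exists>B. \<forall>z. \<bar>frechet_derivative \<phi> (at z) b\<bar> \<le> B"
  proof
    fix b :: 'a assume b: "b \<in> Basis"
    note t = test_function_frechet_derivative[OF \<phi> b]
    obtain R where "\<And>z. R < norm z \<Longrightarrow> frechet_derivative \<phi> (at z) b = 0"
      using test_function_bounded_support[OF t] by blast
    then show "\<exists>B. \<forall>z. \<bar>frechet_derivative \<phi> (at z) b\<bar> \<le> B"
      using bounded_of_compact_support[OF test_functionD(3)[OF t]] by blast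
  qed
  then obtain B where B: "\<And>b z. b \<in> Basis \<Longrightarrow> \<bar>frechet_derivative \<phi> (at z) b\<bar> \<le> B b" by metis
  have B0: "0 \<le> B b" if "b \<in> Basis" for b using B[OF that] abs_ge_zero by (meson order_trans)
  have "\<bar>\<phi> (z + h) - \<phi> z\<bar> \<le> (\<Sum>b\<in>Basis. B b) * norm h" for z h
  proof -
    obtain r where r: "\<phi> (z + h) - \<phi> z = frechet_derivative \<phi> (at (z + r *\<^sub>R h)) h"
      using MVT_line[of \<phi> z h "\<lambda>w. frechet_derivative \<phi> (at w) h"] DERIV_test_function_line[OF \<phi>] by blast
    let ?w = "z + r *\<^sub>R h"
    have lin: "linear (frechet_derivative \<phi> (at ?w))"
      using test_functionD(2)[OF \<phi>, of ?w] frechet_derivative_works has_derivative_linear by blast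
    have "frechet_derivative \<phi> (at ?w) h = frechet_derivative \<phi> (at ?w) (\<Sum>b\<in>Basis. (h \<bullet> b) *\<^sub>R b)"
      by (simp add: euclidean_representation)
    also have "\<dots> = (\<Sum>b\<in>Basis. (h \<bullet> b) * frechet_derivative \<phi> (at ?w) b)"
      by (simp add: linear_sum[OF lin] linear_cmul[OF lin])
    finally have "\<bar>\<phi> (z + h) - \<phi> z\<bar> \<le> (\<Sum>b\<in>Basis. \<bar>(h \<bullet> b) * frechet_derivative \<phi> (at ?w) b\<bar>)"
      unfolding r by (simp only:) (rule sum_abs)
    also have "\<dots> \<le> (\<Sum>b\<in>Basis. norm h * B b)"
      unfolding abs_mult by (intro sum_mono mult_mono B Basis_le_norm) auto
    finally show ?thesis by (simp add: sum_distrib_left mult.commute)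
  qed
  moreover have "0 \<le> (\<Sum>b\<in>Basis. B b)" using B0 by (intro sum_nonneg) auto
  ultimately show thesis using that by blast
qed

section \<open>Integration by parts against the heat kernel\<close>

lemma integration_by_parts_twice:
  fixes k \<eta> :: "'a::euclidean_space \<Rightarrow> real"
  assumes k: "\<And>z r. ((\<lambda>r. k (z + r *\<^sub>R b)) has_real_derivative k1 (z + r *\<^sub>R b)) (at r)"
      "\<And>z r. ((\<lambda>r. k1 (z + r *\<^sub>R b)) has_real_derivative k2 (z + r *\<^sub>R b)) (at r)"
    and \<eta>: "\<And>z r. ((\<lambda>r. \<eta> (z + r *\<^sub>R b)) has_real_derivative \<eta>1 (z + r *\<^sub>R b)) (at r)"
      "\<And>z r. ((\<lambda>r. \<eta>1 (z + r *\<^sub>R b)) has_real_derivative \<eta>2 (z + r *\<^sub>R b)) (at r)"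
    and cont [continuous_intros]: "continuous_on UNIV k" "continuous_on UNIV k1" "continuous_on UNIV k2"
      "continuous_on UNIV \<eta>" "continuous_on UNIV \<eta>1" "continuous_on UNIV \<eta>2"
    and supp: "\<And>z. R < norm z \<Longrightarrow> \<eta> z = 0" "\<And>z. R < norm z \<Longrightarrow> \<eta>1 z = 0" "\<And>z. R < norm z \<Longrightarrow> \<eta>2 z = 0"
  shows "integrable lborel (\<lambda>z. k2 z * \<eta> z)" "integrable lborel (\<lambda>z. k z * \<eta>2 z)"
    "(\<integral>z. k2 z * \<eta> z \<partial>lborel) = (\<integral>z. k z * \<eta>2 z \<partial>lborel)"
proof -
  show int: "integrable lborel (\<lambda>z. k2 z * \<eta> z)" "integrable lborel (\<lambda>z. k z * \<eta>2 z)"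
    by (rule integrable_of_compact_support[where R = R]; (intro continuous_intros | simp add: supp))+
  \<comment> \<open>In the derivative of this combination along b the products of first derivatives
    cancel, so a single vanishing integral performs both integrations by parts.\<close>
  define h where "h z = k z * \<eta>1 z - k1 z * \<eta> z" for z
  define h' where "h' z = k z * \<eta>2 z - k2 z * \<eta> z" for z
  have d: "((\<lambda>r. h (z + r *\<^sub>R b)) has_real_derivative h' (z + r *\<^sub>R b)) (at r)" for z r
    unfolding h_def h'_def by (rule derivative_eq_intros k \<eta> refl)+ (simp add: algebra_simps)
  have "continuous_on UNIV h" "continuous_on UNIV h'" unfolding h_def h'_def by (intro continuous_intros)+
  moreover have s: "h z = 0" "h' z = 0" if "R < norm z" for z using that by (auto simp: h_def h'_def supp)
  ultimately obtain B where "\<And>z. \<bar>h' z\<bar> \<le> B" using bounded_of_compact_support[of h' R] by blast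
  then have "(\<integral>z. h' z \<partial>lborel) = 0"
    using integral_directional_derivative[of h b h' B R] d s \<open>continuous_on UNIV h\<close> borel_measurable_continuous_onI
    by blast
  then show "(\<integral>z. k2 z * \<eta> z \<partial>lborel) = (\<integral>z. k z * \<eta>2 z \<partial>lborel)"
    using int by (simp add: h'_def)
qed

lemma continuous_on_heat_kernel [continuous_intros]:
  assumes "continuous_on S f" "continuous_on S g" "\<And>w. w \<in> S \<Longrightarrow> 0 < f w"
  shows "continuous_on S (\<lambda>w. heat_kernel (f w) (g w :: real ^ 'n))"
proof -
  have "continuous_on S (\<lambda>w. (4 * pi * f w) powr (- real CARD('n) / 2) * exp (- (norm (g w))\<^sup>2 / (4 * f w)))"
    using assms by (auto intro!: continuous_intros simp: less_imp_neq[symmetric])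
  then show ?thesis
    using assms(3) by (subst continuous_on_cong[OF refl]) (auto simp: heat_kernel_def)
qed

lemma continuous_on_heat_derivs [continuous_intros]:
  assumes "continuous_on S f" "continuous_on S g" "\<And>w. w \<in> S \<Longrightarrow> 0 < f w"
  shows "continuous_on S (\<lambda>w. heat_t (f w) (g w :: real ^ 'n))"
    and "continuous_on S (\<lambda>w. heat_tt (f w) (g w :: real ^ 'n))"
    and "continuous_on S (\<lambda>w. heat_x v (f w) (g w :: real ^ 'n))"
    and "continuous_on S (\<lambda>w. heat_tx v (f w) (g w :: real ^ 'n))"
    and "continuous_on S (\<lambda>w. heat_txx v u (f w) (g w :: real ^ 'n))"
proof -
  have "f w \<noteq> 0" if "w \<in> S" for w using assms(3)[OF that] by simp
  then show "continuous_on S (\<lambda>w. heat_t (f w) (g w :: real ^ 'n))"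
    and "continuous_on S (\<lambda>w. heat_tt (f w) (g w :: real ^ 'n))"
    and "continuous_on S (\<lambda>w. heat_x v (f w) (g w :: real ^ 'n))"
    and "continuous_on S (\<lambda>w. heat_tx v (f w) (g w :: real ^ 'n))"
    and "continuous_on S (\<lambda>w. heat_txx v u (f w) (g w :: real ^ 'n))"
    unfolding heat_t_def heat_tt_def heat_x_def heat_tx_def heat_txx_def using assms
    by (auto intro!: continuous_intros)
qed

lemma sum_axis_inner: "(\<Sum>i\<in>UNIV. (z \<bullet> axis i 1) * (z \<bullet> axis i 1)) = z \<bullet> (z :: real ^ 'n)"
  by (simp add: inner_axis) (simp add: inner_vec_def)

text \<open>The heat equation for the kernel, written as a sum over the axes so that it matches
  integrations by parts in one direction each.\<close>

lemma heat_t_eq_laplacian: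
  fixes z :: "real ^ 'n"
  assumes "0 < s"
  shows "(\<Sum>i\<in>UNIV. heat_kernel s z * ((z \<bullet> axis i 1) * (z \<bullet> axis i 1) / (4 * s\<^sup>2) - (axis i 1 \<bullet> axis i (1::real)) / (2 * s)))
    = heat_t s z"
  unfolding heat_t_def sum_distrib_left[symmetric] sum_subtractf sum_divide_distrib[symmetric] sum_axis_inner
  by (simp add: inner_axis_axis)

text \<open>The time derivative of the kernel solves the heat equation as well; this identity drives
  the Green formula below.\<close>

lemma heat_tt_eq_laplacian:
  fixes z :: "real ^ 'n"
  assumes "0 < s"
  shows "(\<Sum>i\<in>UNIV. heat_txx (axis i 1) (axis i 1) s z) = heat_tt s z"
proof -
  define b where "b = (real CARD('n) + 2) / (4 * s\<^sup>2) - (z \<bullet> z) / (8 * s ^ 3)"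
  have "(\<Sum>i\<in>UNIV. heat_txx (axis i 1) (axis i 1) s z) = heat_kernel s z *
      (\<Sum>i\<in>UNIV. b - ((z \<bullet> axis i 1) * (z \<bullet> axis i 1)) * (1 / (4 * s ^ 3) + b / (2 * s)))"
    unfolding heat_txx_def sum_distrib_left b_def[symmetric]
    by (intro sum.cong refl) (simp add: inner_axis_axis algebra_simps)
  also have "\<dots> = heat_kernel s z * (real CARD('n) * b - (z \<bullet> z) * (1 / (4 * s ^ 3) + b / (2 * s)))"
    unfolding sum_subtractf sum_distrib_right[symmetric] sum_axis_inner by simp
  also have "\<dots> = heat_tt s z"
    unfolding heat_tt_def b_def using assms
    by (simp add: field_simps power2_eq_square power3_eq_cube power4_eq_xxxx)
  finally show ?thesis .
qed

section \<open>The heat equation in the sense of distributions\<close>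

definition pd :: "'a::euclidean_space \<Rightarrow> ('a \<Rightarrow> real) \<Rightarrow> 'a \<Rightarrow> real" where
  "pd b \<phi> = (\<lambda>z. frechet_derivative \<phi> (at z) b)"

definition lap :: "(real \<times> (real ^ 'n) \<Rightarrow> real) \<Rightarrow> real \<times> (real ^ 'n) \<Rightarrow> real" where
  "lap \<phi> = (\<lambda>z. \<Sum>i\<in>UNIV. pd (0, axis i 1) (pd (0, axis i 1) \<phi>) z)"

text \<open>What the Fubini and limit arguments use of a test function. Closure under sums is
  immediate for this class, so it also covers the Laplacian of a test function.\<close>

definition compact_lipschitz :: "('a::euclidean_space \<Rightarrow> real) \<Rightarrow> bool" where
  "compact_lipschitz f \<longleftrightarrow> continuous_on UNIV f \<and> (\<exists>R>0. \<forall>z. R < norm z \<longrightarrow> f z = 0) \<and>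
     (\<exists>L\<ge>0. \<forall>z h. \<bar>f (z + h) - f z\<bar> \<le> L * norm h)"

lemma space_time_Basis: "(1, 0) \<in> (Basis :: (real \<times> (real ^ 'n)) set)" "(0, axis i 1) \<in> (Basis :: (real \<times> (real ^ 'n)) set)"
  by (auto simp: Basis_prod_def Basis_vec_def)

lemma compact_lipschitz_test_function:
  assumes "\<phi> \<in> test_functions U"
  shows "compact_lipschitz \<phi>"
proof -
  obtain R where "0 < R" "\<And>z. R < norm z \<Longrightarrow> \<phi> z = 0" using test_function_bounded_support[OF assms] by blast
  moreover obtain L where "0 \<le> L" "\<And>z h. \<bar>\<phi> (z + h) - \<phi> z\<bar> \<le> L * norm h" using test_function_Lipschitz[OF assms] by blast
  ultimately show ?thesis
    using test_functionD(3)[OF assms] unfolding compact_lipschitz_def by blast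
qed

lemma compact_lipschitz_zero: "compact_lipschitz (\<lambda>z. 0)"
  unfolding compact_lipschitz_def by (auto intro!: exI[of _ 1])

lemma compact_lipschitz_add:
  assumes f: "compact_lipschitz f" and g: "compact_lipschitz g"
  shows "compact_lipschitz (\<lambda>z. f z + g z)"
proof -
  obtain R L where R: "0 < R" "\<And>z. R < norm z \<Longrightarrow> f z = 0" and L: "0 \<le> L" "\<And>z h. \<bar>f (z + h) - f z\<bar> \<le> L * norm h"
    and cf: "continuous_on UNIV f"
    using f unfolding compact_lipschitz_def by blast
  obtain R' L' where R': "0 < R'" "\<And>z. R' < norm z \<Longrightarrow> g z = 0" and L': "0 \<le> L'" "\<And>z h. \<bar>g (z + h) - g z\<bar> \<le> L' * norm h"
    and cg: "continuous_on UNIV g"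
    using g unfolding compact_lipschitz_def by blast
  have "\<bar>(f (z + h) + g (z + h)) - (f z + g z)\<bar> \<le> (L + L') * norm h" for z h
    using L(2)[of z h] L'(2)[of z h] by (simp add: distrib_right)
  then show ?thesis
    unfolding compact_lipschitz_def using R R' L L' cf cg
    by (intro conjI exI[of _ "max R R'"] exI[of _ "L + L'"] continuous_intros) auto
qed

lemma compact_lipschitz_sum:
  "(\<And>i. i \<in> I \<Longrightarrow> compact_lipschitz (f i)) \<Longrightarrow> compact_lipschitz (\<lambda>z. \<Sum>i\<in>I. f i z)"
  by (induction I rule: infinite_finite_induct) (auto intro: compact_lipschitz_zero compact_lipschitz_add)

lemma
  assumes "compact_lipschitz f"
  shows compact_lipschitz_continuous: "continuous_on UNIV f"
    and compact_lipschitz_measurable: "f \<in> borel_measurable borel"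
    and compact_lipschitz_integrable: "integrable lborel f"
    and compact_lipschitz_bounded: "\<exists>B\<ge>0. \<forall>z. \<bar>f z\<bar> \<le> B"
    and compact_lipschitz_supp: "\<exists>R>0. \<forall>z. R < norm z \<longrightarrow> f z = 0"
    and compact_lipschitz_diff: "\<exists>L\<ge>0. \<forall>z h. \<bar>f (z + h) - f z\<bar> \<le> L * norm h"
  using assms borel_measurable_continuous_onI integrable_of_compact_support bounded_of_compact_support
  unfolding compact_lipschitz_def by blast+

lemma test_function_pd:
  fixes \<phi> :: "real \<times> (real ^ 'n) \<Rightarrow> real"
  shows "\<phi> \<in> test_functions U \<Longrightarrow> pd (1, 0) \<phi> \<in> test_functions U"
    and "\<phi> \<in> test_functions U \<Longrightarrow> pd (0, axis i 1) \<phi> \<in> test_functions U"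
  unfolding pd_def by (auto intro!: test_function_frechet_derivative space_time_Basis)

lemma compact_lipschitz_lap:
  "\<phi> \<in> test_functions U \<Longrightarrow> compact_lipschitz (lap \<phi>)"
  unfolding lap_def by (intro compact_lipschitz_sum compact_lipschitz_test_function test_function_pd)

lemma DERIV_test_function_space:
  assumes "\<phi> \<in> test_functions U"
  shows "((\<lambda>r. \<phi> (t, y + (z + r *\<^sub>R b))) has_real_derivative pd (0, b) \<phi> (t, y + (z + r *\<^sub>R b))) (at r)"
  using DERIV_test_function_line[OF assms, of "(t, y + z)" "(0, b)"] by (simp add: pd_def add.assoc)

lemma DERIV_test_function_time:
  assumes "\<phi> \<in> test_functions U"
  shows "((\<lambda>s. \<phi> (t + s, x)) has_real_derivative pd (1, 0) \<phi> (t + s, x)) (at s)"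
  using DERIV_test_function_line[OF assms, of "(t, x)" "(1, 0)"] by (simp add: pd_def)

lemma norm_le_norm_add: "norm (z :: 'b::real_normed_vector) \<le> norm (y + z) + norm y"
  using norm_triangle_ineq4[of "y + z" y] by simp

text \<open>On the slice at a fixed s > 0 the kernel is smooth and \<phi> has compact support, so no
  boundary terms arise; summing over the axes and applying the heat equation turns the Laplacian of
  the kernel into a time derivative.\<close>

lemma heat_kernel_ibp:
  fixes \<phi> :: "real \<times> (real ^ 'n) \<Rightarrow> real"
  assumes s: "0 < s" and \<phi>: "\<phi> \<in> test_functions U"
  shows "(\<integral>z. heat_t s z * \<phi> (t, y + z) \<partial>lborel) = (\<integral>z. heat_kernel s z * lap \<phi> (t, y + z) \<partial>lborel)"
    and "(\<integral>z. heat_tt s z * \<phi> (t, y + z) \<partial>lborel) = (\<integral>z. heat_t s z * lap \<phi> (t, y + z) \<partial>lborel)"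
proof -
  have ex: "\<exists>R>0. \<forall>i. \<forall>z. R < norm z \<longrightarrow> \<phi> (t, y + z) = 0 \<and> pd (0, axis i 1) \<phi> (t, y + z) = 0 \<and>
      pd (0, axis i 1) (pd (0, axis i 1) \<phi>) (t, y + z) = 0"
  proof -
    obtain R where R: "0 < R" "\<And>z. R < norm z \<Longrightarrow> \<phi> z = 0" using test_function_bounded_support[OF \<phi>] by blast
    have out: "pd b f z = 0" if "\<And>z. R < norm z \<Longrightarrow> f z = 0" "R < norm z" "\<And>z. f differentiable (at z)"
      for b f and z :: "real \<times> (real ^ 'n)"
    proof -
      have "supp f \<subseteq> cball 0 R" unfolding supp_def using that(1) by (intro closure_minimal) (force simp: not_less)+
      then have "supp (pd b f) \<subseteq> cball 0 R"
        unfolding pd_def using supp_frechet_derivative_subset[OF that(3), of b] by blast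
      then show ?thesis
        using that(2) closure_subset[of "{z. pd b f z \<noteq> 0}"] unfolding supp_def by force
    qed
    have 1: "pd (0, axis i 1) \<phi> z = 0" if "R < norm z" for z i
      by (rule out[of \<phi>, OF R(2) that test_functionD(2)[OF \<phi>]])
    have 2: "pd (0, axis i 1) (pd (0, axis i 1) \<phi>) z = 0" if "R < norm z" for z i
      by (rule out[of "pd (0, axis i 1) \<phi>", OF 1 that test_functionD(2)[OF test_function_pd(2)[OF \<phi>]]])
    have "R < norm (t, y + z)" if "R + norm y < norm z" for z
      using that norm_le_norm_add[of z y] norm_snd_le[of "y + z" t] by simp
    then show ?thesis using R 1 2 by (intro exI[of _ "R + norm y"]) (auto intro: add_pos_nonneg)
  qed
  then obtain R where R: "\<And>i z. R < norm z \<Longrightarrow> \<phi> (t, y + z) = 0" "\<And>i z. R < norm z \<Longrightarrow> pd (0, axis i 1) \<phi> (t, y + z) = 0"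
    "\<And>i z. R < norm z \<Longrightarrow> pd (0, axis i 1) (pd (0, axis i 1) \<phi>) (t, y + z) = 0" by blast
  have c: "continuous_on UNIV (\<lambda>z. f (t, y + z))" if "f \<in> test_functions U" for f
    by (rule continuous_on_compose2[OF test_functionD(3)[OF that]]) (auto intro!: continuous_intros)
  note cs = c[OF \<phi>] c[OF test_function_pd(2)[OF \<phi>]] c[OF test_function_pd(2)[OF test_function_pd(2)[OF \<phi>]]]
  define k2 where "k2 i z = heat_kernel s z * ((z \<bullet> axis i 1) * (z \<bullet> axis i 1) / (4 * s\<^sup>2) - (axis i 1 \<bullet> axis i (1::real)) / (2 * s))" for i and z :: "real ^ 'n"
  have ck2: "continuous_on UNIV (k2 i)" for i
    unfolding k2_def using s by (intro continuous_intros) auto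
  have c0: "continuous_on UNIV (heat_kernel s :: real ^ 'n \<Rightarrow> real)" "continuous_on UNIV (heat_t s :: real ^ 'n \<Rightarrow> real)"
    "continuous_on UNIV (heat_x v s)" "continuous_on UNIV (heat_tx v s)" "continuous_on UNIV (heat_txx v u s)" for v u :: "real ^ 'n"
    using s by (intro continuous_intros; simp)+
  have k2d: "((\<lambda>r. heat_x (axis i 1) s (z + r *\<^sub>R axis i 1)) has_real_derivative k2 i (z + r *\<^sub>R axis i 1)) (at r)" for i z r
    unfolding k2_def by (rule DERIV_heat_x[OF s])
  note ibp = integration_by_parts_twice[OF DERIV_heat_kernel_x[OF s] k2d
      DERIV_test_function_space[OF \<phi>] DERIV_test_function_space[OF test_function_pd(2)[OF \<phi>]]
      c0(1) c0(3) ck2 cs R]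
  have "(\<integral>z. heat_t s z * \<phi> (t, y + z) \<partial>lborel) = (\<integral>z. (\<Sum>i\<in>UNIV. k2 i z * \<phi> (t, y + z)) \<partial>lborel)"
    by (simp only: heat_t_eq_laplacian[OF s, symmetric] k2_def sum_distrib_right)
  also have "\<dots> = (\<Sum>i\<in>UNIV. \<integral>z. heat_kernel s z * pd (0, axis i 1) (pd (0, axis i 1) \<phi>) (t, y + z) \<partial>lborel)"
    using ibp by (subst Bochner_Integration.integral_sum) auto
  also have "\<dots> = (\<integral>z. heat_kernel s z * lap \<phi> (t, y + z) \<partial>lborel)"
    unfolding lap_def sum_distrib_left using ibp by (subst Bochner_Integration.integral_sum) auto
  finally show "(\<integral>z. heat_t s z * \<phi> (t, y + z) \<partial>lborel) = (\<integral>z. heat_kernel s z * lap \<phi> (t, y + z) \<partial>lborel)" .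
  note ibp = integration_by_parts_twice[OF DERIV_heat_t_x[OF s] DERIV_heat_tx_x[OF s]
      DERIV_test_function_space[OF \<phi>] DERIV_test_function_space[OF test_function_pd(2)[OF \<phi>]]
      c0(2) c0(4) c0(5) cs R]
  have "(\<integral>z. heat_tt s z * \<phi> (t, y + z) \<partial>lborel) = (\<integral>z. (\<Sum>i\<in>UNIV. heat_txx (axis i 1) (axis i 1) s z * \<phi> (t, y + z)) \<partial>lborel)"
    by (simp only: heat_tt_eq_laplacian[OF s, symmetric] sum_distrib_right)
  also have "\<dots> = (\<Sum>i\<in>UNIV. \<integral>z. heat_t s z * pd (0, axis i 1) (pd (0, axis i 1) \<phi>) (t, y + z) \<partial>lborel)"
    using ibp by (subst Bochner_Integration.integral_sum) auto
  also have "\<dots> = (\<integral>z. heat_t s z * lap \<phi> (t, y + z) \<partial>lborel)"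
    unfolding lap_def sum_distrib_left using ibp by (subst Bochner_Integration.integral_sum) auto
  finally show "(\<integral>z. heat_tt s z * \<phi> (t, y + z) \<partial>lborel) = (\<integral>z. heat_t s z * lap \<phi> (t, y + z) \<partial>lborel)" .
qed

lemma integrable_cut_off:
  fixes f :: "real \<times> (real ^ 'n) \<Rightarrow> real"
  assumes "integrable lborel f"
  shows "integrable lborel (\<lambda>p. indicator {a<..} (fst p) * f p)"
proof -
  have "fst -` {a<..} \<in> sets (borel :: (real \<times> (real ^ 'n)) measure)"
    using measurable_sets_borel[OF borel_measurable_fst_snd(1), of "{a<..}"] by simp
  then have "integrable lborel (\<lambda>p. f p * indicator (fst -` {a<..}) p)"
    using assms by (intro integrable_real_mult_indicator) auto
  then show ?thesis by (rule back_subst[of "integrable lborel"]) (auto simp: indicator_def)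
qed

text \<open>Both derivatives are moved to the kernel, by \<open>heat_tt = \<Delta> heat_t\<close>, so that no mixed partial
  derivatives of \<open>\<phi>\<close> need to be commuted. The kernel with \<open>s\<close> replaced by \<open>max s \<epsilon>\<close> is
  continuous everywhere, which gives integrability against compactly supported functions.\<close>

lemma heat_kernel_green:
  fixes \<phi> :: "real \<times> (real ^ 'n) \<Rightarrow> real"
  assumes \<epsilon>: "0 < \<epsilon>" and \<phi>: "\<phi> \<in> test_functions U"
  shows "(\<integral>v. indicator {\<epsilon><..} (fst v) * heat_t (fst v) (snd v) * (pd (1, 0) \<phi> (w + v) + lap \<phi> (w + v)) \<partial>lborel)
    = - (\<integral>z. heat_kernel \<epsilon> z * lap \<phi> (w + (\<epsilon>, z)) \<partial>lborel)"
proof -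
  obtain \<tau> y where w: "w = (\<tau>, y)" by (cases w)
  have cl: "compact_lipschitz \<phi>" "compact_lipschitz (pd (1, 0) \<phi>)" "compact_lipschitz (lap \<phi>)"
    using \<phi> by (auto intro: compact_lipschitz_test_function test_function_pd compact_lipschitz_lap)
  have clp: "compact_lipschitz (\<lambda>v. pd (1, 0) \<phi> v + lap \<phi> v)" by (intro compact_lipschitz_add cl)
  have shift: "\<exists>R>0. \<forall>v. R < norm v \<longrightarrow> f (w + v) = 0" if f: "compact_lipschitz f" for f :: "real \<times> (real ^ 'n) \<Rightarrow> real"
  proof -
    obtain R where R: "0 < R" "\<And>v. R < norm v \<Longrightarrow> f v = 0" using compact_lipschitz_supp[OF f] by blast
    have "f (w + v) = 0" if "R + norm w < norm v" for v
      using that norm_le_norm_add[of v w] by (intro R) simp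
    then show ?thesis using R(1) by (intro exI[of _ "R + norm w"]) (auto intro: add_pos_nonneg)
  qed
  have cont: "continuous_on S (\<lambda>v. f (w + v))" if "compact_lipschitz f" for S and f :: "real \<times> (real ^ 'n) \<Rightarrow> real"
    by (rule continuous_on_compose2[OF compact_lipschitz_continuous[OF that]]) (auto intro!: continuous_intros)
  have int0: "integrable lborel (\<lambda>v. k v * f (w + v))"
    if k: "continuous_on UNIV k" and f: "compact_lipschitz f" for k f :: "real \<times> (real ^ 'n) \<Rightarrow> real"
  proof -
    obtain R where "\<forall>v. R < norm v \<longrightarrow> f (w + v) = 0" using shift[OF f] by blast
    then show ?thesis by (intro integrable_of_compact_support[where R = R] continuous_intros k cont[OF f]) auto
  qed
  define k where "k v = heat_t (max (fst v) \<epsilon>) (snd v)" for v :: "real \<times> (real ^ 'n)"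
  define kt where "kt v = heat_tt (max (fst v) \<epsilon>) (snd v)" for v :: "real \<times> (real ^ 'n)"
  have ck: "continuous_on UNIV k" "continuous_on UNIV kt"
    unfolding k_def kt_def using \<epsilon> by (intro continuous_intros; auto simp: less_max_iff_disj)+
  \<comment> \<open>For s > \<epsilon> this is the derivative in s of \<open>heat_t\<close> times
    the shifted \<phi>. Integrated in z first it gives \<open>g\<close> by the identity on slices;
    integrated in s first it gives the boundary value at \<epsilon>.\<close>
  define j where "j v = indicator {\<epsilon><..} (fst v) * (kt v * \<phi> (w + v) + k v * pd (1, 0) \<phi> (w + v))" for v
  define g where "g v = indicator {\<epsilon><..} (fst v) * (k v * (pd (1, 0) \<phi> (w + v) + lap \<phi> (w + v)))" for v
  have jint: "integrable lborel j"
    unfolding j_def by (intro integrable_cut_off Bochner_Integration.integrable_add int0 ck cl)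
  have gint: "integrable lborel g"
    unfolding g_def by (intro integrable_cut_off int0[OF _ clp] ck)
  have slice: "integrable lborel (\<lambda>z. heat_tt s z * \<phi> (\<tau> + s, y + z))" "integrable lborel (\<lambda>z. heat_t s z * f (\<tau> + s, y + z))"
    if s: "0 < s" and f: "compact_lipschitz f" for s f
  proof -
    have *: "integrable lborel (\<lambda>z. q z * f (\<tau> + s, y + z))" if q: "continuous_on UNIV q" and f: "compact_lipschitz f" for q f
    proof -
      obtain R where R: "\<And>v. R < norm v \<Longrightarrow> f (w + v) = 0" using shift[OF f] by blast
      have "f (\<tau> + s, y + z) = 0" if "R < norm z" for z
        using R[of "(s, z)"] that norm_snd_le[of z s] by (simp add: w)
      moreover have "continuous_on UNIV (\<lambda>z. f (\<tau> + s, y + z))"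
        by (rule continuous_on_compose2[OF compact_lipschitz_continuous[OF f]]) (auto intro!: continuous_intros)
      ultimately show ?thesis by (intro integrable_of_compact_support[where R = R] continuous_intros q) auto
    qed
    show "integrable lborel (\<lambda>z. heat_tt s z * \<phi> (\<tau> + s, y + z))" "integrable lborel (\<lambda>z. heat_t s z * f (\<tau> + s, y + z))"
      using s by (intro * f cl continuous_intros; simp)+
  qed
  have "(\<integral>v. j v \<partial>lborel) = (\<integral>s. (\<integral>z. j (s, z) \<partial>lborel) \<partial>lborel)" by (rule Fubini_lborel(1)[OF jint])
  also have "\<dots> = (\<integral>s. (\<integral>z. g (s, z) \<partial>lborel) \<partial>lborel)"
  proof (rule Bochner_Integration.integral_cong[OF refl])
    fix s :: real
    show "(\<integral>z. j (s, z) \<partial>lborel) = (\<integral>z. g (s, z) \<partial>lborel)"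
    proof (cases "\<epsilon> < s")
      case True
      then have s: "0 < s" using \<epsilon> by simp
      have "(\<integral>z. j (s, z) \<partial>lborel) = (\<integral>z. heat_tt s z * \<phi> (\<tau> + s, y + z) + heat_t s z * pd (1, 0) \<phi> (\<tau> + s, y + z) \<partial>lborel)"
        using True by (simp add: j_def k_def kt_def w max_def)
      also have "\<dots> = (\<integral>z. heat_t s z * lap \<phi> (\<tau> + s, y + z) \<partial>lborel) + (\<integral>z. heat_t s z * pd (1, 0) \<phi> (\<tau> + s, y + z) \<partial>lborel)"
        using slice[OF s cl(2)] heat_kernel_ibp(2)[OF s \<phi>, of "\<tau> + s" y] by simp
      also have "\<dots> = (\<integral>z. g (s, z) \<partial>lborel)"
        using True slice[OF s cl(2)] slice[OF s cl(3)] by (simp add: g_def k_def w max_def distrib_left)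
      finally show ?thesis .
    qed (simp add: j_def g_def)
  qed
  also have "\<dots> = (\<integral>v. g v \<partial>lborel)" by (rule Fubini_lborel(1)[OF gint, symmetric])
  also have "\<dots> = (\<integral>v. indicator {\<epsilon><..} (fst v) * heat_t (fst v) (snd v) * (pd (1, 0) \<phi> (w + v) + lap \<phi> (w + v)) \<partial>lborel)"
    by (intro Bochner_Integration.integral_cong) (auto simp: g_def k_def indicator_def max_def)
  finally have 1: "(\<integral>v. j v \<partial>lborel) = \<dots>" .
  have "(\<integral>v. j v \<partial>lborel) = (\<integral>z. (\<integral>s. j (s, z) \<partial>lborel) \<partial>lborel)" by (rule Fubini_lborel(2)[OF jint])
  also have "\<dots> = (\<integral>z. - (heat_t \<epsilon> z * \<phi> (\<tau> + \<epsilon>, y + z)) \<partial>lborel)"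
  proof (rule Bochner_Integration.integral_cong[OF refl])
    fix z :: "real ^ 'n"
    obtain R where R: "\<And>v. R < norm v \<Longrightarrow> \<phi> (w + v) = 0" using shift[OF cl(1)] by blast
    obtain R' where R': "\<And>v. R' < norm v \<Longrightarrow> pd (1, 0) \<phi> (w + v) = 0" using shift[OF cl(2)] by blast
    define g' where "g' s = kt (s, z) * \<phi> (w + (s, z)) + k (s, z) * pd (1, 0) \<phi> (w + (s, z))" for s
    have cz: "continuous_on UNIV (\<lambda>s. f (s, z))" if "continuous_on UNIV f" for f :: "real \<times> (real ^ 'n) \<Rightarrow> real"
      by (rule continuous_on_compose2[OF that]) (auto intro!: continuous_intros)
    have cg: "continuous_on UNIV g'"
      unfolding g'_def using cz[OF ck(1)] cz[OF ck(2)] cz[OF cont[OF cl(1)]] cz[OF cont[OF cl(2)]] by (intro continuous_intros)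
    have n: "\<bar>s\<bar> \<le> norm (s, z)" for s using norm_fst_le[of s z] by simp
    have "integrable lborel g'"
    proof (rule integrable_of_compact_support[where R = "max R R'", OF cg])
      fix s :: real assume "max R R' < norm s"
      then show "g' s = 0" using R[of "(s, z)"] R'[of "(s, z)"] n[of s] by (simp add: g'_def)
    qed
    then have ig: "integrable lborel (\<lambda>s. indicator {\<epsilon><..} s * g' s)"
      using integrable_real_mult_indicator[of "{\<epsilon><..}" lborel g'] by (simp add: mult.commute)
    have "(\<integral>s. indicator {\<epsilon><..} s * g' s \<partial>lborel) = - (heat_t \<epsilon> z * \<phi> (\<tau> + \<epsilon>, y + z))"
    proof (rule integral_derivative_to_inf[OF _ _ ig])
      fix s assume s: "\<epsilon> \<le> s"
      have "((\<lambda>s. heat_t s z * \<phi> (\<tau> + s, y + z)) has_real_derivative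
         heat_tt s z * \<phi> (\<tau> + s, y + z) + pd (1, 0) \<phi> (\<tau> + s, y + z) * heat_t s z) (at s)"
        using s \<epsilon> by (intro DERIV_mult DERIV_heat_t_t DERIV_test_function_time[OF \<phi>]) auto
      then show "((\<lambda>s. heat_t s z * \<phi> (\<tau> + s, y + z)) has_real_derivative g' s) (at s)"
        using s by (simp add: g'_def k_def kt_def w max_def mult.commute)
    next
      show "isCont g' s" for s using cg by (simp add: continuous_on_eq_continuous_at)
      have "eventually (\<lambda>s. heat_t s z * \<phi> (\<tau> + s, y + z) = 0) at_top"
        using eventually_gt_at_top[of "\<bar>R\<bar>"]
      proof eventually_elim
        case (elim s)
        then show ?case using R[of "(s, z)"] n[of s] by (simp add: w)
      qed
      then show "((\<lambda>s. heat_t s z * \<phi> (\<tau> + s, y + z)) \<longlongrightarrow> 0) at_top" by (rule tendsto_eventually)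
    qed
    then show "(\<integral>s. j (s, z) \<partial>lborel) = - (heat_t \<epsilon> z * \<phi> (\<tau> + \<epsilon>, y + z))"
      by (simp add: j_def g'_def)
  qed
  \<comment> \<open>The boundary value still contains \<open>heat_t \<epsilon>\<close>; moving the
    Laplacian to \<phi> leaves a Gaussian average, which stays bounded as \<epsilon> tends to
    0.\<close>
  also have "\<dots> = - (\<integral>z. heat_kernel \<epsilon> z * lap \<phi> (\<tau> + \<epsilon>, y + z) \<partial>lborel)"
    using heat_kernel_ibp(1)[OF \<epsilon> \<phi>, of "\<tau> + \<epsilon>" y] by simp
  finally show ?thesis using 1 by (simp add: w)
qed

lemma measurable_parameter_integral:
  fixes f :: "'a::euclidean_space \<Rightarrow> 'b::euclidean_space \<Rightarrow> real"
  assumes "(\<lambda>p. f (fst p) (snd p)) \<in> borel_measurable borel"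
  shows "(\<lambda>z. \<integral>v. f z v \<partial>lborel) \<in> borel_measurable borel"
proof (rule lborel.borel_measurable_lebesgue_integral)
  show "(\<lambda>(z, v). f z v) \<in> borel_measurable (borel \<Otimes>\<^sub>M lborel)"
    using assms by (simp add: case_prod_beta' borel_prod[symmetric] cong: measurable_cong_sets)
qed

section \<open>Weak form of the truncated potential\<close>

context heat_domain
begin

lemma measurable_pot:
  assumes \<Phi>: "(\<lambda>p. \<Phi> (fst p) (snd p)) \<in> borel_measurable borel" and F: "holder_density M F"
    and [measurable]: "I \<in> sets borel"
  shows "(\<lambda>z. pot I \<Phi> F (fst z) (snd z)) \<in> borel_measurable borel"
proof -
  note [measurable] = holder_densityD(1)[OF F]
  have [measurable]: "(\<lambda>w :: (real \<times> (real ^ 'n)) \<times> (real \<times> (real ^ 'n)). \<Phi> (fst (snd w)) (snd (fst w) - snd (snd w))) \<in> borel_measurable borel"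
    by (rule measurable_curried[OF \<Phi>]) measurable
  show ?thesis
    unfolding pot_def integrand_def by (rule measurable_parameter_integral) measurable
qed

lemma
  shows cylinder_sets: "{a..b :: real} \<times> \<Omega> \<in> sets lborel"
    and cylinder_finite: "emeasure lborel ({a..b :: real} \<times> \<Omega>) < \<infinity>"
proof -
  show "{a..b} \<times> \<Omega> \<in> sets lborel" using borel_Times[of "{a..b}" \<Omega>] Om by simp
  have "emeasure lborel ({a..b} \<times> \<Omega>) = emeasure (lborel \<Otimes>\<^sub>M lborel) ({a..b} \<times> \<Omega>)" by (simp add: lborel_prod)
  also have "\<dots> = emeasure lborel {a..b} * emeasure lborel \<Omega>"
    by (rule lborel.emeasure_pair_measure_Times) auto
  finally show "emeasure lborel ({a..b} \<times> \<Omega>) < \<infinity>"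
    using fin emeasure_bounded_finite[of "{a..b}"] by (simp add: ennreal_mult_less_top)
qed

text \<open>Time reversal turns \<open>A\<close> into a space-time convolution of F with the cut-off
  kernel, so the adjoint acts on \<psi> through \<open>w + v\<close>. The L1 norm of
  \<open>k (z - w) * F w\<close> in w is at most \<open>W\<close> for all z, which together with
  integrability of \<psi> justifies Fubini.\<close>

lemma swap_history_part:
  assumes F: "holder_density M F" and \<psi>: "compact_lipschitz \<psi>" and \<epsilon>: "0 < \<epsilon>"
  defines "A \<equiv> \<lambda>z. \<integral>p. indicator {\<epsilon><..} (fst p) * heat_t (fst p) (snd z - snd p) * F (fst z - fst p, snd p) \<partial>lborel"
    and "G \<equiv> \<lambda>w. \<integral>v. indicator {\<epsilon><..} (fst v) * heat_t (fst v) (snd v) * \<psi> (w + v) \<partial>lborel"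
  shows "integrable lborel (\<lambda>z. \<psi> z * A z)" "integrable lborel (\<lambda>w. F w * G w)"
    "(\<integral>z. \<psi> z * A z \<partial>lborel) = (\<integral>w. F w * G w \<partial>lborel)"
proof -
  note M = holder_densityD[OF F]
  note [measurable] = M(1) compact_lipschitz_measurable[OF \<psi>]
  define k where "k v = indicator {\<epsilon><..} (fst v) * heat_t (fst v) (snd v)" for v :: "real \<times> (real ^ 'n)"
  have [measurable]: "k \<in> borel_measurable borel" unfolding k_def by measurable
  obtain C where C: "0 < C" and bnd: "\<And>s z. 0 < s \<Longrightarrow> \<bar>heat_t s (z :: real ^ 'n)\<bar> \<le> C * s powr (-1) * heat_kernel (4 * s) z"
    using heat_difference_bounds[where 'n = 'n] by blast
  have bt: "\<bar>heat_t s (z :: real ^ 'n)\<bar> \<le> C * s powr (-1) * heat_kernel (4 * s) z" if "\<epsilon> < s" for s z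
    using bnd[of s z] that \<epsilon> by simp
  have mt: "(\<lambda>p. heat_t (fst p) (snd p :: real ^ 'n)) \<in> borel_measurable borel" by measurable
  define W where "W = C * M * (1 + measure lborel \<Omega>) * (\<epsilon> powr (-1) / 1)"
  have W: "0 \<le> W" using C M(5) by (simp add: W_def)
  have A_eq: "A z = (\<integral>w. k (z - w) * F w \<partial>lborel)"
    and kF_int: "integrable lborel (\<lambda>w. k (z - w) * F w)"
    and kF_bnd: "(\<integral>w. \<bar>k (z - w) * F w\<bar> \<partial>lborel) \<le> W" for z
  proof -
    define D where "D p = F (fst z - fst p, snd p)" for p
    have [measurable]: "D \<in> borel_measurable borel" unfolding D_def by measurable
    have *: "(\<lambda>p. indicator {\<epsilon><..} (fst p) * heat_t (fst p) (snd z - snd p) * D p) = (\<lambda>p. k (z - (fst z - fst p, snd p)) * F (fst z - fst p, snd p))"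
      by (auto simp: k_def D_def minus_prod_def)
    have int: "integrable lborel (\<lambda>p. indicator {\<epsilon><..} (fst p) * heat_t (fst p) (snd z - snd p) * D p)"
      using \<epsilon> C by (intro integrable_tail[OF mt _ _ _ bt, where b = M]) (auto simp: D_def M)
    have abs: "(\<integral>p. \<bar>indicator {\<epsilon><..} (fst p) * heat_t (fst p) (snd z - snd p) * D p\<bar> \<partial>lborel) \<le> W"
      unfolding W_def using \<epsilon> C by (intro tail_abs_bound[OF mt _ _ _ bt, where b = M]) (auto simp: D_def M)
    have m: "(\<lambda>w. k (z - w) * F w) \<in> borel_measurable borel" by measurable
    show "A z = (\<integral>w. k (z - w) * F w \<partial>lborel)"
    proof -
      have "A z = (\<integral>p. indicator {\<epsilon><..} (fst p) * heat_t (fst p) (snd z - snd p) * D p \<partial>lborel)"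
        by (simp add: A_def D_def)
      also have "\<dots> = (\<integral>p. k (z - (fst z - fst p, snd p)) * F (fst z - fst p, snd p) \<partial>lborel)"
        unfolding * ..
      also have "\<dots> = (\<integral>w. k (z - w) * F w \<partial>lborel)" by (rule integral_lborel_reflect_fst[OF m])
      finally show ?thesis .
    qed
    show "integrable lborel (\<lambda>w. k (z - w) * F w)"
      using int unfolding * integrable_lborel_reflect_fst[OF m] .
    have m': "(\<lambda>w. \<bar>k (z - w) * F w\<bar>) \<in> borel_measurable borel" by measurable
    show "(\<integral>w. \<bar>k (z - w) * F w\<bar> \<partial>lborel) \<le> W"
    proof -
      have "(\<lambda>p. \<bar>indicator {\<epsilon><..} (fst p) * heat_t (fst p) (snd z - snd p) * D p\<bar>) =
          (\<lambda>p. \<bar>k (z - (fst z - fst p, snd p)) * F (fst z - fst p, snd p)\<bar>)"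
        using fun_cong[OF *] by simp
      then show ?thesis
        using abs integral_lborel_reflect_fst[OF m', of "fst z"] by (simp only:)
    qed
  qed
  define f where "f p = \<psi> (fst p) * (k (fst p - snd p) * F (snd p))" for p
  have fm: "f \<in> borel_measurable borel" unfolding f_def by measurable
  have "(\<integral>\<^sup>+w. ennreal \<bar>f (z, w)\<bar> \<partial>lborel) \<le> ennreal (W * \<bar>\<psi> z\<bar>)" for z
  proof -
    have "(\<integral>\<^sup>+w. ennreal \<bar>f (z, w)\<bar> \<partial>lborel) = (\<integral>\<^sup>+w. ennreal \<bar>\<psi> z\<bar> * ennreal \<bar>k (z - w) * F w\<bar> \<partial>lborel)"
      by (simp add: f_def abs_mult ennreal_mult)
    also have "\<dots> = ennreal \<bar>\<psi> z\<bar> * (\<integral>\<^sup>+w. ennreal \<bar>k (z - w) * F w\<bar> \<partial>lborel)"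
      by (rule nn_integral_cmult) measurable
    also have "(\<integral>\<^sup>+w. ennreal \<bar>k (z - w) * F w\<bar> \<partial>lborel) = ennreal (\<integral>w. \<bar>k (z - w) * F w\<bar> \<partial>lborel)"
      by (intro nn_integral_eq_integral integrable_abs kF_int) auto
    also have "ennreal \<bar>\<psi> z\<bar> * \<dots> \<le> ennreal \<bar>\<psi> z\<bar> * ennreal W"
      by (intro mult_left_mono ennreal_leI kF_bnd) simp
    also have "\<dots> = ennreal (W * \<bar>\<psi> z\<bar>)" using W by (simp add: ennreal_mult mult.commute)
    finally show ?thesis .
  qed
  moreover have "has_bochner_integral lborel (\<lambda>z. W * \<bar>\<psi> z\<bar>) (\<integral>z. W * \<bar>\<psi> z\<bar> \<partial>lborel)"
    using compact_lipschitz_integrable[OF \<psi>] by (intro has_bochner_integral_integrable integrable_mult_right integrable_abs)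
  ultimately have fint: "integrable lborel f" by (rule Tonelli_bound(1)[OF fm]) (use W in simp)
  have fint': "integrable (lborel \<Otimes>\<^sub>M lborel) f" using fint by (simp add: lborel_prod)
  have fz: "(\<integral>w. f (z, w) \<partial>lborel) = \<psi> z * A z" for z by (simp add: f_def A_eq)
  have fw: "(\<integral>z. f (z, w) \<partial>lborel) = F w * G w" for w
  proof -
    have m: "(\<lambda>z. f (z, w)) \<in> borel_measurable borel" unfolding f_def by measurable
    have "(\<integral>z. f (z, w) \<partial>lborel) = (\<integral>v. f (w + v, w) \<partial>lborel)"
      by (rule integral_lborel_translate[OF m, symmetric])
    also have "\<dots> = (\<integral>v. F w * (indicator {\<epsilon><..} (fst v) * heat_t (fst v) (snd v) * \<psi> (w + v)) \<partial>lborel)"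
      by (simp add: f_def k_def mult_ac)
    also have "\<dots> = F w * G w" unfolding G_def by (rule integral_mult_right_zero)
    finally show ?thesis .
  qed
  show "integrable lborel (\<lambda>z. \<psi> z * A z)"
    using lborel_pair.integrable_fst'[OF fint'] by (simp add: fz)
  show "integrable lborel (\<lambda>w. F w * G w)"
    using lborel_pair.integrable_snd[of "\<lambda>z w. f (z, w)"] fint' by (simp add: fw)
  show "(\<integral>z. \<psi> z * A z \<partial>lborel) = (\<integral>w. F w * G w \<partial>lborel)"
    using Fubini_lborel[OF fint] by (simp add: fz fw)
qed

text \<open>The present value \<open>F (t, y)\<close> meets a Gaussian average at fixed t, so Fubini
  is applied on each time slice and the slices are integrated afterwards.\<close>

lemma swap_present_part:
  assumes F: "holder_density M F" and \<psi>: "compact_lipschitz \<psi>" and \<epsilon>: "0 < \<epsilon>"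
  defines "H \<equiv> \<lambda>z. \<integral>y. heat_kernel \<epsilon> (snd z - y) * F (fst z, y) \<partial>lborel"
    and "G \<equiv> \<lambda>w. \<integral>z. heat_kernel \<epsilon> z * \<psi> (fst w, snd w + z) \<partial>lborel"
  shows "integrable lborel (\<lambda>z. \<psi> z * H z)" "integrable lborel (\<lambda>w. F w * G w)"
    "(\<integral>z. \<psi> z * H z \<partial>lborel) = (\<integral>w. F w * G w \<partial>lborel)"
proof -
  note M = holder_densityD[OF F]
  note [measurable] = M(1) compact_lipschitz_measurable[OF \<psi>]
  obtain B where B: "0 \<le> B" "\<And>z. \<bar>\<psi> z\<bar> \<le> B" using compact_lipschitz_bounded[OF \<psi>] by blast
  obtain R where R: "0 < R" "\<And>z. R < norm z \<Longrightarrow> \<psi> z = 0" using compact_lipschitz_supp[OF \<psi>] by blast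
  have H_reflect: "H (t, x) = (\<integral>z. heat_kernel \<epsilon> z * F (t, x - z) \<partial>lborel)" for t x
  proof -
    have "(\<lambda>y. heat_kernel \<epsilon> (x - y) * F (t, y)) \<in> borel_measurable borel" by measurable
    from integral_lborel_reflect[OF this, of x] show ?thesis by (simp add: H_def)
  qed
  have Hb: "\<bar>H z\<bar> \<le> M" for z
    using \<epsilon> by (cases z) (auto simp: H_reflect intro!: heat_kernel_convolution_bound M)
  have Gb: "\<bar>G w\<bar> \<le> B" for w
    unfolding G_def using \<epsilon> by (auto intro!: heat_kernel_convolution_bound B)
  have [measurable]: "H \<in> borel_measurable borel" "G \<in> borel_measurable borel"
    unfolding H_def G_def by (rule measurable_parameter_integral; measurable)+
  show i1: "integrable lborel (\<lambda>z. \<psi> z * H z)"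
    by (rule Bochner_Integration.integrable_bound[where f = "\<lambda>z. M * \<psi> z"])
      (use mult_right_mono[OF Hb abs_ge_zero] M(5) in \<open>auto intro!: AE_I2 integrable_mult_right compact_lipschitz_integrable[OF \<psi>] simp: abs_mult mult.commute[of "\<psi> _"]\<close>)
  have G0: "G w = 0" if "R < \<bar>fst w\<bar>" for w
  proof -
    have "\<psi> (fst w, snd w + z) = 0" for z
      using that norm_fst_le[of "fst w" "snd w + z"] by (intro R) simp
    then show ?thesis by (simp add: G_def)
  qed
  \<comment> \<open>\<open>G\<close> need not have compact support in space, but F vanishes off
    \<Omega> and \<open>G\<close> vanishes for |t| > R, so the product lives on a cylinder of finite
    measure.\<close>
  show i2: "integrable lborel (\<lambda>w. F w * G w)"
  proof (rule Bochner_Integration.integrable_bound[where f = "\<lambda>w. M * B * indicator ({-R..R} \<times> \<Omega>) w"])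
    show "integrable lborel (\<lambda>w. M * B * indicator ({-R..R} \<times> \<Omega>) w :: real)"
      using cylinder_finite cylinder_sets by (intro integrable_mult_right integrable_real_indicator) auto
    show "AE w in lborel. norm (F w * G w) \<le> norm (M * B * indicator ({-R..R} \<times> \<Omega>) w)"
    proof (rule AE_I2)
      fix w
      show "norm (F w * G w) \<le> norm (M * B * indicator ({-R..R} \<times> \<Omega>) w)"
      proof (cases "w \<in> {-R..R} \<times> \<Omega>")
        case True
        then show ?thesis using M B(1) mult_mono[OF M(2)[of w] Gb[of w]] by (simp add: abs_mult)
      next
        case False
        then have "R < \<bar>fst w\<bar> \<or> snd w \<notin> \<Omega>" by (cases w) (auto simp: not_le abs_real_def)
        then have "F w = 0 \<or> G w = 0" using G0[of w] M(3)[of "snd w" "fst w"] by auto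
        then show ?thesis by auto
      qed
    qed
  qed measurable
  have slice: "(\<integral>x. \<psi> (t, x) * H (t, x) \<partial>lborel) = (\<integral>y. F (t, y) * G (t, y) \<partial>lborel)" for t
  proof -
    define q where "q p = \<psi> (t, fst p) * (heat_kernel \<epsilon> (fst p - snd p) * F (t, snd p))" for p
    have qm: "q \<in> borel_measurable borel" unfolding q_def by measurable
    have \<psi>t: "integrable lborel (\<lambda>x. \<psi> (t, x))"
    proof (rule integrable_of_compact_support[where R = R])
      show "continuous_on UNIV (\<lambda>x. \<psi> (t, x))"
        by (rule continuous_on_compose2[OF compact_lipschitz_continuous[OF \<psi>]]) (auto intro!: continuous_intros)
      show "\<psi> (t, x) = 0" if "R < norm x" for x
        using that norm_snd_le[of x t] by (intro R) simp
    qed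
    have "(\<integral>\<^sup>+y. ennreal \<bar>q (x, y)\<bar> \<partial>lborel) \<le> ennreal (M * \<bar>\<psi> (t, x)\<bar>)" for x
    proof -
      have "(\<integral>\<^sup>+y. ennreal \<bar>q (x, y)\<bar> \<partial>lborel) \<le> (\<integral>\<^sup>+y. ennreal (M * \<bar>\<psi> (t, x)\<bar>) * ennreal (heat_kernel \<epsilon> (x - y)) \<partial>lborel)"
      proof (rule nn_integral_mono)
        fix y
        have "\<bar>q (x, y)\<bar> = \<bar>\<psi> (t, x)\<bar> * heat_kernel \<epsilon> (x - y) * \<bar>F (t, y)\<bar>"
          by (simp add: q_def abs_mult heat_kernel_nonneg)
        also have "\<dots> \<le> \<bar>\<psi> (t, x)\<bar> * heat_kernel \<epsilon> (x - y) * M"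
          by (intro mult_left_mono M) (auto simp: heat_kernel_nonneg)
        finally show "ennreal \<bar>q (x, y)\<bar> \<le> ennreal (M * \<bar>\<psi> (t, x)\<bar>) * ennreal (heat_kernel \<epsilon> (x - y))"
          using M(5) by (simp add: ennreal_mult[symmetric] heat_kernel_nonneg mult_ac ennreal_leI)
      qed
      also have "\<dots> = ennreal (M * \<bar>\<psi> (t, x)\<bar>)"
        using \<epsilon> by (subst nn_integral_cmult) (auto simp: nn_integral_heat_kernel_reflect)
      finally show ?thesis .
    qed
    moreover have "has_bochner_integral lborel (\<lambda>x. M * \<bar>\<psi> (t, x)\<bar>) (\<integral>x. M * \<bar>\<psi> (t, x)\<bar> \<partial>lborel)"
      using \<psi>t by (intro has_bochner_integral_integrable integrable_mult_right integrable_abs)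
    ultimately have qint: "integrable lborel q" by (rule Tonelli_bound(1)[OF qm]) (use M(5) in simp)
    have qx: "(\<integral>y. q (x, y) \<partial>lborel) = \<psi> (t, x) * H (t, x)" for x by (simp add: q_def H_def)
    have qy: "(\<integral>x. q (x, y) \<partial>lborel) = F (t, y) * G (t, y)" for y
    proof -
      have m: "(\<lambda>x. q (x, y)) \<in> borel_measurable borel" unfolding q_def by measurable
      have "(\<integral>x. q (x, y) \<partial>lborel) = (\<integral>z. q (y + z, y) \<partial>lborel)"
        by (rule integral_lborel_translate[OF m, symmetric])
      also have "\<dots> = (\<integral>z. F (t, y) * (heat_kernel \<epsilon> z * \<psi> (t, y + z)) \<partial>lborel)" by (simp add: q_def mult_ac)
      also have "\<dots> = F (t, y) * G (t, y)" by (simp add: G_def)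
      finally show ?thesis .
    qed
    show ?thesis using Fubini_lborel[OF qint] by (simp add: qx qy)
  qed
  show "(\<integral>z. \<psi> z * H z \<partial>lborel) = (\<integral>w. F w * G w \<partial>lborel)"
    using Fubini_lborel(1)[OF i1] Fubini_lborel(1)[OF i2] slice by simp
qed

text \<open>Once the lag is cut off, history and present can be treated apart. Exact integration in
  s turns the present term, which carries a minus sign, into plus a Gaussian average of F; the Green
  identity turns the adjoint of the history term into minus a Gaussian average of
  \<open>lap \<phi>\<close> taken \<epsilon> later. In the limit the two Laplacians cancel and the
  time derivative survives.\<close>

lemma truncated_potential_weak:
  assumes F: "holder_density M F" and \<phi>: "\<phi> \<in> test_functions U" and \<epsilon>: "0 < \<epsilon>"
  defines "\<psi> \<equiv> \<lambda>z. pd (1, 0) \<phi> z + lap \<phi> z"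
    and "G \<equiv> \<lambda>w. \<integral>z. heat_kernel \<epsilon> z * (pd (1, 0) \<phi> (fst w, snd w + z) + lap \<phi> (fst w, snd w + z) - lap \<phi> (fst w + \<epsilon>, snd w + z)) \<partial>lborel"
  shows "integrable lborel (\<lambda>z. pot {\<epsilon><..} heat_t F (fst z) (snd z) * \<psi> z)" "integrable lborel (\<lambda>w. F w * G w)"
    "(\<integral>z. pot {\<epsilon><..} heat_t F (fst z) (snd z) * \<psi> z \<partial>lborel) = (\<integral>w. F w * G w \<partial>lborel)"
proof -
  note M = holder_densityD[OF F]
  note [measurable] = M(1)
  have cl: "compact_lipschitz (lap \<phi>)" "compact_lipschitz \<psi>"
    unfolding \<psi>_def
    using compact_lipschitz_add[OF compact_lipschitz_test_function[OF test_function_pd(1)[OF \<phi>]] compact_lipschitz_lap[OF \<phi>]]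
      compact_lipschitz_lap[OF \<phi>] by auto
  define A where "A z = (\<integral>p. indicator {\<epsilon><..} (fst p) * heat_t (fst p) (snd z - snd p) * F (fst z - fst p, snd p) \<partial>lborel)" for z
  define H where "H z = (\<integral>y. heat_kernel \<epsilon> (snd z - y) * F (fst z, y) \<partial>lborel)" for z
  define GA where "GA w = (\<integral>v. indicator {\<epsilon><..} (fst v) * heat_t (fst v) (snd v) * \<psi> (w + v) \<partial>lborel)" for w
  define GH where "GH w = (\<integral>z. heat_kernel \<epsilon> z * \<psi> (fst w, snd w + z) \<partial>lborel)" for w
  note a = swap_history_part[OF F cl(2) \<epsilon>, folded A_def GA_def]
  note h = swap_present_part[OF F cl(2) \<epsilon>, folded H_def GH_def]
  obtain C where C: "0 < C" and bnd: "\<And>s z. 0 < s \<Longrightarrow> \<bar>heat_t s (z :: real ^ 'n)\<bar> \<le> C * s powr (-1) * heat_kernel (4 * s) z"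
    using heat_difference_bounds[where 'n = 'n] by blast
  have bt: "\<bar>heat_t s (z :: real ^ 'n)\<bar> \<le> C * s powr (-1) * heat_kernel (4 * s) z" if "\<epsilon> < s" for s z
    using bnd[of s z] that \<epsilon> by simp
  have mt: "(\<lambda>p. heat_t (fst p) (snd p :: real ^ 'n)) \<in> borel_measurable borel" by measurable
  have pot_eq: "pot {\<epsilon><..} heat_t F t x = A (t, x) + H (t, x)" for t x
  proof -
    have 1: "integrable lborel (\<lambda>p. indicator {\<epsilon><..} (fst p) * heat_t (fst p) (x - snd p) * F (t - fst p, snd p))"
      using \<epsilon> C by (intro integrable_tail[OF mt _ _ _ bt, where b = M]) (auto simp: M)
    have m: "(\<lambda>y. F (t, y)) \<in> borel_measurable borel" by measurable
    note 2 = integrable_heat_t_potential_tail[OF \<epsilon> m M(2) M(3), of x] heat_t_potential_tail[OF \<epsilon> m M(2) M(3), of x]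
    have "integrand {\<epsilon><..} heat_t F t x = (\<lambda>p. indicator {\<epsilon><..} (fst p) * heat_t (fst p) (x - snd p) * F (t - fst p, snd p)
        - indicator {\<epsilon><..} (fst p) * heat_t (fst p) (x - snd p) * F (t, snd p))"
      by (auto simp: integrand_def algebra_simps)
    then show ?thesis
      unfolding pot_def using 1 2 by (simp add: A_def H_def)
  qed
  have G_eq: "G w = GA w + GH w" for w
  proof -
    have mf: "(\<lambda>z. f (s, snd w + z)) \<in> borel_measurable borel" if "compact_lipschitz f" for f s
      using compact_lipschitz_measurable[OF that] by measurable
    have bf: "\<exists>b. \<forall>z. \<bar>f (s, snd w + z)\<bar> \<le> b" if "compact_lipschitz f" for f s
      using compact_lipschitz_bounded[OF that] by blast
    have int: "integrable lborel (\<lambda>z. heat_kernel \<epsilon> z * f (s, snd w + z))" if f: "compact_lipschitz f" for f s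
    proof -
      obtain b where "\<And>z. \<bar>f (s, snd w + z)\<bar> \<le> b" using bf[OF f] by blast
      then show ?thesis by (rule heat_kernel_convolution_bound(1)[OF \<epsilon> mf[OF f]])
    qed
    have "GA w = - (\<integral>z. heat_kernel \<epsilon> z * lap \<phi> (fst w + \<epsilon>, snd w + z) \<partial>lborel)"
      unfolding GA_def \<psi>_def using heat_kernel_green[OF \<epsilon> \<phi>, of w] by (simp add: plus_prod_def)
    moreover have "G w = GH w - (\<integral>z. heat_kernel \<epsilon> z * lap \<phi> (fst w + \<epsilon>, snd w + z) \<partial>lborel)"
    proof -
      have "G w = (\<integral>z. heat_kernel \<epsilon> z * \<psi> (fst w, snd w + z) - heat_kernel \<epsilon> z * lap \<phi> (fst w + \<epsilon>, snd w + z) \<partial>lborel)"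
        unfolding G_def \<psi>_def by (simp add: algebra_simps)
      then show ?thesis using int[OF cl(1)] int[OF cl(2)] by (simp add: GH_def)
    qed
    ultimately show ?thesis by simp
  qed
  have e1: "(\<lambda>z. pot {\<epsilon><..} heat_t F (fst z) (snd z) * \<psi> z) = (\<lambda>z. \<psi> z * A z + \<psi> z * H z)"
    by (auto simp: pot_eq algebra_simps)
  have e2: "(\<lambda>w. F w * G w) = (\<lambda>w. F w * GA w + F w * GH w)"
    by (auto simp: G_eq algebra_simps)
  show "integrable lborel (\<lambda>z. pot {\<epsilon><..} heat_t F (fst z) (snd z) * \<psi> z)" "integrable lborel (\<lambda>w. F w * G w)"
    "(\<integral>z. pot {\<epsilon><..} heat_t F (fst z) (snd z) * \<psi> z \<partial>lborel) = (\<integral>w. F w * G w \<partial>lborel)"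
    unfolding e1 e2 using a h by simp_all
qed

theorem heat_potential_weak:
  assumes F: "holder_density M F" and \<phi>: "\<phi> \<in> test_functions U"
  shows "(\<integral>z. pot {0<..} heat_t F (fst z) (snd z) * (pd (1, 0) \<phi> z + lap \<phi> z) \<partial>lborel) = (\<integral>z. F z * pd (1, 0) \<phi> z \<partial>lborel)"
proof -
  note M = holder_densityD[OF F]
  note [measurable] = M(1)
  define \<psi> where "\<psi> z = pd (1, 0) \<phi> z + lap \<phi> z" for z
  have cl: "compact_lipschitz (pd (1, 0) \<phi>)" "compact_lipschitz (lap \<phi>)" "compact_lipschitz \<psi>"
    unfolding \<psi>_def
    using compact_lipschitz_add[OF compact_lipschitz_test_function[OF test_function_pd(1)[OF \<phi>]] compact_lipschitz_lap[OF \<phi>]]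
      compact_lipschitz_test_function[OF test_function_pd(1)[OF \<phi>]] compact_lipschitz_lap[OF \<phi>] by auto
  note [measurable] = cl[THEN compact_lipschitz_measurable]
  obtain C where C: "0 < C" and est: "\<And>t x. integrable lborel (integrand {0<..} heat_t F t x)"
    "\<And>t x. \<bar>pot {0<..} heat_t F t x\<bar> \<le> C * M" "\<And>t x a. 0 < a \<Longrightarrow> \<bar>pot {0<..a} heat_t F t x\<bar> \<le> C * M * a powr \<gamma>"
    using pot_estimates F unfolding pot_bounds_def by blast
  obtain C' where C': "0 < C'" and mom: "\<And>s z. 0 < s \<Longrightarrow> norm (z :: real ^ 'n) * heat_kernel s z \<le> C' * sqrt s * heat_kernel (2 * s) z"
    using heat_bounds[where 'n = 'n] by blast
  obtain L where L: "0 \<le> L" "\<And>z h. \<bar>pd (1, 0) \<phi> (z + h) - pd (1, 0) \<phi> z\<bar> \<le> L * norm h"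
    using compact_lipschitz_diff[OF cl(1)] by blast
  obtain L' where L': "0 \<le> L'" "\<And>z h. \<bar>lap \<phi> (z + h) - lap \<phi> z\<bar> \<le> L' * norm h"
    using compact_lipschitz_diff[OF cl(2)] by blast
  obtain R1 where R1: "0 < R1" "\<And>z. R1 < norm z \<Longrightarrow> pd (1, 0) \<phi> z = 0" using compact_lipschitz_supp[OF cl(1)] by blast
  obtain R2 where R2: "0 < R2" "\<And>z. R2 < norm z \<Longrightarrow> lap \<phi> z = 0" using compact_lipschitz_supp[OF cl(2)] by blast
  define R where "R = max R1 R2"
  have R: "0 < R" "\<And>t x. R < \<bar>t\<bar> \<Longrightarrow> pd (1, 0) \<phi> (t, x) = 0" "\<And>t x. R < \<bar>t\<bar> \<Longrightarrow> lap \<phi> (t, x) = 0"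
  proof -
    show "pd (1, 0) \<phi> (t, x) = 0" if "R < \<bar>t\<bar>" for t x
      using that norm_fst_le[of t x] by (intro R1(2)) (simp add: R_def)
    show "lap \<phi> (t, x) = 0" if "R < \<bar>t\<bar>" for t x
      using that norm_fst_le[of t x] by (intro R2(2)) (simp add: R_def)
  qed (use R1 in \<open>simp add: R_def\<close>)
  \<comment> \<open>The margin 1 accommodates the time shift by \<epsilon> <= 1 inside the average
    \<open>G\<close>.\<close>
  define S where "S = {- (R + 1)..R + 1} \<times> \<Omega>"
  have S: "S \<in> sets lborel" "emeasure lborel S < \<infinity>"
    unfolding S_def by (rule cylinder_sets, rule cylinder_finite)
  have S_int: "integrable lborel (\<lambda>w. c * indicator S w :: real)" for c
    using S by (intro integrable_mult_right integrable_real_indicator) auto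
  define I where "I = (\<integral>z. \<bar>\<psi> z\<bar> \<partial>lborel)"
  define V where "V z = pot {0<..} heat_t F (fst z) (snd z)" for z
  have mt: "(\<lambda>p. heat_t (fst p) (snd p :: real ^ 'n)) \<in> borel_measurable borel" by measurable
  have [measurable]: "V \<in> borel_measurable borel" unfolding V_def by (rule measurable_pot[OF mt F]) simp
  have V_bound: "\<bar>V z\<bar> \<le> C * M" for z unfolding V_def by (rule est)
  have V_int: "integrable lborel (\<lambda>z. V z * \<psi> z)"
    by (rule Bochner_Integration.integrable_bound[where f = "\<lambda>z. C * M * \<psi> z"])
      (use V_bound C M(5) in \<open>auto intro!: AE_I2 integrable_mult_right compact_lipschitz_integrable cl mult_right_mono simp: abs_mult\<close>)
  have F_int: "integrable lborel (\<lambda>z. F z * pd (1, 0) \<phi> z)"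
    by (rule Bochner_Integration.integrable_bound[where f = "\<lambda>z. M * pd (1, 0) \<phi> z"])
      (use M in \<open>auto intro!: AE_I2 integrable_mult_right compact_lipschitz_integrable cl mult_right_mono simp: abs_mult\<close>)
  define X where "X = (\<integral>z. V z * \<psi> z \<partial>lborel) - (\<integral>z. F z * pd (1, 0) \<phi> z \<partial>lborel)"
  \<comment> \<open>Three errors: the removed near part, of order \<epsilon>^\<gamma>; the
    oscillation of the time derivative of \<phi> over the Gaussian, of order sqrt \<epsilon> by the
    first moment; the time shift of the Laplacian, of order \<epsilon>.\<close>
  have main: "\<bar>X\<bar> \<le> C * M * I * \<epsilon> powr \<gamma> + M * (L * C' * sqrt \<epsilon> + L' * \<epsilon>) * measure lborel S" if \<epsilon>: "0 < \<epsilon>" "\<epsilon> \<le> 1" for \<epsilon>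
  proof -
    define G where "G w = (\<integral>z. heat_kernel \<epsilon> z * (pd (1, 0) \<phi> (fst w, snd w + z) + lap \<phi> (fst w, snd w + z) - lap \<phi> (fst w + \<epsilon>, snd w + z)) \<partial>lborel)" for w
    note t = truncated_potential_weak[OF F \<phi> \<epsilon>(1), folded \<psi>_def G_def]
    have isub: "integrable lborel (integrand J heat_t F t x)" if "J \<subseteq> {0<..}" "J \<in> sets borel" for J t x
      by (rule integrable_integrand_subset[OF est(1) that])
    have V_split: "V z = pot {0<..\<epsilon>} heat_t F (fst z) (snd z) + pot {\<epsilon><..} heat_t F (fst z) (snd z)" for z
      unfolding V_def using \<epsilon> by (intro pot_split isub) auto
    have near: "norm (V z * \<psi> z - pot {\<epsilon><..} heat_t F (fst z) (snd z) * \<psi> z) \<le> C * M * \<epsilon> powr \<gamma> * \<bar>\<psi> z\<bar>" for z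
    proof -
      have "V z * \<psi> z - pot {\<epsilon><..} heat_t F (fst z) (snd z) * \<psi> z = pot {0<..\<epsilon>} heat_t F (fst z) (snd z) * \<psi> z"
        by (simp add: V_split algebra_simps)
      then show ?thesis using est(3)[OF \<epsilon>(1), of "fst z" "snd z"] by (simp add: abs_mult mult_right_mono)
    qed
    have "norm (\<integral>z. V z * \<psi> z - pot {\<epsilon><..} heat_t F (fst z) (snd z) * \<psi> z \<partial>lborel) \<le> (\<integral>z. C * M * \<epsilon> powr \<gamma> * \<bar>\<psi> z\<bar> \<partial>lborel)"
      using t V_int near compact_lipschitz_integrable[OF cl(3)]
      by (intro Bochner_Integration.integral_norm_bound_integral Bochner_Integration.integrable_diff integrable_mult_right integrable_abs)
    then have 1: "\<bar>(\<integral>z. V z * \<psi> z \<partial>lborel) - (\<integral>w. F w * G w \<partial>lborel)\<bar> \<le> C * M * \<epsilon> powr \<gamma> * I"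
      using t V_int by (simp add: I_def)
    define K where "K = L * C' * sqrt \<epsilon> + L' * \<epsilon>"
    have K: "0 \<le> K" using L L' C' \<epsilon> by (simp add: K_def)
    have G_diff: "\<bar>G w - pd (1, 0) \<phi> w\<bar> \<le> K" for w
    proof -
      obtain \<tau> y where w: "w = (\<tau>, y)" by (cases w)
      define u where "u z = pd (1, 0) \<phi> (\<tau>, y + z) + lap \<phi> (\<tau>, y + z) - lap \<phi> (\<tau> + \<epsilon>, y + z)" for z
      have um: "u \<in> borel_measurable borel" unfolding u_def by measurable
      have u: "\<bar>u z - pd (1, 0) \<phi> w\<bar> \<le> L * norm z + L' * \<epsilon>" for z
        using L(2)[of w "(0, z)"] L'(2)[of "(\<tau>, y + z)" "(\<epsilon>, 0)"] \<epsilon> by (simp add: u_def w)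
      obtain b1 where b1: "\<forall>z. \<bar>pd (1, 0) \<phi> z\<bar> \<le> b1" using compact_lipschitz_bounded[OF cl(1)] by blast
      obtain b2 where b2: "\<forall>z. \<bar>lap \<phi> z\<bar> \<le> b2" using compact_lipschitz_bounded[OF cl(2)] by blast
      have ub: "\<bar>u z\<bar> \<le> b1 + b2 + b2" for z
        using b1[rule_format, of "(\<tau>, y + z)"] b2[rule_format, of "(\<tau>, y + z)"] b2[rule_format, of "(\<tau> + \<epsilon>, y + z)"]
        unfolding u_def by linarith
      have H: "integrable lborel (heat_kernel s :: real ^ 'n \<Rightarrow> real)" "(\<integral>z. heat_kernel s (z :: real ^ 'n) \<partial>lborel) = 1" if "0 < s" for s
        using has_bochner_integral_heat_kernel[OF that, where 'n = 'n] by (auto simp: has_bochner_integral_iff)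
      have int: "integrable lborel (\<lambda>z. heat_kernel \<epsilon> z * u z)" by (rule heat_kernel_convolution_bound(1)[OF \<epsilon>(1) um ub])
      have "G w - pd (1, 0) \<phi> w = (\<integral>z. heat_kernel \<epsilon> z * u z \<partial>lborel) - (\<integral>z. heat_kernel \<epsilon> (z :: real ^ 'n) * pd (1, 0) \<phi> w \<partial>lborel)"
        using H[OF \<epsilon>(1)] by (simp add: G_def u_def w)
      also have "\<dots> = (\<integral>z. heat_kernel \<epsilon> z * u z - heat_kernel \<epsilon> z * pd (1, 0) \<phi> w \<partial>lborel)"
        using int H[OF \<epsilon>(1)] by simp
      finally have eq: "G w - pd (1, 0) \<phi> w = \<dots>" .
      have ptw: "norm (heat_kernel \<epsilon> z * u z - heat_kernel \<epsilon> z * pd (1, 0) \<phi> w) \<le> L * C' * sqrt \<epsilon> * heat_kernel (2 * \<epsilon>) z + L' * \<epsilon> * heat_kernel \<epsilon> z" for z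
      proof -
        have "norm (heat_kernel \<epsilon> z * u z - heat_kernel \<epsilon> z * pd (1, 0) \<phi> w) = heat_kernel \<epsilon> z * \<bar>u z - pd (1, 0) \<phi> w\<bar>"
          by (simp add: heat_kernel_nonneg abs_mult flip: right_diff_distrib)
        also have "\<dots> \<le> heat_kernel \<epsilon> z * (L * norm z + L' * \<epsilon>)"
          by (intro mult_left_mono u heat_kernel_nonneg)
        also have "\<dots> = L * (norm z * heat_kernel \<epsilon> z) + L' * \<epsilon> * heat_kernel \<epsilon> z" by (simp add: algebra_simps)
        also have "\<dots> \<le> L * (C' * sqrt \<epsilon> * heat_kernel (2 * \<epsilon>) z) + L' * \<epsilon> * heat_kernel \<epsilon> z"
          by (intro add_right_mono mult_left_mono mom \<epsilon> L)
        finally show ?thesis by (simp add: mult_ac)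
      qed
      have "norm (\<integral>z. heat_kernel \<epsilon> z * u z - heat_kernel \<epsilon> z * pd (1, 0) \<phi> w \<partial>lborel)
          \<le> (\<integral>z. L * C' * sqrt \<epsilon> * heat_kernel (2 * \<epsilon>) z + L' * \<epsilon> * heat_kernel \<epsilon> (z :: real ^ 'n) \<partial>lborel)"
        using int H[of \<epsilon>] H[of "2 * \<epsilon>"] \<epsilon> ptw
        by (intro Bochner_Integration.integral_norm_bound_integral) auto
      also have "\<dots> = K" using H[of \<epsilon>] H[of "2 * \<epsilon>"] \<epsilon> by (simp add: K_def)
      finally show ?thesis by (simp add: eq)
    qed
    have G_zero: "F w * G w - F w * pd (1, 0) \<phi> w = 0" if "w \<notin> S" for w
    proof (cases "snd w \<in> \<Omega>")
      case True
      then have "R + 1 < \<bar>fst w\<bar>" using that by (cases w) (auto simp: S_def abs_le_iff not_le)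
      then have a: "R < \<bar>fst w\<bar>" "R < \<bar>fst w + \<epsilon>\<bar>" using \<epsilon> by auto
      then show ?thesis using R(2)[OF a(1), of "snd w"] by (simp add: G_def R)
    next
      case False
      then show ?thesis using M(3)[of "snd w" "fst w"] by simp
    qed
    have ptw: "norm (F w * G w - F w * pd (1, 0) \<phi> w) \<le> M * K * indicator S w" for w
    proof (cases "w \<in> S")
      case True
      have "norm (F w * G w - F w * pd (1, 0) \<phi> w) = \<bar>F w\<bar> * \<bar>G w - pd (1, 0) \<phi> w\<bar>"
        by (simp add: abs_mult flip: right_diff_distrib)
      also have "\<dots> \<le> M * K" using M by (intro mult_mono M G_diff) auto
      finally show ?thesis using True by simp
    qed (simp add: G_zero)
    have "norm (\<integral>w. F w * G w - F w * pd (1, 0) \<phi> w \<partial>lborel) \<le> (\<integral>w. M * K * indicator S w \<partial>lborel)"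
      using t F_int S_int ptw by (intro Bochner_Integration.integral_norm_bound_integral Bochner_Integration.integrable_diff)
    then have 2: "\<bar>(\<integral>w. F w * G w \<partial>lborel) - (\<integral>z. F z * pd (1, 0) \<phi> z \<partial>lborel)\<bar> \<le> M * K * measure lborel S"
      using t F_int S by simp
    have "\<bar>X\<bar> \<le> C * M * \<epsilon> powr \<gamma> * I + M * K * measure lborel S"
      unfolding X_def using 1 2 by linarith
    then show ?thesis by (simp add: K_def mult_ac)
  qed
  have "\<bar>X\<bar> \<le> 0"
  proof (rule tendsto_lowerbound)
    have "((\<lambda>\<epsilon>. C * M * I * \<epsilon> powr \<gamma> + M * (L * C' * sqrt \<epsilon> + L' * \<epsilon>) * measure lborel S) \<longlongrightarrow>
       C * M * I * 0 + M * (L * C' * sqrt 0 + L' * 0) * measure lborel S) (at_right 0)"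
    proof (intro tendsto_intros)
      show "((\<lambda>\<epsilon>. \<epsilon> powr \<gamma>) \<longlongrightarrow> 0) (at_right 0)"
        using tendsto_powr2[OF tendsto_ident_at tendsto_const, of 0 "{0<..}" \<gamma>] \<gamma>
        by (auto simp: eventually_at_filter)
    qed
    then show "((\<lambda>\<epsilon>. C * M * I * \<epsilon> powr \<gamma> + M * (L * C' * sqrt \<epsilon> + L' * \<epsilon>) * measure lborel S) \<longlongrightarrow> 0) (at_right 0)"
      by simp
    have "eventually (\<lambda>\<epsilon>. \<epsilon> \<in> {0<..<1}) (at_right (0::real))"
      by (intro eventually_at_right_real) simp
    then show "eventually (\<lambda>\<epsilon>. \<bar>X\<bar> \<le> C * M * I * \<epsilon> powr \<gamma> + M * (L * C' * sqrt \<epsilon> + L' * \<epsilon>) * measure lborel S) (at_right 0)"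
      by eventually_elim (intro main; simp)
  qed simp
  then show ?thesis unfolding X_def V_def \<psi>_def by simp
qed

end

section \<open>Functions with vanishing time derivative\<close>

definition flat_exp :: "nat \<Rightarrow> real \<Rightarrow> real" where
  "flat_exp k t = (if 0 < t then (1 / t) ^ k * exp (- 1 / t) else 0)"

lemma tendsto_flat_exp_0: "(flat_exp k \<longlongrightarrow> 0) (at 0)"
  unfolding filterlim_at_split
proof
  have "((\<lambda>t. flat_exp k t) \<longlongrightarrow> 0) (at_left 0) \<longleftrightarrow> ((\<lambda>t. 0 :: real) \<longlongrightarrow> 0) (at_left (0::real))"
    by (rule filterlim_cong) (auto simp: flat_exp_def eventually_at_filter)
  then show "(flat_exp k \<longlongrightarrow> 0) (at_left 0)" by simp
  have "((\<lambda>t. (inverse t) ^ k / exp (inverse t)) \<longlongrightarrow> (0::real)) (at_right 0)"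
    by (rule filterlim_compose[OF tendsto_power_div_exp_0 filterlim_inverse_at_top_right])
  then show "(flat_exp k \<longlongrightarrow> 0) (at_right 0)"
    by (rule Lim_transform_eventually)
      (auto simp: flat_exp_def eventually_at_filter exp_minus inverse_eq_divide field_simps)
qed

text \<open>At 0 the difference quotient of the k-th function is the (k + 1)-st, which tends to 0.
  Keeping the powers of 1/t as an index makes the family stable under differentiation, up to linear
  combinations.\<close>

lemma DERIV_flat_exp:
  "(flat_exp k has_real_derivative flat_exp (k + 2) t - real k * flat_exp (k + 1) t) (at t)"
proof (cases t "0 :: real" rule: linorder_cases)
  case less
  have "((\<lambda>t. 0) has_real_derivative flat_exp (k + 2) t - real k * flat_exp (k + 1) t) (at t)"
    using less by (simp add: flat_exp_def)
  then show ?thesis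
    by (rule has_field_derivative_transform_within_open[where S = "{..<0}"]) (use less in \<open>auto simp: flat_exp_def\<close>)
next
  case equal
  have "((\<lambda>h. (flat_exp k (0 + h) - flat_exp k 0) / h) \<longlongrightarrow> 0) (at 0)"
    by (rule Lim_transform_eventually[OF tendsto_flat_exp_0[of "k + 1"]])
      (auto simp: flat_exp_def eventually_at_filter)
  then show ?thesis using equal by (simp add: DERIV_def flat_exp_def)
next
  case greater
  have "((\<lambda>t. (inverse t) ^ k * exp (- inverse t)) has_real_derivative flat_exp (k + 2) t - real k * flat_exp (k + 1) t) (at t)"
  proof -
    have inv: "(inverse has_real_derivative - (inverse t * inverse t)) (at t)"
      using DERIV_inverse[of t] greater by simp
    have 1: "((\<lambda>t. inverse t ^ k) has_real_derivative - (real k * inverse t ^ (k + 1))) (at t)"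
    proof (induction k)
      case (Suc k)
      show ?case
        using DERIV_cong[OF DERIV_mult[OF inv Suc.IH], of "- (real (Suc k) * inverse t ^ (Suc k + 1))"]
        by (simp add: algebra_simps)
    qed simp
    have 2: "((\<lambda>t. exp (- inverse t)) has_real_derivative exp (- inverse t) * (inverse t * inverse t)) (at t)"
      using DERIV_fun_exp[OF DERIV_minus[OF inv]] by simp
    show ?thesis
      by (rule DERIV_cong[OF DERIV_mult[OF 1 2]])
        (use greater in \<open>simp add: flat_exp_def inverse_eq_divide[symmetric] power_add algebra_simps power2_eq_square\<close>)
  qed
  then show ?thesis
    by (rule has_field_derivative_transform_within_open[where S = "{0<..}"])
      (use greater in \<open>auto simp: flat_exp_def inverse_eq_divide\<close>)
qed

text \<open>The generators contain the bumps (\<open>q\<close> is the squared radius,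
  \<open>c\<close> the centre) and the rules suffice for stability under directional derivatives, so
  smoothness follows by induction with no formula for the iterated derivatives.\<close>

inductive bump_class :: "real \<Rightarrow> 'a::euclidean_space \<Rightarrow> ('a \<Rightarrow> real) \<Rightarrow> bool" for q c where
  base: "bump_class q c (\<lambda>z. flat_exp k (q - (z - c) \<bullet> (z - c)))"
| coord: "bump_class q c f \<Longrightarrow> bump_class q c (\<lambda>z. ((z - c) \<bullet> b) * f z)"
| add: "bump_class q c f \<Longrightarrow> bump_class q c g \<Longrightarrow> bump_class q c (\<lambda>z. f z + g z)"
| scale: "bump_class q c f \<Longrightarrow> bump_class q c (\<lambda>z. a * f z)"

lemma bump_class_derivative:
  "bump_class q c f \<Longrightarrow> \<exists>f'. (\<forall>z. (f has_derivative f' z) (at z)) \<and> (\<forall>b. bump_class q c (\<lambda>z. f' z b))"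
proof (induction rule: bump_class.induct)
  case (base k)
  define e where "e j z = flat_exp j (q - (z - c) \<bullet> (z - c))" for j z
  define f' where "f' z h = (e (k + 2) z - real k * e (k + 1) z) * (- 2 * ((z - c) \<bullet> h))" for z h
  have "((\<lambda>z. flat_exp k (q - (z - c) \<bullet> (z - c))) has_derivative f' z) (at z)" for z
  proof -
    have 1: "((\<lambda>z. q - (z - c) \<bullet> (z - c)) has_derivative (\<lambda>h. - 2 * ((z - c) \<bullet> h))) (at z)"
      by (auto intro!: derivative_eq_intros simp: inner_commute)
    have 2: "(flat_exp k has_derivative (*) (e (k + 2) z - real k * e (k + 1) z)) (at (q - (z - c) \<bullet> (z - c)))"
      using DERIV_flat_exp unfolding e_def has_field_derivative_def .
    show ?thesis using has_derivative_compose[OF 1 2] unfolding f'_def .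
  qed
  moreover have "bump_class q c (\<lambda>z. f' z b)" for b
  proof -
    have "bump_class q c (\<lambda>z. (- 2) * (((z - c) \<bullet> b) * e (k + 2) z) + (2 * real k) * (((z - c) \<bullet> b) * e (k + 1) z))"
      unfolding e_def by (intro bump_class.intros)
    then show ?thesis by (rule back_subst[of "bump_class q c"]) (auto simp: f'_def algebra_simps)
  qed
  ultimately show ?case by blast
next
  case (coord f b0)
  then obtain f' where f': "\<And>z. (f has_derivative f' z) (at z)" "\<And>b. bump_class q c (\<lambda>z. f' z b)" by blast
  have "((\<lambda>z. ((z - c) \<bullet> b0) * f z) has_derivative (\<lambda>h. ((z - c) \<bullet> b0) * f' z h + (h \<bullet> b0) * f z)) (at z)" for z
    by (rule has_derivative_mult[OF _ f'(1)]) (auto intro!: derivative_eq_intros)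
  moreover have "bump_class q c (\<lambda>z. ((z - c) \<bullet> b0) * f' z b + (b \<bullet> b0) * f z)" for b
    by (intro bump_class.intros f' coord.hyps)
  ultimately show ?case by (intro exI[of _ "\<lambda>z h. ((z - c) \<bullet> b0) * f' z h + (h \<bullet> b0) * f z"]) blast
next
  case (add f g)
  then obtain f' g' where f': "\<And>z. (f has_derivative f' z) (at z)" "\<And>b. bump_class q c (\<lambda>z. f' z b)"
    and g': "\<And>z. (g has_derivative g' z) (at z)" "\<And>b. bump_class q c (\<lambda>z. g' z b)" by blast
  then show ?case
    by (intro exI[of _ "\<lambda>z h. f' z h + g' z h"]) (auto intro!: has_derivative_add bump_class.add)
next
  case (scale f a)
  then obtain f' where f': "\<And>z. (f has_derivative f' z) (at z)" "\<And>b. bump_class q c (\<lambda>z. f' z b)" by blast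
  then show ?case
    by (intro exI[of _ "\<lambda>z h. a * f' z h"]) (auto intro!: has_derivative_mult_right bump_class.scale)
qed

lemma bump_class_smooth:
  assumes "bump_class q c f"
  shows "smooth f"
proof -
  have *: "g differentiable (at z)" "bump_class q c (\<lambda>z. frechet_derivative g (at z) b)" if "bump_class q c g" for g z b
  proof -
    obtain g' where g': "\<And>z. (g has_derivative g' z) (at z)" "\<And>b. bump_class q c (\<lambda>z. g' z b)"
      using bump_class_derivative[OF \<open>bump_class q c g\<close>] by blast
    show "g differentiable (at z)" using g'(1) differentiable_def by blast
    show "bump_class q c (\<lambda>z. frechet_derivative g (at z) b)"
      using g' by (simp add: frechet_derivative_at[OF g'(1), symmetric])
  qed
  have "bump_class q c (iter_deriv bs f)" for bs
    by (induction bs) (use assms * in auto)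
  then show ?thesis unfolding smooth_def using * by blast
qed

definition bump :: "real \<Rightarrow> 'a::euclidean_space \<Rightarrow> 'a \<Rightarrow> real" where
  "bump r c z = flat_exp 0 (r\<^sup>2 - (z - c) \<bullet> (z - c))"

lemma bump_nonneg: "0 \<le> bump r c z"
  by (simp add: bump_def flat_exp_def)

lemma bump_eq_0: "0 < r \<Longrightarrow> r \<le> norm (z - c) \<Longrightarrow> bump r c z = 0"
  using power_mono[of r "norm (z - c)" 2] by (simp add: bump_def flat_exp_def power2_norm_eq_inner not_less)

lemma bump_test_function:
  assumes "0 < r" "cball c r \<subseteq> U"
  shows "bump r c \<in> test_functions U"
proof -
  have "smooth (bump r c)" unfolding bump_def by (rule bump_class_smooth[OF bump_class.base])
  moreover have "supp (bump r c) \<subseteq> cball c r"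
    unfolding supp_def
  proof (rule closure_minimal)
    show "{z. bump r c z \<noteq> 0} \<subseteq> cball c r"
      using bump_eq_0[OF assms(1), of _ c] by (force simp: dist_norm norm_minus_commute)
  qed simp
  moreover from this have "compact (supp (bump r c))"
    using compact_Int_closed[OF compact_cball, of "supp (bump r c)" c r] by (simp add: supp_def Int_absorb1)
  ultimately show ?thesis using assms(2) by (auto simp: test_functions_def)
qed

lemma bump_shift: "bump r (c + h) z = bump r c (z - h)"
  by (simp add: bump_def algebra_simps)

text \<open>On the concentric ball of half the radius the argument of the profile is at least 3/4
  r^2, which gives an explicit positive minorant.\<close>

lemma integral_bump_pos:
  assumes "0 < r"
  shows "0 < (\<integral>z. bump r c z \<partial>lborel)"
proof -
  have t: "bump r c \<in> test_functions UNIV" using assms by (intro bump_test_function) auto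
  define m where "m = exp (- 1 / (3 / 4 * r\<^sup>2))"
  have "(\<integral>z. m * indicator (cball c (r / 2)) z \<partial>lborel) \<le> (\<integral>z. bump r c z \<partial>lborel)"
  proof (rule integral_mono)
    show "integrable lborel (\<lambda>z. m * indicator (cball c (r / 2)) z :: real)"
      by (intro integrable_mult_right integrable_real_indicator)
        (use emeasure_bounded_finite[of "cball c (r / 2)"] in auto)
    show "integrable lborel (bump r c)"
      by (rule compact_lipschitz_integrable[OF compact_lipschitz_test_function[OF t]])
    fix z
    show "m * indicator (cball c (r / 2)) z \<le> bump r c z"
    proof (cases "z \<in> cball c (r / 2)")
      case True
      then have "norm (z - c) \<le> r / 2" by (simp add: dist_norm norm_minus_commute)
      then have "(z - c) \<bullet> (z - c) \<le> (r / 2)\<^sup>2"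
        using power_mono[of "norm (z - c)" "r / 2" 2] by (simp add: power2_norm_eq_inner)
      then have q: "3 / 4 * r\<^sup>2 \<le> r\<^sup>2 - (z - c) \<bullet> (z - c)" by (simp add: power2_eq_square)
      have pos: "0 < 3 / 4 * r\<^sup>2" using assms by simp
      have pos2: "0 < r\<^sup>2 - (z - c) \<bullet> (z - c)" using pos q by linarith
      have "m \<le> exp (- 1 / (r\<^sup>2 - (z - c) \<bullet> (z - c)))"
      proof -
        have "1 / (r\<^sup>2 - (z - c) \<bullet> (z - c)) \<le> 1 / (3 / 4 * r\<^sup>2)"
          by (intro divide_left_mono q mult_pos_pos pos pos2) auto
        then show ?thesis unfolding m_def exp_le_cancel_iff minus_divide_left[symmetric] by (rule le_imp_neg_le)
      qed
      then show ?thesis using True pos2 by (simp add: bump_def flat_exp_def)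
    qed (simp add: bump_nonneg)
  qed
  moreover have "0 < m * measure lborel (cball c (r / 2))"
    using assms content_cball_pos[of "r / 2" c] by (simp add: m_def)
  ultimately show ?thesis by simp
qed

section \<open>Mollification with bumps moving in time\<close>

lemma
  fixes u :: "'a::euclidean_space \<Rightarrow> real"
  assumes u: "continuous_on U u" "bounded (u ` U)" and U: "open U" and f: "compact_lipschitz f"
  shows integrable_mult_compact_lipschitz: "integrable lborel (\<lambda>z. indicator U z * (u z * f z))"
proof -
  obtain B where B: "\<And>z. z \<in> U \<Longrightarrow> \<bar>u z\<bar> \<le> B" using u(2) unfolding bounded_iff by auto
  have [measurable]: "(\<lambda>z. indicator U z * u z) \<in> borel_measurable borel"
    using borel_measurable_continuous_on_indicator[OF _ u(1)] U by simp
  note [measurable] = compact_lipschitz_measurable[OF f]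
  have "(\<lambda>z. (indicator U z * u z) * f z) \<in> borel_measurable borel" by measurable
  then have m: "(\<lambda>z. indicator U z * (u z * f z)) \<in> borel_measurable lborel" by (simp add: mult.assoc)
  have b: "norm (indicator U z * (u z * f z)) \<le> norm (\<bar>B\<bar> * \<bar>f z\<bar>)" for z
    using B[of z] by (auto simp: indicator_def abs_mult intro!: mult_right_mono)
  have "integrable lborel (\<lambda>z. \<bar>B\<bar> * \<bar>f z\<bar>)"
    by (intro integrable_mult_right integrable_abs compact_lipschitz_integrable f)
  then show ?thesis by (rule Bochner_Integration.integrable_bound[OF _ m]) (use b in simp)
qed

text \<open>The mollification of \<open>u\<close> is constant in time because its increments are of second order.\<close>

lemma bump_average_time_constant:
  fixes u :: "real \<times> (real ^ 'n) \<Rightarrow> real"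
  assumes u: "continuous_on U u" "bounded (u ` U)" and U: "open U" and r: "0 < r"
    and K: "\<And>s. s \<in> {t..t'} \<Longrightarrow> cball (s, y) r \<subseteq> U" and tt: "t \<le> t'"
    and weak: "\<And>\<phi>. \<phi> \<in> test_functions U \<Longrightarrow> (\<integral>z. indicator U z * (u z * pd (1, 0) \<phi> z) \<partial>lborel) = 0"
  shows "(\<integral>z. indicator U z * (u z * bump r (t, y) z) \<partial>lborel) = (\<integral>z. indicator U z * (u z * bump r (t', y) z) \<partial>lborel)"
proof -
  define J where "J s = (\<integral>z. indicator U z * (u z * bump r (s, y) z) \<partial>lborel)" for s
  \<comment> \<open>All bumps are time translates of this one, so a single Lipschitz constant of its
    time derivative serves for every s.\<close>
  define B where "B = bump r (t, y)"
  have B: "B \<in> test_functions UNIV" unfolding B_def using r by (intro bump_test_function) auto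
  have bs: "bump r (s, y) z = B (z - (s - t, 0))" for s z
    using bump_shift[of r "(t, y)" "(s - t, 0)" z] by (simp add: B_def)
  obtain L where L: "0 \<le> L" "\<And>z h. \<bar>pd (1, 0) B (z + h) - pd (1, 0) B z\<bar> \<le> L * norm h"
    using compact_lipschitz_diff[OF compact_lipschitz_test_function[OF test_function_pd(1)[OF B]]] by blast
  define S where "S = {t - r..t' + r} \<times> cball y r"
  have S: "emeasure lborel S < \<infinity>" "S \<in> sets lborel"
  proof -
    show "emeasure lborel S < \<infinity>"
      unfolding S_def by (intro emeasure_bounded_finite bounded_Times) auto
    show "S \<in> sets lborel" unfolding S_def by (auto intro!: borel_closed closed_Times)
  qed
  obtain b where b: "\<And>z. z \<in> U \<Longrightarrow> \<bar>u z\<bar> \<le> b" using u(2) unfolding bounded_iff by auto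
  define C where "C = \<bar>b\<bar> * L * measure lborel S"
  have out: "bump r (s, y) z = 0" if "s \<in> {t..t'}" "z \<notin> S" for s z
  proof (rule bump_eq_0[OF r])
    show "r \<le> norm (z - (s, y))"
    proof (rule ccontr)
      assume "\<not> r \<le> norm (z - (s, y))"
      moreover have "\<bar>fst z - s\<bar> \<le> norm (z - (s, y))" "norm (snd z - y) \<le> norm (z - (s, y))"
        using norm_fst_le[of "fst z - s" "snd z - y"] norm_snd_le[of "snd z - y" "fst z - s"] by (simp_all add: minus_prod_def)
      ultimately show False using that by (cases z) (auto simp: S_def dist_norm norm_minus_commute)
    qed
  qed
  have quad: "\<bar>J s' - J s\<bar> \<le> C * (s' - s)\<^sup>2" if s: "s \<in> {t..t'}" "s' \<in> {t..t'}" for s s'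
  proof -
    note ts = bump_test_function[OF r K[OF s(1)]] and ts' = bump_test_function[OF r K[OF s(2)]]
    have cl: "compact_lipschitz (bump r (s, y))" "compact_lipschitz (bump r (s', y))" "compact_lipschitz (pd (1, 0) (bump r (s, y)))"
      by (rule compact_lipschitz_test_function[OF ts], rule compact_lipschitz_test_function[OF ts'],
          rule compact_lipschitz_test_function[OF test_function_pd(1)[OF ts]])
    have eq: "bump r (s', y) z = bump r (s, y) (z - (s' - s, 0))" for s s' z
      using bump_shift[of r "(s, y)" "(s' - s, 0)" z] by simp
    have pd_out: "pd (1, 0) (bump r (s, y)) z = 0" if "z \<notin> S" for z
    proof -
      have "supp (bump r (s, y)) \<subseteq> S"
        unfolding supp_def S_def
        by (rule closure_minimal) (use out[OF s(1)] in \<open>auto simp: S_def intro!: closed_Times\<close>)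
      then show ?thesis
        using supp_frechet_derivative_subset[OF test_functionD(2)[OF ts], of "(1, 0)"] that
          closure_subset[of "{z. pd (1, 0) (bump r (s, y)) z \<noteq> 0}"]
        unfolding supp_def pd_def by blast
    qed
    have pdB: "pd (1, 0) (bump r (s, y)) z = pd (1, 0) B (z - (s - t, 0))" for z
    proof -
      have d1: "((\<lambda>x. bump r (s, y) (z + x *\<^sub>R (1, 0))) has_real_derivative pd (1, 0) (bump r (s, y)) z) (at 0)"
        using DERIV_test_function_line[OF ts, of z "(1, 0)" 0] by (simp add: pd_def zero_prod_def[symmetric])
      have d2: "((\<lambda>x. B (z - (s - t, 0) + x *\<^sub>R (1, 0))) has_real_derivative pd (1, 0) B (z - (s - t, 0))) (at 0)"
        using DERIV_test_function_line[OF B, of "z - (s - t, 0)" "(1, 0)" 0] by (simp add: pd_def zero_prod_def[symmetric])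
      have "(\<lambda>x. bump r (s, y) (z + x *\<^sub>R (1, 0))) = (\<lambda>x. B (z - (s - t, 0) + x *\<^sub>R (1, 0)))"
        by (simp add: bs algebra_simps)
      then show ?thesis using DERIV_unique[OF d1] d2 by simp
    qed
    \<comment> \<open>When the centre moves forward, the value at a fixed z moves backward along
      \<open>B\<close>; hence the plus sign of the first order term and h = s - s'.\<close>
    have taylor: "\<bar>bump r (s', y) z - bump r (s, y) z + (s' - s) * pd (1, 0) (bump r (s, y)) z\<bar> \<le> L * (s' - s)\<^sup>2" for z
    proof -
      define h where "h = s - s'"
      define w where "w = z - (s - t, 0)"
      have "((\<lambda>q. B (w + q *\<^sub>R (h, 0))) has_real_derivative h * pd (1, 0) B (w + q *\<^sub>R (h, 0))) (at q)" for q
      proof -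
        have "((\<lambda>x. B (w + x *\<^sub>R (1, 0))) has_real_derivative pd (1, 0) B (w + (q * h) *\<^sub>R (1, 0))) (at (q * h))"
          using DERIV_test_function_line[OF B, of w "(1, 0)" "q * h"] by (simp add: pd_def)
        moreover have "((\<lambda>q. q * h) has_real_derivative h) (at q)" by (auto intro!: derivative_eq_intros)
        ultimately have "((\<lambda>q. B (w + (q * h) *\<^sub>R (1, 0))) has_real_derivative pd (1, 0) B (w + (q * h) *\<^sub>R (1, 0)) * h) (at q)"
          by (rule DERIV_chain2)
        then show ?thesis by (simp add: mult.commute)
      qed
      then obtain q where q: "0 < q" "q < 1" "B (w + (h, 0)) - B w = h * pd (1, 0) B (w + q *\<^sub>R (h, 0))"
        using MVT_line[of B w "(h, 0)" "\<lambda>v. h * pd (1, 0) B v"] by blast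
      have weq: "w + (h, 0) = z - (s' - t, 0)" by (simp add: w_def h_def prod_eq_iff)
      have "bump r (s', y) z - bump r (s, y) z = B (w + (h, 0)) - B w"
        unfolding bs weq by (simp only: w_def)
      then have "bump r (s', y) z - bump r (s, y) z + (s' - s) * pd (1, 0) (bump r (s, y)) z
          = h * (pd (1, 0) B (w + q *\<^sub>R (h, 0)) - pd (1, 0) B w)"
        unfolding q(3) pdB w_def[symmetric] by (simp add: h_def algebra_simps)
      also have "\<bar>\<dots>\<bar> \<le> \<bar>h\<bar> * (L * \<bar>h\<bar>)"
      proof -
        have "\<bar>pd (1, 0) B (w + q *\<^sub>R (h, 0)) - pd (1, 0) B w\<bar> \<le> L * norm (q *\<^sub>R (h, 0 :: real ^ 'n))" by (rule L)
        also have "\<dots> \<le> L * \<bar>h\<bar>" using q L by (intro mult_left_mono) (auto simp: abs_mult mult_left_le_one_le)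
        finally show ?thesis by (simp add: abs_mult mult_left_mono)
      qed
      also have "\<bar>h\<bar> * (L * \<bar>h\<bar>) = L * (s' - s)\<^sup>2"
      proof -
        have "\<bar>h\<bar> * \<bar>h\<bar> = (s' - s)\<^sup>2" unfolding abs_mult_self_eq by (simp add: h_def power2_eq_square algebra_simps)
        then show ?thesis by (simp only: mult.left_commute)
      qed
      finally show ?thesis .
    qed
    define D where "D z = indicator U z * (u z * bump r (s', y) z) - indicator U z * (u z * bump r (s, y) z)
        + (s' - s) * (indicator U z * (u z * pd (1, 0) (bump r (s, y)) z))" for z
    note ints = cl[THEN integrable_mult_compact_lipschitz[OF u U]]
    have D_int: "integrable lborel D"
      unfolding D_def using ints by (intro Bochner_Integration.integrable_add Bochner_Integration.integrable_diff integrable_mult_right)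
    have "(\<integral>z. D z \<partial>lborel) = J s' - J s + (s' - s) * (\<integral>z. indicator U z * (u z * pd (1, 0) (bump r (s, y)) z) \<partial>lborel)"
      unfolding D_def J_def using ints by simp
    \<comment> \<open>The weak hypothesis, tested with the bump at s, removes the first order
      term.\<close>
    then have J: "(\<integral>z. D z \<partial>lborel) = J s' - J s" using weak[OF ts] by simp
    have "norm (D z) \<le> \<bar>b\<bar> * (L * (s' - s)\<^sup>2) * indicator S z" for z
    proof (cases "z \<in> S \<and> z \<in> U")
      case True
      then have "D z = u z * (bump r (s', y) z - bump r (s, y) z + (s' - s) * pd (1, 0) (bump r (s, y)) z)"
        by (simp add: D_def algebra_simps)
      then have "norm (D z) = \<bar>u z\<bar> * \<bar>bump r (s', y) z - bump r (s, y) z + (s' - s) * pd (1, 0) (bump r (s, y)) z\<bar>"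
        by (simp add: abs_mult)
      also have "\<dots> \<le> \<bar>b\<bar> * (L * (s' - s)\<^sup>2)"
        using b[of z] True by (intro mult_mono taylor) auto
      finally show ?thesis using True by simp
    next
      case False
      then have "D z = 0" using out[OF s(1), of z] out[OF s(2), of z] pd_out[of z] by (auto simp: D_def)
      then show ?thesis using L(1) by simp
    qed
    then have "norm (\<integral>z. D z \<partial>lborel) \<le> (\<integral>z. \<bar>b\<bar> * (L * (s' - s)\<^sup>2) * indicator S z \<partial>lborel)"
      using D_int S by (intro Bochner_Integration.integral_norm_bound_integral integrable_mult_right integrable_real_indicator) auto
    also have "\<dots> = C * (s' - s)\<^sup>2" using S by (simp add: C_def mult_ac)
    finally show ?thesis unfolding J by simp
  qed
  have "(J has_field_derivative 0) (at s within {t..t'})" if s: "s \<in> {t..t'}" for s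
    unfolding has_field_derivative_iff
  proof (rule Lim_null_comparison)
    show "eventually (\<lambda>s'. norm ((J s' - J s) / (s' - s)) \<le> C * \<bar>s' - s\<bar>) (at s within {t..t'})"
      unfolding eventually_at_filter
    proof (rule always_eventually, intro allI impI)
      fix s' assume s': "s' \<noteq> s" "s' \<in> {t..t'}"
      have "(s' - s)\<^sup>2 = \<bar>s' - s\<bar> * \<bar>s' - s\<bar>" by (simp add: power2_eq_square)
      then have "\<bar>J s' - J s\<bar> \<le> (C * \<bar>s' - s\<bar>) * \<bar>s' - s\<bar>" using quad[OF s s'(2)] by (simp only: mult.assoc)
      then have "\<bar>J s' - J s\<bar> / \<bar>s' - s\<bar> \<le> C * \<bar>s' - s\<bar>" using s'(1) by (subst pos_divide_le_eq) auto
      then show "norm ((J s' - J s) / (s' - s)) \<le> C * \<bar>s' - s\<bar>" by simp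
    qed
    have "((\<lambda>s'. C * \<bar>s' - s\<bar>) \<longlongrightarrow> C * \<bar>s - s\<bar>) (at s within {t..t'})" by (intro tendsto_intros)
    then show "((\<lambda>s'. C * \<bar>s' - s\<bar>) \<longlongrightarrow> 0) (at s within {t..t'})" by simp
  qed
  then obtain c where "\<And>s. s \<in> {t..t'} \<Longrightarrow> J s = c"
    using has_field_derivative_zero_constant[of "{t..t'}" J] by auto
  then show ?thesis using tt unfolding J_def by auto
qed

text \<open>If the values at the two ends differed, the difference \<open>w\<close> of the two
  translates of u would keep its sign near 0 and have a nonzero bump average; but the bump averages
  at the two ends agree.\<close>

lemma weak_time_derivative_zero_imp_constant:
  fixes u :: "real \<times> (real ^ 'n) \<Rightarrow> real"
  assumes u: "continuous_on U u" "bounded (u ` U)" and U: "open U"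
    and seg: "{t..t'} \<times> {y} \<subseteq> U" and tt: "t \<le> t'"
    and weak: "\<And>\<phi>. \<phi> \<in> test_functions U \<Longrightarrow> (\<integral>z. indicator U z * (u z * pd (1, 0) \<phi> z) \<partial>lborel) = 0"
  shows "u (t, y) = u (t', y)"
proof (rule ccontr)
  assume ne: "u (t, y) \<noteq> u (t', y)"
  define w where "w v = u (v + (t, y)) - u (v + (t', y))" for v
  \<comment> \<open>With an error e at each end, \<open>w\<close> stays within 2 e = |w 0| / 2 of
    its value at 0.\<close>
  define e where "e = \<bar>w 0\<bar> / 4"
  have e: "0 < e" using ne by (simp add: e_def w_def)
  \<comment> \<open>The bump must stay inside U on the whole way from t to t'; compactness of the
    segment provides one radius for all centres.\<close>
  obtain \<delta> where \<delta>: "0 < \<delta>" "\<And>s. s \<in> {t..t'} \<Longrightarrow> cball (s, y) \<delta> \<subseteq> U"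
  proof -
    have "compact ({t..t'} \<times> {y})" by (intro compact_Times) auto
    then obtain d where "0 < d" "(\<Union>x\<in>{t..t'} \<times> {y}. ball x d) \<subseteq> U"
      using compact_subset_open_imp_ball_epsilon_subset[OF _ U seg] by blast
    then show thesis by (intro that[of "d / 2"]) (force simp: subset_iff)+
  qed
  have at: "(t, y) \<in> U" "(t', y) \<in> U" using seg tt by auto
  have "isCont u (t, y)" "isCont u (t', y)"
    using u(1) U at continuous_on_eq_continuous_at by blast+
  then obtain d1 d2 where d1: "0 < d1" "\<And>z. dist z (t, y) < d1 \<Longrightarrow> dist (u z) (u (t, y)) < e"
    and d2: "0 < d2" "\<And>z. dist z (t', y) < d2 \<Longrightarrow> dist (u z) (u (t', y)) < e"
    unfolding continuous_at_eps_delta dist_norm using e by metis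
  define r where "r = min \<delta> (min d1 d2) / 2"
  have r: "0 < r" "r \<le> \<delta>" "r < d1" "r < d2" using \<delta> d1 d2 by (auto simp: r_def)
  have sub: "cball (s, y) r \<subseteq> U" if "s \<in> {t..t'}" for s
    using \<delta>(2)[OF that] r subset_cball[of r \<delta> "(s, y)"] by blast
  have near: "\<bar>w v - w 0\<bar> \<le> 2 * e" if "norm v \<le> r" for v
  proof -
    have "dist (u (v + (t, y))) (u (t, y)) < e" "dist (u (v + (t', y))) (u (t', y)) < e"
      by (rule d1(2), use that r in \<open>simp add: dist_norm\<close>, rule d2(2), use that r in \<open>simp add: dist_norm\<close>)
    then show ?thesis by (simp add: w_def dist_real_def)
  qed
  define Jint where "Jint s v = indicator U (v + (s, y)) * (u (v + (s, y)) * bump r 0 v)" for s v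
  have J: "integrable lborel (Jint s)" "(\<integral>z. indicator U z * (u z * bump r (s, y) z) \<partial>lborel) = (\<integral>v. Jint s v \<partial>lborel)"
    if "s \<in> {t..t'}" for s
  proof -
    define f where "f z = indicator U z * (u z * bump r (s, y) z)" for z
    have fi: "integrable lborel f"
      unfolding f_def by (intro integrable_mult_compact_lipschitz u U compact_lipschitz_test_function[where U = U] bump_test_function sub that r)
    then have fm: "f \<in> borel_measurable borel" by (auto dest: borel_measurable_integrable)
    have eq: "Jint s v = f ((s, y) + v)" for v
      using bump_shift[of r 0 "(s, y)" "v + (s, y)"] by (simp add: f_def Jint_def add.commute)
    show "integrable lborel (Jint s)"
      unfolding eq[abs_def] using fi integrable_lborel_translate[OF fm] by blast
    show "(\<integral>z. f z \<partial>lborel) = (\<integral>v. Jint s v \<partial>lborel)"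
      unfolding eq[abs_def] using integral_lborel_translate[OF fm] by simp
  qed
  have t: "t \<in> {t..t'}" "t' \<in> {t..t'}" using tt by auto
  define q where "q v = w v * bump r 0 v" for v
  have cb: "v + p \<in> cball p r" if "norm v \<le> r" for v p :: "real \<times> (real ^ 'n)"
    using that by (subst mem_cball, subst dist_commute) (simp add: dist_norm)
  have q_eq: "q v = Jint t v - Jint t' v" for v
  proof (cases "norm v < r")
    case True
    then have "v + (t, y) \<in> U" "v + (t', y) \<in> U" using sub[OF t(1)] sub[OF t(2)] cb[of v] by (auto simp: less_imp_le)
    then show ?thesis by (simp add: q_def Jint_def w_def algebra_simps)
  next
    case False
    then show ?thesis using bump_eq_0[OF r(1), of v 0] by (simp add: q_def Jint_def)
  qed
  have q_int: "integrable lborel q" "(\<integral>v. q v \<partial>lborel) = 0"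
    unfolding q_eq[abs_def] using J[OF t(1)] J[OF t(2)] bump_average_time_constant[OF u U r(1) sub tt weak] by auto
  have cl: "compact_lipschitz (bump r (0 :: real \<times> (real ^ 'n)))"
    using r by (intro compact_lipschitz_test_function[where U = UNIV] bump_test_function) auto
  have "2 * e * bump r 0 v \<le> sgn (w 0) * q v" for v
  proof (cases "norm v < r")
    case True
    have "2 * e \<le> sgn (w 0) * w v"
    proof (cases "0 < w 0")
      case pos: True
      then have "w 0 / 2 \<le> w v" using near[of v] True unfolding e_def by linarith
      then show ?thesis using pos by (simp add: e_def)
    next
      case False
      then have "w v \<le> w 0 / 2" using near[of v] True unfolding e_def by linarith
      then show ?thesis using False e by (simp add: e_def sgn_if)
    qed
    then show ?thesis using mult_right_mono[OF _ bump_nonneg[of r 0 v]] by (simp add: q_def mult.assoc[symmetric])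
  next
    case False
    then show ?thesis using bump_eq_0[OF r(1), of v 0] by (simp add: q_def)
  qed
  then have "(\<integral>v. 2 * e * bump r (0 :: real \<times> (real ^ 'n)) v \<partial>lborel) \<le> (\<integral>v. sgn (w 0) * q v \<partial>lborel)"
    using q_int compact_lipschitz_integrable[OF cl] by (intro integral_mono integrable_mult_right)
  also have "\<dots> = 0" using q_int by simp
  finally show False
    using e integral_bump_pos[OF r(1), of "0 :: real \<times> (real ^ 'n)"] by (simp add: mult_le_0_iff)
qed

section \<open>Hoelder spaces on cylinders\<close>

lemma open_time_open: "open (time_open T)"
  by (cases T) (auto simp: time_open_def simp flip: lessThan_def)

lemma time_closed_eq:
  assumes "T \<noteq> -\<infinity>"
  shows "time_closed T = {t. ereal t \<le> T}"
proof (cases T)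
  case (real r)
  have "{t. t < r} = {..<r}" "{t. t \<le> r} = {..r}" by auto
  then show ?thesis by (simp add: time_closed_def time_open_def real)
qed (use assms in \<open>auto simp: time_closed_def time_open_def\<close>)

lemma time_open_subset_closed: "time_open T \<subseteq> time_closed T"
  unfolding time_closed_def by (rule closure_subset)

lemma time_closed_past: "T \<noteq> -\<infinity> \<Longrightarrow> t \<in> time_closed T \<Longrightarrow> \<tau> < t \<Longrightarrow> \<tau> \<in> time_open T"
  by (auto simp: time_closed_eq time_open_def intro: order_less_le_trans[of "ereal \<tau>" "ereal t"])

lemma open_cyl_subset: "open_cyl T \<Omega> \<subseteq> cyl T (closure \<Omega>)"
  unfolding open_cyl_def cyl_def using time_open_subset_closed closure_subset by (intro Sigma_mono)

lemma open_open_cyl: "open \<Omega> \<Longrightarrow> open (open_cyl T \<Omega>)"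
  unfolding open_cyl_def by (intro open_Times open_time_open)

section \<open>Extension in time, and Hoelder norms as real inequalities\<close>

definition clamp_time :: "ereal \<Rightarrow> real \<Rightarrow> real" where
  "clamp_time T t = (if T = \<infinity> then t else min t (real_of_ereal T))"

text \<open>A retraction of the time axis onto the closed interval that does not increase distances,
  so composing with it preserves Hoelder constants in time.\<close>

lemma clamp_time:
  assumes "T \<noteq> -\<infinity>"
  shows "clamp_time T t \<in> time_closed T" "t \<in> time_closed T \<Longrightarrow> clamp_time T t = t"
    "\<bar>clamp_time T t - clamp_time T t'\<bar> \<le> \<bar>t - t'\<bar>" "continuous_on UNIV (clamp_time T)"
proof -
  show "continuous_on UNIV (clamp_time T)"
    unfolding clamp_time_def by (cases "T = \<infinity>") (auto intro!: continuous_intros)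
qed (use assms in \<open>cases T; auto simp: clamp_time_def time_closed_eq\<close>)+

lemma tendsto_powr_null:
  fixes f :: "'b \<Rightarrow> real"
  assumes "(f \<longlongrightarrow> 0) F" "\<And>x. 0 \<le> f x" "0 < p"
  shows "((\<lambda>x. f x powr p) \<longlongrightarrow> 0) F"
  using tendsto_powr2[OF assms(1) tendsto_const, of p] assms by simp

text \<open>A Hoelder bound in time that is uniform in x upgrades continuity on each slice to joint
  continuity.\<close>

lemma continuous_on_cyl:
  fixes v :: "real \<times> (real ^ 'n) \<Rightarrow> real"
  assumes g: "0 < g" and time: "\<And>t t' x. t \<in> S \<Longrightarrow> t' \<in> S \<Longrightarrow> x \<in> D \<Longrightarrow> \<bar>v (t, x) - v (t', x)\<bar> \<le> A * \<bar>t - t'\<bar> powr g"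
    and space: "\<And>t. t \<in> S \<Longrightarrow> continuous_on D (\<lambda>x. v (t, x))"
  shows "continuous_on (S \<times> D) v"
  unfolding continuous_on_def
proof
  fix z assume "z \<in> S \<times> D"
  then obtain t x where z: "z = (t, x)" "t \<in> S" "x \<in> D" by auto
  have "((\<lambda>w. \<bar>fst w - t\<bar>) \<longlongrightarrow> \<bar>fst z - t\<bar>) (at z within S \<times> D)" by (intro tendsto_intros)
  then have "((\<lambda>w. \<bar>fst w - t\<bar> powr g) \<longlongrightarrow> 0) (at z within S \<times> D)"
    using g by (intro tendsto_powr_null) (auto simp: z)
  then have 1: "((\<lambda>w. A * \<bar>fst w - t\<bar> powr g) \<longlongrightarrow> 0) (at z within S \<times> D)"
    by (rule tendsto_mult_right_zero)
  have "continuous_on (S \<times> D) (\<lambda>w. v (t, snd w))"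
    by (rule continuous_on_compose2[OF space[OF z(2)]]) (auto intro!: continuous_intros)
  then have 2: "((\<lambda>w. v (t, snd w)) \<longlongrightarrow> v z) (at z within S \<times> D)"
    using \<open>z \<in> S \<times> D\<close> z unfolding continuous_on_def by fastforce
  have "((\<lambda>w. v w - v (t, snd w)) \<longlongrightarrow> 0) (at z within S \<times> D)"
  proof (rule Lim_null_comparison[OF _ 1])
    show "eventually (\<lambda>w. norm (v w - v (t, snd w)) \<le> A * \<bar>fst w - t\<bar> powr g) (at z within S \<times> D)"
      unfolding eventually_at_filter
    proof (rule always_eventually, intro allI impI)
      fix w :: "real \<times> (real ^ 'n)" assume "w \<in> S \<times> D"
      then show "norm (v w - v (t, snd w)) \<le> A * \<bar>fst w - t\<bar> powr g"
        using time[of "fst w" t "snd w"] z(2) by (cases w) auto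
    qed
  qed
  from tendsto_add[OF this 2] show "(v \<longlongrightarrow> v z) (at z within S \<times> D)" by simp
qed

lemma sup_norm_le: "(\<And>z. z \<in> S \<Longrightarrow> \<bar>v z\<bar> \<le> A) \<Longrightarrow> sup_norm S v \<le> ennreal A"
  unfolding sup_norm_def by (intro SUP_least ennreal_leI)

lemma time_seminorm_le:
  assumes "\<And>t t' x. t \<in> time_closed T \<Longrightarrow> t' \<in> time_closed T \<Longrightarrow> x \<in> D \<Longrightarrow> \<bar>v (t, x) - v (t', x)\<bar> \<le> A * \<bar>t - t'\<bar> powr g"
  shows "time_seminorm T D g v \<le> ennreal A"
  unfolding time_seminorm_def
proof (intro SUP_least, clarify, intro SUP_least ennreal_leI)
  fix t t' x assume "t \<in> time_closed T" "t' \<in> time_closed T" "t \<noteq> t'" "x \<in> D"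
  then show "\<bar>v (t, x) - v (t', x)\<bar> / \<bar>t - t'\<bar> powr g \<le> A"
    using assms[of t t' x] by (simp add: divide_le_eq)
qed

lemma space_seminorm_le:
  assumes "\<And>t x x'. t \<in> time_closed T \<Longrightarrow> x \<in> D \<Longrightarrow> x' \<in> D \<Longrightarrow> \<bar>v (t, x) - v (t, x')\<bar> \<le> A * norm (x - x') powr b"
  shows "space_seminorm T D b v \<le> ennreal A"
  unfolding space_seminorm_def
proof (intro SUP_least, clarify, intro ennreal_leI)
  fix t x x' assume "t \<in> time_closed T" "x \<in> D" "x' \<in> D" "x \<noteq> x'"
  then show "\<bar>v (t, x) - v (t, x')\<bar> / norm (x - x') powr b \<le> A"
    using assms[of t x x'] by (simp add: divide_le_eq)
qed

lemma holder_spaceI: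
  fixes v :: "real \<times> (real ^ 'n) \<Rightarrow> real"
  assumes "0 \<le> A" "0 < g" "0 < b"
    and sup: "\<And>t x. t \<in> time_closed T \<Longrightarrow> x \<in> D \<Longrightarrow> \<bar>v (t, x)\<bar> \<le> A"
    and time: "\<And>t t' x. t \<in> time_closed T \<Longrightarrow> t' \<in> time_closed T \<Longrightarrow> x \<in> D \<Longrightarrow> \<bar>v (t, x) - v (t', x)\<bar> \<le> A * \<bar>t - t'\<bar> powr g"
    and space: "\<And>t x x'. t \<in> time_closed T \<Longrightarrow> x \<in> D \<Longrightarrow> x' \<in> D \<Longrightarrow> \<bar>v (t, x) - v (t, x')\<bar> \<le> A * norm (x - x') powr b"
  shows "v \<in> holder_space T D g b" "holder_norm T D g b v \<le> ennreal (3 * A)"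
proof -
  \<comment> \<open>The factor 3 counts the sup norm and the two seminorms, each at most A.\<close>
  have "holder_norm T D g b v \<le> ennreal A + ennreal A + ennreal A"
    unfolding holder_norm_def
    by (intro add_mono sup_norm_le time_seminorm_le space_seminorm_le time space) (auto simp: cyl_def sup)
  also have "\<dots> = ennreal (3 * A)" using assms(1) by (simp flip: ennreal_plus)
  finally show n: "holder_norm T D g b v \<le> ennreal (3 * A)" .
  have "continuous_on D (\<lambda>x. v (t, x))" if t: "t \<in> time_closed T" for t
    unfolding continuous_on_def
  proof
    fix x assume x: "x \<in> D"
    have "((\<lambda>x'. norm (x' - x)) \<longlongrightarrow> norm (x - x)) (at x within D)" by (intro tendsto_intros)
    then have "((\<lambda>x'. norm (x' - x) powr b) \<longlongrightarrow> 0) (at x within D)"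
      using assms(3) by (intro tendsto_powr_null) auto
    then have "((\<lambda>x'. A * norm (x' - x) powr b) \<longlongrightarrow> 0) (at x within D)"
      by (rule tendsto_mult_right_zero)
    then have "((\<lambda>x'. v (t, x') - v (t, x)) \<longlongrightarrow> 0) (at x within D)"
      by (rule Lim_null_comparison[rotated]) (use space[OF t _ x] in \<open>auto simp: eventually_at_filter\<close>)
    then show "((\<lambda>x'. v (t, x')) \<longlongrightarrow> v (t, x)) (at x within D)" by (rule LIM_zero_cancel)
  qed
  then have "continuous_on (cyl T D) v"
    unfolding cyl_def using time by (intro continuous_on_cyl[OF \<open>0 < g\<close>])
  moreover have "bounded (v ` cyl T D)"
    unfolding bounded_iff using sup by (auto simp: cyl_def)
  ultimately show "v \<in> holder_space T D g b"
    using n by (auto simp: holder_space_def intro: order_le_less_trans)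
qed

text \<open>Membership makes the extended norm a real number N; as its three summands are
  nonnegative, N alone serves as the constant in each pointwise bound.\<close>

lemma holder_spaceD:
  fixes v :: "real \<times> (real ^ 'n) \<Rightarrow> real"
  assumes v: "v \<in> holder_space T D g b"
  defines "N \<equiv> enn2real (holder_norm T D g b v)"
  shows "continuous_on (cyl T D) v" "bounded (v ` cyl T D)" "0 \<le> N" "holder_norm T D g b v = ennreal N"
    "t \<in> time_closed T \<Longrightarrow> x \<in> D \<Longrightarrow> \<bar>v (t, x)\<bar> \<le> N"
    "t \<in> time_closed T \<Longrightarrow> t' \<in> time_closed T \<Longrightarrow> x \<in> D \<Longrightarrow> \<bar>v (t, x) - v (t', x)\<bar> \<le> N * \<bar>t - t'\<bar> powr g"
    "t \<in> time_closed T \<Longrightarrow> x \<in> D \<Longrightarrow> x' \<in> D \<Longrightarrow> \<bar>v (t, x) - v (t, x')\<bar> \<le> N * norm (x - x') powr b"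
proof -
  show "continuous_on (cyl T D) v" "bounded (v ` cyl T D)" and N0: "0 \<le> N"
    using v by (auto simp: holder_space_def N_def)
  show N: "holder_norm T D g b v = ennreal N" using v by (simp add: holder_space_def N_def)
  have le: "a \<le> N" if "ennreal a \<le> x" "x \<le> holder_norm T D g b v" for a x
    using order_trans[OF that] N0 unfolding N by simp
  show "\<bar>v (t, x)\<bar> \<le> N" if "t \<in> time_closed T" "x \<in> D"
  proof (rule le)
    show "ennreal \<bar>v (t, x)\<bar> \<le> sup_norm (cyl T D) v"
      unfolding sup_norm_def using that by (intro SUP_upper) (auto simp: cyl_def)
    show "sup_norm (cyl T D) v \<le> holder_norm T D g b v" unfolding holder_norm_def by (simp add: add.assoc)
  qed
  show "\<bar>v (t, x) - v (t', x)\<bar> \<le> N * \<bar>t - t'\<bar> powr g" if "t \<in> time_closed T" "t' \<in> time_closed T" "x \<in> D"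
  proof (cases "t = t'")
    case False
    have "\<bar>v (t, x) - v (t', x)\<bar> / \<bar>t - t'\<bar> powr g \<le> N"
    proof (rule le)
      show "ennreal (\<bar>v (t, x) - v (t', x)\<bar> / \<bar>t - t'\<bar> powr g) \<le> time_seminorm T D g v"
        unfolding time_seminorm_def using that False by (intro SUP_upper2[of "(t, t')"]) (auto intro!: SUP_upper2[of x])
      show "time_seminorm T D g v \<le> holder_norm T D g b v"
        unfolding holder_norm_def by (simp add: add.commute[of "sup_norm _ _"] add.assoc)
    qed
    then show ?thesis using False by (simp add: divide_le_eq)
  qed simp
  show "\<bar>v (t, x) - v (t, x')\<bar> \<le> N * norm (x - x') powr b" if "t \<in> time_closed T" "x \<in> D" "x' \<in> D"
  proof (cases "x = x'")
    case False
    have "\<bar>v (t, x) - v (t, x')\<bar> / norm (x - x') powr b \<le> N"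
    proof (rule le)
      show "ennreal (\<bar>v (t, x) - v (t, x')\<bar> / norm (x - x') powr b) \<le> space_seminorm T D b v"
        unfolding space_seminorm_def using that False by (intro SUP_upper2[of t]) (auto intro!: SUP_upper2[of "(x, x')"])
      show "space_seminorm T D b v \<le> holder_norm T D g b v" unfolding holder_norm_def by simp
    qed
    then show ?thesis using False by (simp add: divide_le_eq)
  qed simp
qed

lemma holder_space_linear:
  fixes u v :: "real \<times> (real ^ 'n) \<Rightarrow> real"
  assumes u: "u \<in> holder_space T D g b" and v: "v \<in> holder_space T D g b" and gb: "0 < g" "0 < b"
  shows "(\<lambda>z. p * u z + q * v z) \<in> holder_space T D g b"
proof -
  note U = holder_spaceD[OF u] and V = holder_spaceD[OF v]
  let ?N = "enn2real (holder_norm T D g b u)" and ?M = "enn2real (holder_norm T D g b v)"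
  have lin: "\<bar>p * x + q * y\<bar> \<le> (\<bar>p\<bar> * ?N + \<bar>q\<bar> * ?M) * k" if "\<bar>x\<bar> \<le> ?N * k" "\<bar>y\<bar> \<le> ?M * k" for x y k
  proof -
    have "\<bar>p * x + q * y\<bar> \<le> \<bar>p\<bar> * \<bar>x\<bar> + \<bar>q\<bar> * \<bar>y\<bar>" by (rule order_trans[OF abs_triangle_ineq]) (simp add: abs_mult)
    also have "\<dots> \<le> \<bar>p\<bar> * (?N * k) + \<bar>q\<bar> * (?M * k)" using that by (intro add_mono mult_left_mono) auto
    finally show ?thesis by (simp add: algebra_simps)
  qed
  have diff: "p * x + q * y - (p * x' + q * y') = p * (x - x') + q * (y - y')" for x y x' y' by (simp add: algebra_simps)
  show ?thesis
  proof (rule holder_spaceI(1)[where A = "\<bar>p\<bar> * ?N + \<bar>q\<bar> * ?M", OF _ gb])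
    show "0 \<le> \<bar>p\<bar> * ?N + \<bar>q\<bar> * ?M" by simp
    show "\<bar>p * u (t, x) + q * v (t, x)\<bar> \<le> \<bar>p\<bar> * ?N + \<bar>q\<bar> * ?M" if "t \<in> time_closed T" "x \<in> D" for t x
      using lin[of "u (t, x)" 1 "v (t, x)"] U(5)[OF that] V(5)[OF that] by simp
    show "\<bar>p * u (t, x) + q * v (t, x) - (p * u (t', x) + q * v (t', x))\<bar> \<le> (\<bar>p\<bar> * ?N + \<bar>q\<bar> * ?M) * \<bar>t - t'\<bar> powr g"
      if "t \<in> time_closed T" "t' \<in> time_closed T" "x \<in> D" for t t' x
      unfolding diff by (rule lin[OF U(6)[OF that] V(6)[OF that]])
    show "\<bar>p * u (t, x) + q * v (t, x) - (p * u (t, x') + q * v (t, x'))\<bar> \<le> (\<bar>p\<bar> * ?N + \<bar>q\<bar> * ?M) * norm (x - x') powr b"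
      if "t \<in> time_closed T" "x \<in> D" "x' \<in> D" for t x x'
      unfolding diff by (rule lin[OF U(7)[OF that] V(7)[OF that]])
  qed
qed

section \<open>The heat volume potential\<close>

text \<open>The difference of two primitives has vanishing distributional time derivative, so over
  each y of \<Omega> it is constant on the open time interval and, by continuity, on its closure.
  The constant may depend on y, hence only increments in time are determined.\<close>

lemma time_derivative_determines_increments:
  fixes \<Omega> :: "(real ^ 'n) set"
  assumes \<Omega>: "open \<Omega>" and T: "T \<noteq> -\<infinity>"
    and f: "f1 \<in> neg_primitives T \<Omega> g b l" "f2 \<in> neg_primitives T \<Omega> g b l"
    and t: "t \<in> time_closed T" "t' \<in> time_closed T" and y: "y \<in> \<Omega>"
  shows "f1 (t, y) - f1 (t', y) = f2 (t, y) - f2 (t', y)"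
proof -
  define U where "U = open_cyl T \<Omega>"
  have U: "open U" unfolding U_def by (rule open_open_cyl[OF \<Omega>])
  have sub: "U \<subseteq> cyl T (closure \<Omega>)" unfolding U_def by (rule open_cyl_subset)
  have h: "f1 \<in> holder_space T (closure \<Omega>) g b" "f2 \<in> holder_space T (closure \<Omega>) g b"
    and d: "distr_dt T \<Omega> (regular_distr U f1) = distr_dt T \<Omega> (regular_distr U f2)"
    using f by (auto simp: neg_primitives_def U_def)
  define u where "u z = f1 z - f2 z" for z
  have cu': "continuous_on (cyl T (closure \<Omega>)) u"
    unfolding u_def using holder_spaceD(1)[OF h(1)] holder_spaceD(1)[OF h(2)] by (intro continuous_intros)
  have cu: "continuous_on U f1" "continuous_on U f2" "continuous_on U u"
    using holder_spaceD(1)[OF h(1)] holder_spaceD(1)[OF h(2)] cu' sub by (auto intro: continuous_on_subset)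
  have bf: "bounded (f1 ` U)" "bounded (f2 ` U)"
    using holder_spaceD(2)[OF h(1)] holder_spaceD(2)[OF h(2)] sub by (auto intro: bounded_subset)
  then have bu: "bounded (u ` U)" unfolding u_def by (rule bounded_minus_comp)
  have weak: "(\<integral>z. indicator U z * (u z * pd (1, 0) \<phi> z) \<partial>lborel) = 0" if \<phi>: "\<phi> \<in> test_functions U" for \<phi>
  proof -
    note p = test_function_pd(1)[OF \<phi>]
    note i = integrable_mult_compact_lipschitz[OF cu(1) bf(1) U compact_lipschitz_test_function[OF p]]
      integrable_mult_compact_lipschitz[OF cu(2) bf(2) U compact_lipschitz_test_function[OF p]]
    have "regular_distr U f1 (pd (1, 0) \<phi>) = regular_distr U f2 (pd (1, 0) \<phi>)"
      using fun_cong[OF d, of \<phi>] \<phi> by (simp add: distr_dt_def distr_deriv_def U_def pd_def)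
    then have "(\<integral>z. indicator U z * (f1 z * pd (1, 0) \<phi> z) \<partial>lborel) = (\<integral>z. indicator U z * (f2 z * pd (1, 0) \<phi> z) \<partial>lborel)"
      using p by (simp add: regular_distr_def set_lebesgue_integral_def)
    moreover have "(\<lambda>z. indicator U z * (u z * pd (1, 0) \<phi> z)) =
        (\<lambda>z. indicator U z * (f1 z * pd (1, 0) \<phi> z) - indicator U z * (f2 z * pd (1, 0) \<phi> z))"
      by (auto simp: u_def algebra_simps)
    ultimately show ?thesis using i by simp
  qed
  have seg: "{s..s'} \<times> {y} \<subseteq> U" if "s' \<in> time_open T" for s s'
    using that y by (auto simp: U_def open_cyl_def time_open_def intro: order_le_less_trans[of "ereal _" "ereal s'"])
  have const: "u (s, y) = u (s', y)" if "s \<in> time_open T" "s' \<in> time_open T" for s s'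
  proof (cases "s \<le> s'")
    case True
    then show ?thesis using weak_time_derivative_zero_imp_constant[OF cu(3) bu U seg[OF that(2)] _ weak] by blast
  next
    case False
    then show ?thesis using weak_time_derivative_zero_imp_constant[OF cu(3) bu U seg[OF that(1)] _ weak, of s'] by auto
  qed
  have cont: "continuous_on (closure (time_open T)) (\<lambda>s. u (s, y))"
    by (rule continuous_on_compose2[OF cu'])
      (use y closure_subset in \<open>auto simp: cyl_def time_closed_def intro!: continuous_intros\<close>)
  obtain s0 where s0: "s0 \<in> time_open T"
    using t(1) time_closed_def[of T] by (metis closure_empty ex_in_conv)
  have "u (s, y) = u (s0, y)" if "s \<in> time_closed T" for s
    using continuous_constant_on_closure[OF cont const[OF _ s0]] that unfolding time_closed_def by blast
  then have "u (t, y) = u (t', y)" using t by simp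
  then show ?thesis by (simp add: u_def)
qed

section \<open>The potential as an integral over lags\<close>

context heat_domain
begin

definition zero_ext :: "ereal \<Rightarrow> (real \<times> (real ^ 'n) \<Rightarrow> real) \<Rightarrow> real \<times> (real ^ 'n) \<Rightarrow> real" where
  "zero_ext T f z = indicator \<Omega> (snd z) * f (clamp_time T (fst z), snd z)"

text \<open>The constant is the norm of f itself, so the bounds for potentials become operator
  bounds. Measurability comes from continuity on the open set
  \<open>UNIV \<times> \<Omega>\<close>.\<close>

lemma holder_density_zero_ext:
  assumes \<Omega>: "open \<Omega>" and T: "T \<noteq> -\<infinity>" and f: "f \<in> holder_space T (closure \<Omega>) \<gamma> b"
  shows "holder_density (enn2real (holder_norm T (closure \<Omega>) \<gamma> b f)) (zero_ext T f)"
proof -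
  note H = holder_spaceD[OF f]
  have cl: "y \<in> closure \<Omega>" if "y \<in> \<Omega>" for y using that closure_subset by blast
  have "continuous_on (UNIV \<times> \<Omega>) (\<lambda>z. f (clamp_time T (fst z), snd z))"
    by (rule continuous_on_compose2[OF H(1)])
      (auto intro!: continuous_intros continuous_on_compose2[OF clamp_time(4)[OF T]] simp: cyl_def clamp_time[OF T] cl)
  moreover have "UNIV \<times> \<Omega> \<in> sets (borel :: (real \<times> (real ^ 'n)) measure)"
    using \<Omega> by (intro borel_open open_Times) auto
  ultimately have "(\<lambda>z. indicator (UNIV \<times> \<Omega>) z *\<^sub>R f (clamp_time T (fst z), snd z)) \<in> borel_measurable borel"
    using borel_measurable_continuous_on_indicator by blast
  then have "zero_ext T f \<in> borel_measurable borel"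
    by (rule back_subst[of "\<lambda>h. h \<in> borel_measurable borel"]) (auto simp: zero_ext_def indicator_def)
  moreover have "\<bar>zero_ext T f z\<bar> \<le> enn2real (holder_norm T (closure \<Omega>) \<gamma> b f)" for z
    using H(3,5) clamp_time(1)[OF T] cl by (auto simp: zero_ext_def indicator_def)
  moreover have "\<bar>zero_ext T f (t, y) - zero_ext T f (t', y)\<bar> \<le> enn2real (holder_norm T (closure \<Omega>) \<gamma> b f) * \<bar>t - t'\<bar> powr \<gamma>" for t t' y
  proof (cases "y \<in> \<Omega>")
    case True
    have "\<bar>f (clamp_time T t, y) - f (clamp_time T t', y)\<bar> \<le> enn2real (holder_norm T (closure \<Omega>) \<gamma> b f) * \<bar>clamp_time T t - clamp_time T t'\<bar> powr \<gamma>"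
      using True by (intro H(6) clamp_time[OF T] cl)
    also have "\<dots> \<le> enn2real (holder_norm T (closure \<Omega>) \<gamma> b f) * \<bar>t - t'\<bar> powr \<gamma>"
      using \<gamma> H(3) by (intro mult_left_mono powr_mono2 clamp_time[OF T]) auto
    finally show ?thesis using True by (simp add: zero_ext_def)
  qed (use H(3) in \<open>simp add: zero_ext_def\<close>)
  ultimately show ?thesis by (auto simp: holder_density_def zero_ext_def)
qed

text \<open>For \<tau> < t both times lie in the time interval, where clamping is the identity; the
  substitution s = t - \<tau> and Fubini then pass from the iterated integral to the joint
  one.\<close>

lemma heat_potential_of_eq_pot:
  assumes T: "T \<noteq> -\<infinity>" and t: "t \<in> time_closed T" and int: "integrable lborel (integrand {0<..} heat_t (zero_ext T f) t x)"
  shows "heat_potential_of \<Omega> f (t, x) = pot {0<..} heat_t (zero_ext T f) t x"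
proof -
  let ?g = "\<lambda>s. \<integral>y. integrand {0<..} heat_t (zero_ext T f) t x (s, y) \<partial>lborel"
  have "heat_potential_of \<Omega> f (t, x) = (\<integral>\<tau>. ?g (t + (- 1) * \<tau>) \<partial>lborel)"
    unfolding heat_potential_of_def prod.case set_lebesgue_integral_def
  proof (rule Bochner_Integration.integral_cong[OF refl])
    fix \<tau> :: real
    show "indicator {..<t} \<tau> *\<^sub>R (\<integral>y. indicator \<Omega> y *\<^sub>R (deriv (\<lambda>s. heat_kernel s (x - y)) (t - \<tau>) * (f (\<tau>, y) - f (t, y))) \<partial>lborel)
        = ?g (t + (- 1) * \<tau>)"
    proof (cases "\<tau> < t")
      case True
      have d: "deriv (\<lambda>s. heat_kernel s (x - y)) (t - \<tau>) = heat_t (t - \<tau>) (x - y)" for y :: "real ^ 'n"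
        using True by (intro DERIV_imp_deriv DERIV_heat_kernel_t) simp
      have c: "clamp_time T \<tau> = \<tau>" "clamp_time T t = t"
        using clamp_time(2)[OF T] t time_closed_past[OF T t True] time_open_subset_closed by blast+
      have "?g (t + (- 1) * \<tau>) = (\<integral>y. indicator \<Omega> y *\<^sub>R (heat_t (t - \<tau>) (x - y) * (f (\<tau>, y) - f (t, y))) \<partial>lborel)"
        by (intro Bochner_Integration.integral_cong[OF refl])
          (use True in \<open>auto simp: integrand_def zero_ext_def c indicator_def\<close>)
      then show ?thesis using True by (simp add: d)
    qed (simp add: integrand_def)
  qed
  also have "\<dots> = (\<integral>s. ?g s \<partial>lborel)"
    using lborel_integral_real_affine[of "- 1" ?g t] by simp
  also have "\<dots> = pot {0<..} heat_t (zero_ext T f) t x"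
    unfolding pot_def by (rule Fubini_lborel(1)[OF int, symmetric])
  finally show ?thesis .
qed

lemma pot_linear_density:
  assumes "integrable lborel (integrand I \<Phi> F t x)" "integrable lborel (integrand I \<Phi> G t x)"
  shows "pot I \<Phi> (\<lambda>z. a * F z + b * G z) t x = a * pot I \<Phi> F t x + b * pot I \<Phi> G t x"
proof -
  have "integrand I \<Phi> (\<lambda>z. a * F z + b * G z) t x = (\<lambda>p. a * integrand I \<Phi> F t x p + b * integrand I \<Phi> G t x p)"
    by (auto simp: integrand_def algebra_simps)
  then show ?thesis unfolding pot_def using assms by simp
qed

text \<open>\<open>heat_tx\<close> is linear in its direction; this makes the candidate for the
  space derivative a bounded linear map in h.\<close>

lemma pot_heat_tx_axis:
  assumes "\<And>v. integrable lborel (integrand I (heat_tx v) F t x)"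
  shows "pot I (heat_tx h) F t x = (\<Sum>i\<in>UNIV. h $ i * pot I (heat_tx (axis i 1)) F t x)"
proof -
  have "heat_tx h s z = (\<Sum>i\<in>UNIV. h $ i * heat_tx (axis i 1) s z)" for s z
  proof -
    have "z \<bullet> h = (\<Sum>i\<in>UNIV. h $ i * (z \<bullet> axis i 1))" 
      by (simp add: inner_axis) (simp add: inner_vec_def mult.commute)
    then show ?thesis by (simp add: heat_tx_def sum_distrib_left sum_distrib_right mult_ac)
  qed
  then have "integrand I (heat_tx h) F t x = (\<lambda>p. \<Sum>i\<in>UNIV. h $ i * integrand I (heat_tx (axis i 1)) F t x p)"
    by (auto simp: integrand_def sum_distrib_left sum_distrib_right mult_ac)
  then show ?thesis unfolding pot_def using assms by simp
qed

text \<open>The first order Taylor estimate with remainder \<open>O(|h| powr (2 * \<gamma>))\<close>, \<open>2 * \<gamma> > 1\<close>, identifies the gradient.\<close>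

lemma has_derivative_pot:
  assumes int: "\<And>v. integrable lborel (integrand {0<..} (heat_tx v) F t x)"
    and taylor: "\<And>h. \<bar>pot {0<..} heat_t F t (x + h) - pot {0<..} heat_t F t x - pot {0<..} (heat_tx h) F t x\<bar> \<le> A * norm h powr (2 * \<gamma>)"
  shows "((\<lambda>w. pot {0<..} heat_t F t w) has_derivative (\<lambda>h. pot {0<..} (heat_tx h) F t x)) (at x)"
proof (rule has_derivativeI)
  have "bounded_linear (\<lambda>h. \<Sum>i\<in>UNIV. h $ i * pot {0<..} (heat_tx (axis i 1)) F t x)"
    by (rule bounded_linear_sum) (rule bounded_linear_compose[OF bounded_linear_mult_left bounded_linear_vec_nth])
  moreover have "(\<lambda>h. pot {0<..} (heat_tx h) F t x) = (\<lambda>h. \<Sum>i\<in>UNIV. h $ i * pot {0<..} (heat_tx (axis i 1)) F t x)"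
    by (rule ext) (rule pot_heat_tx_axis[OF int])
  ultimately show "bounded_linear (\<lambda>h. pot {0<..} (heat_tx h) F t x)" by (simp only:)
  show "((\<lambda>y. (pot {0<..} heat_t F t y - pot {0<..} heat_t F t x - pot {0<..} (heat_tx (y - x)) F t x) /\<^sub>R norm (y - x)) \<longlongrightarrow> 0) (at x)"
  proof (rule Lim_null_comparison)
    have "((\<lambda>y. norm (y - x)) \<longlongrightarrow> norm (x - x)) (at x)" by (intro tendsto_intros)
    then have "((\<lambda>y. norm (y - x)) \<longlongrightarrow> 0) (at x)" by simp
    then have "((\<lambda>y. norm (y - x) powr (2 * \<gamma> - 1)) \<longlongrightarrow> 0) (at x)"
      by (rule tendsto_powr_null) (use \<gamma> in simp_all)
    then show "((\<lambda>y. A * norm (y - x) powr (2 * \<gamma> - 1)) \<longlongrightarrow> 0) (at x)" by (rule tendsto_mult_right_zero)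
    show "eventually (\<lambda>y. norm ((pot {0<..} heat_t F t y - pot {0<..} heat_t F t x - pot {0<..} (heat_tx (y - x)) F t x) /\<^sub>R norm (y - x))
        \<le> A * norm (y - x) powr (2 * \<gamma> - 1)) (at x)"
      unfolding eventually_at_filter
    proof (rule always_eventually, intro allI impI)
      fix y assume "y \<noteq> x"
      then have n: "0 < norm (y - x)" by simp
      have "norm (y - x) powr (2 * \<gamma> - 1) = norm (y - x) powr (2 * \<gamma>) / norm (y - x)"
        using n by (simp add: powr_diff)
      moreover have "\<bar>pot {0<..} heat_t F t y - pot {0<..} heat_t F t x - pot {0<..} (heat_tx (y - x)) F t x\<bar> / norm (y - x)
          \<le> A * norm (y - x) powr (2 * \<gamma>) / norm (y - x)"
        using taylor[of "y - x"] by (intro divide_right_mono) simp_all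
      ultimately show "norm ((pot {0<..} heat_t F t y - pot {0<..} heat_t F t x - pot {0<..} (heat_tx (y - x)) F t x) /\<^sub>R norm (y - x))
        \<le> A * norm (y - x) powr (2 * \<gamma> - 1)"
        by (simp add: abs_mult divide_inverse mult_ac)
    qed
  qed
qed

end

text \<open>A positive real factor is invertible in \<open>ennreal\<close>: divide by c, take the
  infimum, multiply back. This passes from primitives to the quotient norm, also when the infimum
  runs over an empty set.\<close>

lemma le_mult_INF_ennreal:
  assumes "0 < c" "\<And>f. f \<in> S \<Longrightarrow> X \<le> ennreal c * N f"
  shows "X \<le> ennreal c * (INF f\<in>S. N f)"
proof -
  have one: "ennreal c * ennreal (1 / c) = 1" "ennreal (1 / c) * ennreal c = 1"
    using assms(1) by (simp_all flip: ennreal_mult)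
  have "ennreal (1 / c) * X \<le> N f" if "f \<in> S" for f
  proof -
    have "ennreal (1 / c) * X \<le> ennreal (1 / c) * (ennreal c * N f)"
      by (intro mult_left_mono assms that) simp
    then show ?thesis using one by (simp add: mult.assoc[symmetric])
  qed
  then have "ennreal c * (ennreal (1 / c) * X) \<le> ennreal c * (INF f\<in>S. N f)"
    by (intro mult_left_mono INF_greatest) auto
  then show ?thesis using one by (simp add: mult.assoc[symmetric])
qed

section \<open>Independence of the primitive, the equation, the norm bound and linearity\<close>

context heat_domain
begin

text \<open>The integrand sees a primitive only through its time increments over \<Omega>, and these
  coincide for all primitives, so the one picked by \<open>SOME\<close> may be replaced by any
  f.\<close>

lemma heat_potential_eq_pot:
  assumes \<Omega>: "open \<Omega>" and T: "T \<noteq> -\<infinity>" and \<gamma>\<alpha>: "\<gamma> = (1 + \<alpha>) / 2"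
    and f: "f \<in> neg_primitives T \<Omega> \<gamma> b g" and t: "t \<in> time_closed T"
  shows "heat_potential T \<Omega> \<alpha> b g (t, x) = pot {0<..} heat_t (zero_ext T f) t x"
proof -
  define f0 where "f0 = (SOME f. f \<in> neg_primitives T \<Omega> ((1 + \<alpha>) / 2) b g)"
  have f0: "f0 \<in> neg_primitives T \<Omega> \<gamma> b g"
    unfolding f0_def \<gamma>\<alpha>[symmetric] using f unfolding some_in_eq by blast
  have int: "integrable lborel (integrand {0<..} heat_t (zero_ext T h) t x)" if "h \<in> neg_primitives T \<Omega> \<gamma> b g" for h
    using pot_estimates holder_density_zero_ext[OF \<Omega> T, of h b] that by (auto simp: neg_primitives_def pot_bounds_def)
  have "integrand {0<..} heat_t (zero_ext T f0) t x = integrand {0<..} heat_t (zero_ext T f) t x"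
  proof
    fix p :: "real \<times> (real ^ 'n)"
    obtain s y where p: "p = (s, y)" by (cases p)
    show "integrand {0<..} heat_t (zero_ext T f0) t x p = integrand {0<..} heat_t (zero_ext T f) t x p"
    proof (cases "0 < s \<and> y \<in> \<Omega>")
      case True
      then have "t - s \<in> time_closed T"
        using time_closed_past[OF T t, of "t - s"] time_open_subset_closed by auto
      then have "zero_ext T f0 (t - s, y) - zero_ext T f0 (t, y) = zero_ext T f (t - s, y) - zero_ext T f (t, y)"
        using time_derivative_determines_increments[OF \<Omega> T f0 f _ t, of "t - s" y] True t
        by (simp add: zero_ext_def clamp_time[OF T])
      then show ?thesis by (simp add: integrand_def p)
    qed (auto simp: integrand_def zero_ext_def p)
  qed
  then have "pot {0<..} heat_t (zero_ext T f0) t x = pot {0<..} heat_t (zero_ext T f) t x"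
    by (simp add: pot_def)
  moreover have "heat_potential T \<Omega> \<alpha> b g (t, x) = heat_potential_of \<Omega> f0 (t, x)"
    by (simp add: heat_potential_def f0_def)
  ultimately show ?thesis using heat_potential_of_eq_pot[OF T t int[OF f0]] by simp
qed

lemma regular_distr_pot:
  assumes \<phi>: "\<phi> \<in> test_functions (open_cyl T \<Omega>)"
    and eq: "\<And>t x. t \<in> time_closed T \<Longrightarrow> u (t, x) = v (t, x)"
  shows "regular_distr (open_cyl T \<Omega>) u \<phi> = (\<integral>z. v z * \<phi> z \<partial>lborel)"
proof -
  have *: "indicator (open_cyl T \<Omega>) z * (u z * \<phi> z) = v z * \<phi> z" for z
  proof (cases "z \<in> open_cyl T \<Omega>")
    case True
    then have "u z = v z" using eq time_open_subset_closed by (cases z) (auto simp: open_cyl_def)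
    then show ?thesis using True by simp
  qed (simp add: test_functionD(7)[OF \<phi>])
  have "regular_distr (open_cyl T \<Omega>) u \<phi> = (\<integral>z. indicator (open_cyl T \<Omega>) z * (u z * \<phi> z) \<partial>lborel)"
    using \<phi> by (simp add: regular_distr_def set_lebesgue_integral_def)
  then show ?thesis by (simp only: *)
qed

text \<open>Moving one time derivative onto \<phi> costs a sign and moving two space derivatives
  costs none, so the claim on test functions is the weak identity multiplied by -1. On all other
  arguments both sides are 0 by the encoding of distributions.\<close>

lemma heat_potential_solves:
  assumes \<Omega>: "open \<Omega>" and T: "T \<noteq> -\<infinity>" and f: "f \<in> neg_primitives T \<Omega> \<gamma> b g"
    and P: "\<And>t x. t \<in> time_closed T \<Longrightarrow> P (t, x) = pot {0<..} heat_t (zero_ext T f) t x"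
  shows "(\<lambda>\<phi>. distr_dt T \<Omega> (regular_distr (open_cyl T \<Omega>) P) \<phi>
     - distr_laplacian T \<Omega> (regular_distr (open_cyl T \<Omega>) P) \<phi>) = g"
proof
  fix \<phi>
  let ?U = "open_cyl T \<Omega>"
  define F where "F = zero_ext T f"
  define M where "M = enn2real (holder_norm T (closure \<Omega>) \<gamma> b f)"
  have fh: "f \<in> holder_space T (closure \<Omega>) \<gamma> b" and g: "g = distr_dt T \<Omega> (regular_distr ?U f)"
    using f by (auto simp: neg_primitives_def)
  have F: "holder_density M F" unfolding F_def M_def by (rule holder_density_zero_ext[OF \<Omega> T fh])
  define v where "v z = pot {0<..} heat_t F (fst z) (snd z)" for z
  have Pv: "P (t, x) = v (t, x)" if "t \<in> time_closed T" for t x using P[OF that] by (simp add: v_def F_def)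
  show "distr_dt T \<Omega> (regular_distr ?U P) \<phi> - distr_laplacian T \<Omega> (regular_distr ?U P) \<phi> = g \<phi>"
  proof (cases "\<phi> \<in> test_functions ?U")
    case True
    note pt = test_function_pd(1)[OF True] and px = test_function_pd(2)[OF True]
    have dt: "distr_dt T \<Omega> (regular_distr ?U P) \<phi> = - (\<integral>z. v z * pd (1, 0) \<phi> z \<partial>lborel)"
      using True regular_distr_pot[where u = P and v = v, OF pt Pv] by (simp add: distr_dt_def distr_deriv_def pd_def)
    have dl: "distr_laplacian T \<Omega> (regular_distr ?U P) \<phi> = (\<Sum>i\<in>UNIV. \<integral>z. v z * pd (0, axis i 1) (pd (0, axis i 1) \<phi>) z \<partial>lborel)"
    proof -
      have "distr_deriv ?U (0, axis i 1) (distr_deriv ?U (0, axis i 1) (regular_distr ?U P)) \<phi>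
          = (\<integral>z. v z * pd (0, axis i 1) (pd (0, axis i 1) \<phi>) z \<partial>lborel)" for i
        using True px[of i] regular_distr_pot[where u = P and v = v, OF test_function_pd(2)[OF px[of i], of i] Pv]
        by (simp add: distr_deriv_def pd_def)
      then show ?thesis by (simp add: distr_laplacian_def)
    qed
    have dg: "g \<phi> = - (\<integral>z. F z * pd (1, 0) \<phi> z \<partial>lborel)"
    proof -
      have *: "indicator ?U z * (f z * pd (1, 0) \<phi> z) = F z * pd (1, 0) \<phi> z" for z
      proof (cases "z \<in> ?U")
        case True
        then have "F z = f z"
          using time_open_subset_closed[THEN subsetD, THEN clamp_time(2)[OF T]]
          by (cases z) (auto simp: open_cyl_def F_def zero_ext_def)
        then show ?thesis using True by simp
      qed (simp add: test_functionD(7)[OF pt])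
      have "regular_distr ?U f (pd (1, 0) \<phi>) = (\<integral>z. indicator ?U z * (f z * pd (1, 0) \<phi> z) \<partial>lborel)"
        using pt by (simp add: regular_distr_def set_lebesgue_integral_def)
      also have "\<dots> = (\<integral>z. F z * pd (1, 0) \<phi> z \<partial>lborel)" by (simp only: *)
      finally show ?thesis using True by (simp add: g distr_dt_def distr_deriv_def pd_def)
    qed
    obtain C where C: "0 < C" and est: "\<And>t x. \<bar>pot {0<..} heat_t F t x\<bar> \<le> C * M"
      using pot_estimates F unfolding pot_bounds_def by blast
    have vb: "\<bar>v z\<bar> \<le> C * M" for z unfolding v_def by (rule est)
    have vi: "integrable lborel (\<lambda>z. v z * f z)" if "f \<in> test_functions ?U" for f
    proof -
      note cl = compact_lipschitz_test_function[OF that]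
      have "(\<lambda>p. heat_t (fst p) (snd p :: real ^ 'n)) \<in> borel_measurable borel" by measurable
      then have [measurable]: "v \<in> borel_measurable borel" unfolding v_def by (rule measurable_pot[OF _ F]) simp
      note [measurable] = compact_lipschitz_measurable[OF cl]
      have "integrable lborel (\<lambda>z. C * M * f z)" by (intro integrable_mult_right compact_lipschitz_integrable cl)
      then show ?thesis
        by (rule Bochner_Integration.integrable_bound)
          (use vb C holder_densityD(5)[OF F] in \<open>auto intro!: AE_I2 mult_right_mono simp: abs_mult\<close>)
    qed
    have "(\<integral>z. v z * (pd (1, 0) \<phi> z + lap \<phi> z) \<partial>lborel) = (\<integral>z. v z * pd (1, 0) \<phi> z \<partial>lborel)
        + (\<Sum>i\<in>UNIV. \<integral>z. v z * pd (0, axis i 1) (pd (0, axis i 1) \<phi>) z \<partial>lborel)"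
      unfolding distrib_left lap_def sum_distrib_left
      using vi[OF pt] vi[OF test_function_pd(2)[OF px]] by (subst Bochner_Integration.integral_add) auto
    then show ?thesis
      using heat_potential_weak[OF F True] unfolding dt dl dg v_def by simp
  next
    case False
    then show ?thesis by (simp add: g distr_dt_def distr_laplacian_def distr_deriv_def)
  qed
qed

lemma heat_potential_holder1:
  assumes \<Omega>: "open \<Omega>" and T: "T \<noteq> -\<infinity>" and \<gamma>\<alpha>: "\<gamma> = (1 + \<alpha>) / 2" and F: "holder_density M F"
    and P: "\<And>t x. t \<in> time_closed T \<Longrightarrow> P (t, x) = pot {0<..} heat_t F t x"
    and C: "0 < C" and bnds: "pot_bounds C M F"
  shows "P \<in> holder1_space T \<Omega> \<alpha>" "holder1_norm T \<Omega> \<alpha> P \<le> ennreal (C * (2 + 3 * real CARD('n)) * M)"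
proof -
  have M: "0 \<le> M" by (rule holder_densityD[OF F])
  have CM: "0 \<le> C * M" using C M by simp
  note est = bnds[unfolded pot_bounds_def, rule_format]
  have exps: "2 * \<gamma> - 1 = \<alpha>" "\<gamma> - 1/2 = \<alpha> / 2" "0 < \<alpha>" using \<gamma> \<gamma>\<alpha> by (auto simp: field_simps)
  define G where "G i t x = pot {0<..} (heat_tx (axis i 1)) F t x" for i t x
  have G: "\<bar>G i t x\<bar> \<le> C * M" "\<bar>G i t x - G i t' x\<bar> \<le> C * M * \<bar>t - t'\<bar> powr (\<alpha> / 2)"
    "\<bar>G i t x - G i t x'\<bar> \<le> C * M * norm (x - x') powr \<alpha>" for i t t' x x'
    using est[where t = t and x = x and v = "axis i 1" and t' = t'] est[where t = t and x = x' and v = "axis i 1" and h = "x - x'"]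
    unfolding G_def exps by (simp_all add: norm_axis_1)
  have deriv: "((\<lambda>w. P (t, w)) has_derivative (\<lambda>h. pot {0<..} (heat_tx h) F t x)) (at x)" if t: "t \<in> time_closed T" for t x
    unfolding P[OF t] by (rule has_derivative_pot[where A = "C * M"]) (use est in blast)+
  have frechet: "frechet_derivative (\<lambda>w. P (t, w)) (at x) (axis i 1) = G i t x" if "t \<in> time_closed T" for t x i
    using frechet_derivative_at[OF deriv[OF that, of x]] by (metis G_def)
  have cont_G: "continuous_on D (\<lambda>x. G i t x)" for D i t
    unfolding continuous_on_def
  proof
    fix x
    have "((\<lambda>x'. norm (x' - x)) \<longlongrightarrow> norm (x - x)) (at x within D)" by (intro tendsto_intros)
    then have "((\<lambda>x'. norm (x' - x)) \<longlongrightarrow> 0) (at x within D)" by simp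
    then have "((\<lambda>x'. norm (x' - x) powr \<alpha>) \<longlongrightarrow> 0) (at x within D)"
      by (rule tendsto_powr_null) (use exps in simp_all)
    then have "((\<lambda>x'. C * M * norm (x' - x) powr \<alpha>) \<longlongrightarrow> 0) (at x within D)" by (rule tendsto_mult_right_zero)
    then have "((\<lambda>x'. G i t x' - G i t x) \<longlongrightarrow> 0) (at x within D)"
      by (rule Lim_null_comparison[rotated]) (use G(3) in \<open>auto simp: eventually_at_filter\<close>)
    then show "((\<lambda>x'. G i t x') \<longlongrightarrow> G i t x) (at x within D)" by (rule LIM_zero_cancel)
  qed
  \<comment> \<open>\<open>G i t\<close> is continuous on the whole space, so at a boundary point
    the limit from \<Omega> in \<open>space_pderiv\<close> exists and is the value of
    \<open>G i t\<close>. Such a point is in the closure but not in \<Omega>, hence the filter is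
    nontrivial and \<open>Lim\<close> is meaningful.\<close>
  have spd: "space_pderiv \<Omega> i P (t, x) = G i t x" if t: "t \<in> time_closed T" and x: "x \<in> closure \<Omega>" for i t x
  proof (cases "x \<in> \<Omega>")
    case True
    then show ?thesis using frechet[OF t] by (simp add: space_pderiv_def)
  next
    case False
    then have "at x within \<Omega> \<noteq> bot"
      using x by (simp add: closure_def trivial_limit_within)
    moreover have "((\<lambda>y. G i t y) \<longlongrightarrow> G i t x) (at x within \<Omega>)"
      using cont_G[of UNIV i t] by (auto simp: continuous_on_def intro: tendsto_within_subset)
    ultimately have "Lim (at x within \<Omega>) (\<lambda>y. G i t y) = G i t x" by (rule tendsto_Lim)
    then show ?thesis using False frechet[OF t] by (simp add: space_pderiv_def)
  qed
  have spd_holder: "space_pderiv \<Omega> i P \<in> holder_space T (closure \<Omega>) (\<alpha> / 2) \<alpha>"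
    "holder_norm T (closure \<Omega>) (\<alpha> / 2) \<alpha> (space_pderiv \<Omega> i P) \<le> ennreal (3 * (C * M))" for i
    by (rule holder_spaceI[where A = "C * M"]; use CM exps G in \<open>simp add: spd\<close>)+
  have time: "\<bar>P (t, x) - P (t', x)\<bar> \<le> C * M * \<bar>t - t'\<bar> powr \<gamma>" if "t \<in> time_closed T" "t' \<in> time_closed T" for t t' x
    using est[where t = t and x = x and t' = t'] that by (simp add: P)
  have sup: "\<bar>P (t, x)\<bar> \<le> C * M" if "t \<in> time_closed T" for t x
    using est[where t = t and x = x] that by (simp add: P)
  \<comment> \<open>One \<open>C * M\<close> each for the sup norm and the time seminorm, three for
    each partial derivative.\<close>
  have n: "holder1_norm T \<Omega> \<alpha> P \<le> ennreal (C * M) + ennreal (C * M) + (\<Sum>i\<in>(UNIV :: 'n set). ennreal (3 * (C * M)))"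
    unfolding holder1_norm_def \<gamma>\<alpha>[symmetric]
    by (intro add_mono sup_norm_le time_seminorm_le sum_mono spd_holder time) (auto simp: cyl_def sup)
  also have "\<dots> = ennreal (C * M + C * M + (\<Sum>i\<in>(UNIV :: 'n set). 3 * (C * M)))"
  proof -
    have "0 \<le> (\<Sum>i\<in>(UNIV :: 'n set). 3 * (C * M))" using CM by (intro sum_nonneg) simp
    then show ?thesis using CM by (simp add: sum_ennreal del: sum_constant flip: ennreal_plus)
  qed
  also have "C * M + C * M + (\<Sum>i\<in>(UNIV :: 'n set). 3 * (C * M)) = C * (2 + 3 * real CARD('n)) * M"
    by (simp add: algebra_simps)
  finally show norm: "holder1_norm T \<Omega> \<alpha> P \<le> ennreal (C * (2 + 3 * real CARD('n)) * M)" .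
  have "continuous_on (closure \<Omega>) (\<lambda>x. P (t, x))" if "t \<in> time_closed T" for t
    using has_derivative_continuous[OF deriv[OF that]] continuous_at_imp_continuous_on by blast
  then have "continuous_on (cyl T (closure \<Omega>)) P"
    unfolding cyl_def using time \<gamma> by (intro continuous_on_cyl[where g = \<gamma> and A = "C * M"]) auto
  moreover have "bounded (P ` cyl T (closure \<Omega>))"
    unfolding bounded_iff using sup by (auto simp: cyl_def)
  moreover have "space_C1 T \<Omega> P"
    unfolding space_C1_def
  proof (intro ballI conjI allI)
    fix t assume t: "t \<in> time_closed T"
    show "(\<lambda>w. P (t, w)) differentiable at x" for x using deriv[OF t] by (auto simp: differentiable_def)
    show "continuous_on (closure \<Omega>) (\<lambda>x. space_pderiv \<Omega> i P (t, x))" for i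
      using cont_G[of "closure \<Omega>" i t] by (subst continuous_on_cong[OF refl spd[OF t]]) auto
  qed
  ultimately show "P \<in> holder1_space T \<Omega> \<alpha>"
    using spd_holder(1) norm by (auto simp: holder1_space_def intro: order_le_less_trans)
qed

text \<open>Linearity of the potential is not visible through the choice operator; it is obtained by
  evaluating the potential of a combination with the same combination of primitives.\<close>

lemma neg_primitives_linear:
  fixes f h :: "real \<times> (real ^ 'n) \<Rightarrow> real"
  assumes \<Omega>: "open \<Omega>" and b: "0 < b"
    and f: "f \<in> neg_primitives T \<Omega> \<gamma> b g" and h: "h \<in> neg_primitives T \<Omega> \<gamma> b k"
  shows "(\<lambda>z. p * f z + q * h z) \<in> neg_primitives T \<Omega> \<gamma> b (\<lambda>\<phi>. p * g \<phi> + q * k \<phi>)"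
proof -
  let ?U = "open_cyl T \<Omega>"
  have hs: "f \<in> holder_space T (closure \<Omega>) \<gamma> b" "h \<in> holder_space T (closure \<Omega>) \<gamma> b"
    and d: "g = distr_dt T \<Omega> (regular_distr ?U f)" "k = distr_dt T \<Omega> (regular_distr ?U h)"
    using f h by (auto simp: neg_primitives_def)
  note sub = open_cyl_subset[of T \<Omega>] and U = open_open_cyl[OF \<Omega>, of T]
  have "p * g \<phi> + q * k \<phi> = distr_dt T \<Omega> (regular_distr ?U (\<lambda>z. p * f z + q * h z)) \<phi>" for \<phi>
  proof (cases "\<phi> \<in> test_functions ?U")
    case True
    note pt = test_function_pd(1)[OF True]
    have i: "integrable lborel (\<lambda>z. indicator ?U z * (u z * pd (1, 0) \<phi> z))" if "u \<in> holder_space T (closure \<Omega>) \<gamma> b" for u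
      using holder_spaceD(1,2)[OF that] sub
      by (intro integrable_mult_compact_lipschitz U compact_lipschitz_test_function[OF pt])
        (auto intro: continuous_on_subset bounded_subset)
    have "(\<lambda>z. indicator ?U z * ((p * f z + q * h z) * pd (1, 0) \<phi> z)) =
        (\<lambda>z. p * (indicator ?U z * (f z * pd (1, 0) \<phi> z)) + q * (indicator ?U z * (h z * pd (1, 0) \<phi> z)))"
      by (auto simp: algebra_simps)
    then have "regular_distr ?U (\<lambda>z. p * f z + q * h z) (pd (1, 0) \<phi>) =
        p * regular_distr ?U f (pd (1, 0) \<phi>) + q * regular_distr ?U h (pd (1, 0) \<phi>)"
      using pt i[OF hs(1)] i[OF hs(2)] by (simp add: regular_distr_def set_lebesgue_integral_def)
    then show ?thesis using True by (simp add: d distr_dt_def distr_deriv_def pd_def)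
  qed (simp add: d distr_dt_def distr_deriv_def)
  then show ?thesis
    using holder_space_linear[OF hs _ b, of p q] \<gamma> by (auto simp: neg_primitives_def)
qed

end

theorem theorem4p4:
  fixes \<Omega> :: "(real ^ 'n) set" and T :: ereal and \<alpha> \<beta> :: real
  assumes "CARD('n) \<ge> 2"
    and "open \<Omega>" and "bounded \<Omega>"
    and "T \<noteq> -\<infinity>"
    and "0 < \<alpha>" and "\<alpha> < 1" and "0 < \<beta>" and "\<beta> < 1"
  defines "X \<equiv> neg_holder_space T \<Omega> ((1 + \<alpha>) / 2) \<beta>"
    and "P \<equiv> heat_potential T \<Omega> \<alpha> \<beta>"
  shows "(\<forall>g\<in>X.
            (\<lambda>\<phi>. distr_dt T \<Omega> (regular_distr (open_cyl T \<Omega>) (P g)) \<phi>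
                 - distr_laplacian T \<Omega> (regular_distr (open_cyl T \<Omega>) (P g)) \<phi>) = g) \<and>
         ((\<forall>g\<in>X. P g \<in> holder1_space T \<Omega> \<alpha>) \<and>
          (\<forall>g\<in>X. \<forall>h\<in>X. \<forall>a b :: real. \<forall>z\<in>cyl T (closure \<Omega>).
             P (\<lambda>\<phi>. a * g \<phi> + b * h \<phi>) z = a * P g z + b * P h z) \<and>
          (\<exists>C::real. C \<ge> 0 \<and>
             (\<forall>g\<in>X. holder1_norm T \<Omega> \<alpha> (P g)
                      \<le> ennreal C * neg_holder_norm T \<Omega> ((1 + \<alpha>) / 2) \<beta> g)))"
proof -
  define \<gamma> where "\<gamma> = (1 + \<alpha>) / 2"
  interpret heat_domain \<Omega> \<gamma>
  proof
    show "emeasure lborel \<Omega> < \<infinity>" by (rule emeasure_bounded_finite[OF assms(3)])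
  qed (use assms in \<open>auto simp: \<gamma>_def\<close>)
  note \<Omega> = \<open>open \<Omega>\<close> and T = \<open>T \<noteq> -\<infinity>\<close>
  have prim: "\<exists>f. f \<in> neg_primitives T \<Omega> \<gamma> \<beta> g" if "g \<in> X" for g
    using that by (auto simp: X_def neg_holder_space_def \<gamma>_def)
  have P: "P g (t, x) = pot {0<..} heat_t (zero_ext T f) t x"
    if "f \<in> neg_primitives T \<Omega> \<gamma> \<beta> g" "t \<in> time_closed T" for f g t x
    unfolding P_def using heat_potential_eq_pot[OF \<Omega> T \<gamma>_def that] .
  have dens: "holder_density (enn2real (holder_norm T (closure \<Omega>) \<gamma> \<beta> f)) (zero_ext T f)"
    and norm: "holder_norm T (closure \<Omega>) \<gamma> \<beta> f = ennreal (enn2real (holder_norm T (closure \<Omega>) \<gamma> \<beta> f))"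
    if "f \<in> neg_primitives T \<Omega> \<gamma> \<beta> g" for f g
    using holder_density_zero_ext[OF \<Omega> T, of f \<beta>] holder_spaceD(4)[of f T "closure \<Omega>" \<gamma> \<beta>] that
    by (auto simp: neg_primitives_def)
  obtain C where C: "0 < C" and est: "\<And>M F. holder_density M F \<Longrightarrow> pot_bounds C M F"
    using pot_estimates by blast
  define K where "K = C * (2 + 3 * real CARD('n))"
  have K: "0 < K" using C by (simp add: K_def add_pos_nonneg)
  \<comment> \<open>The bound is stated for an arbitrary primitive with a constant independent of
    it, so the infimum that defines the quotient norm can be taken.\<close>
  have hold: "P g \<in> holder1_space T \<Omega> \<alpha>" "holder1_norm T \<Omega> \<alpha> (P g) \<le> ennreal K * holder_norm T (closure \<Omega>) \<gamma> \<beta> f"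
    if f: "f \<in> neg_primitives T \<Omega> \<gamma> \<beta> g" for f g
  proof -
    note d = dens[OF f]
    note r = heat_potential_holder1[OF \<Omega> T \<gamma>_def d P[OF f] C est[OF d]]
    show "P g \<in> holder1_space T \<Omega> \<alpha>" by (rule r(1))
    have "ennreal (K * enn2real (holder_norm T (closure \<Omega>) \<gamma> \<beta> f)) = ennreal K * holder_norm T (closure \<Omega>) \<gamma> \<beta> f"
      using K by (subst (2) norm[OF f]) (simp add: ennreal_mult)
    then show "holder1_norm T \<Omega> \<alpha> (P g) \<le> ennreal K * holder_norm T (closure \<Omega>) \<gamma> \<beta> f"
      using r(2) by (simp add: K_def)
  qed
  show ?thesis
  proof (intro conjI ballI allI)
    fix g assume "g \<in> X"
    then obtain f where f: "f \<in> neg_primitives T \<Omega> \<gamma> \<beta> g" using prim by blast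
    show "(\<lambda>\<phi>. distr_dt T \<Omega> (regular_distr (open_cyl T \<Omega>) (P g)) \<phi>
        - distr_laplacian T \<Omega> (regular_distr (open_cyl T \<Omega>) (P g)) \<phi>) = g"
      by (rule heat_potential_solves[OF \<Omega> T f P[OF f]])
    show "P g \<in> holder1_space T \<Omega> \<alpha>" by (rule hold(1)[OF f])
  next
    fix g h a b z assume "g \<in> X" "h \<in> X" and z: "z \<in> cyl T (closure \<Omega>)"
    then obtain f1 f2 where f: "f1 \<in> neg_primitives T \<Omega> \<gamma> \<beta> g" "f2 \<in> neg_primitives T \<Omega> \<gamma> \<beta> h"
      using prim by blast
    obtain t x where tx: "z = (t, x)" "t \<in> time_closed T" using z by (auto simp: cyl_def)
    have "zero_ext T (\<lambda>z. a * f1 z + b * f2 z) = (\<lambda>z. a * zero_ext T f1 z + b * zero_ext T f2 z)"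
      by (auto simp: zero_ext_def algebra_simps)
    then show "P (\<lambda>\<phi>. a * g \<phi> + b * h \<phi>) z = a * P g z + b * P h z"
      using P[OF neg_primitives_linear[OF \<Omega> \<open>0 < \<beta>\<close> f] tx(2)] P[OF f(1) tx(2)] P[OF f(2) tx(2)]
        pot_linear_density[of "{0<..}" heat_t "zero_ext T f1" t x "zero_ext T f2" a b]
        est[OF dens[OF f(1)]] est[OF dens[OF f(2)]] by (simp add: tx(1) pot_bounds_def)
  next
    show "\<exists>C::real. C \<ge> 0 \<and> (\<forall>g\<in>X. holder1_norm T \<Omega> \<alpha> (P g) \<le> ennreal C * neg_holder_norm T \<Omega> ((1 + \<alpha>) / 2) \<beta> g)"
      unfolding neg_holder_norm_def \<gamma>_def[symmetric] using K
      by (intro exI[of _ K] conjI ballI le_mult_INF_ennreal hold(2)) auto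
  qed
qed

end
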